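(* Let $\sigma>0$ and let $(\mathcal M,g)$ be an admissible Riemannian manifold, $\mathcal M=\mathbf V$. Let $I>2$, let $0\le t_1<\ldots<t_I\le1$ and $\bar y_1,\ldots,\bar y_I\in\mathcal M$, and choose one of the natural, Hermite, or periodic boundary conditions. Then there exists a spline interpolation $y\in W^{2,2}((0,1);\mathbf V)$, i.e. a minimizer of the regularized spline energy $\mathcal F^\sigma$ among all curves in $W^{2,2}((0,1);\mathbf V)$ which satisfy the interpolation constraints $y(t_i)=\bar y_i$, $i=1,\ldots,I$, and the chosen boundary condition. Furthermore, $y\in C^{2,\frac12}([\delta,1-\delta];\mathbf V)$ for every $\delta\in(0,\tfrac12)$.
   Context: **Admissible manifold and metric.** $\mathbf V$ is a separable real Hilbert space compactly embedded in a real Banach space $\mathbf Y$ (the identity $\mathbf V\to\mathbf Y$ is a compact linear operator); $\mathcal M=\mathbf V$ is the admissible manifold, with $T_y\mathcal M=\mathbf V$. A Riemannian metric $g$ on $\mathcal M$ is admissible if it extends to a function $g:\mathbf Y\times\mathbf V\times\mathbf V\to\mathbb R$ of the form $g_y(v,w)=g^c_y(v,w)+\mathcal Q(v,w)$ such that, for all $y\in\mathbf Y$, $v\in\mathbf V$: (i) $g^c$ is symmetric (bilinear) in the last two arguments and $g^c_y(v,v)\le C^\ast\|v\|_{\mathbf Y}^2$ for some constant $C^\ast$; (ii) $g^c$ is twice differentiable with bounded derivatives as a function $g^c:\mathbf Y\to\mathbf Y'\otimes\mathbf Y'$ (primes denote duals; the tensor product carries the topology of the injective cross norm); (iii) $\mathcal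 Q$ is symmetric, positive semi-definite and bilinear on $\mathbf V\times\mathbf V$ with $\mathcal Q(v,v)\le C^{\ast\ast}\|v\|_{\mathbf V}^2$ for some constant $C^{\ast\ast}$; (iv) $c^\ast\|v\|_{\mathbf V}^2\le g_y(v,v)$ for some $c^\ast>0$. **Energies.** The Christoffel operator $\Gamma_y:\mathbf V\times\mathbf V\to\mathbf V$ is defined by $2g_y(\Gamma_y(v,w),z)=(D_yg_y)(w)(v,z)-(D_yg_y)(z)(v,w)+(D_yg_y)(v)(w,z)$ for all $z\in\mathbf V$, where $D_y$ is the derivative with respect to $y$ and the first bracket after $D_yg_y$ contains its direction. The covariant derivative of the velocity of a curve $y:[0,1]\to\mathcal M$ is $\tfrac{D}{\mathrm dt}\dot y=\ddot y+\Gamma_y(\dot y,\dot y)$. Set $\mathcal E[y]=\int_0^1g_{y}(\dot y,\dot y)\,\mathrm dt$, $\mathcal F[y]=\int_0^1g_{y}\left(\tfrac{D}{\mathrm dt}\dot y,\tfrac{D}{\mathrm dt}\dot y\right)\mathrm dt$, and $\mathcal F^\sigma=\mathcal F+\sigma\mathcal E$. **Boundary conditions.** Natural: formally $\tfrac{D}{\mathrm dt}\dot y(0)=\tfrac{D}{\mathrm dt}\dot y(1)=0$, which is interpreted as imposing no boundary condition at all in the minimization. Hermite: $\dot y(0)=v_0$, $\dot y(1)=v_1$ for given $v_0,v_1\in\mathbf V$; in this case it is additionally assumed that $t_1=0$ and $t_I=1$. Periodic: $y(0)=y(1)$, $\dot y(0)=\dot y(1)$; in this case it is additionally assumed that $t_1\ne0$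 or $t_I\ne1$. *)

theory Defs
  imports "HOL-Analysis.Analysis"
begin

section \<open>The injective tensor product of the dual with itself\<close>

definition dual_tensor ::
  "('y::real_normed_vector \<Rightarrow>\<^sub>L real) \<Rightarrow> ('y \<Rightarrow>\<^sub>L real) \<Rightarrow> ('y \<Rightarrow>\<^sub>L 'y \<Rightarrow>\<^sub>L real)"
  where "dual_tensor f h = blinfun_scaleR_left h o\<^sub>L f"

lemma dual_tensor_apply [simp]: "dual_tensor f h x z = f x * h z"
  by (simp add: dual_tensor_def blinfun.scaleR_left)

text \<open>An element of the (completed) injective tensor product of \<open>Y'\<close> with itself is regarded as a
  bounded bilinear form on \<open>Y\<close>. This is legitimate since on the algebraic tensor product
  the operator norm of bilinear forms is the injective cross norm, which by definition is a
  supremum over functionals in the unit ball of \<open>Y''\<close>; see \<open>norm_sum_dual_tensor\<close>.\<close>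

definition injective_tensor :: "('y::real_normed_vector \<Rightarrow>\<^sub>L 'y \<Rightarrow>\<^sub>L real) set"
  where "injective_tensor = closure (span {dual_tensor f h |f h. True})"

lemma norm_sum_dual_tensor:
  fixes f h :: "'i \<Rightarrow> ('y::real_normed_vector \<Rightarrow>\<^sub>L real)"
  shows "norm (\<Sum>i\<in>A. dual_tensor (f i) (h i)) =
    (SUP p \<in> {p :: (('y \<Rightarrow>\<^sub>L real) \<Rightarrow>\<^sub>L real) \<times> (('y \<Rightarrow>\<^sub>L real) \<Rightarrow>\<^sub>L real).
        norm (fst p) \<le> 1 \<and> norm (snd p) \<le> 1}.
       \<bar>\<Sum>i\<in>A. blinfun_apply (fst p) (f i) * blinfun_apply (snd p) (h i)\<bar>)"
    (is "norm ?B = (SUP p\<in>?U. ?F p)")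
proof (rule antisym)
  have upper: "?F p \<le> norm ?B" if "p \<in> ?U" for p
  proof -
    define \<phi> \<psi> where p: "\<phi> = fst p" "\<psi> = snd p"
    have 1: "norm \<phi> \<le> 1" "norm \<psi> \<le> 1"
      using that by (auto simp: p)
    let ?G = "\<Sum>i\<in>A. \<psi> (h i) *\<^sub>R f i"
    have "norm ?G \<le> norm ?B"
    proof (rule norm_blinfun_bound)
      fix x
      have "?G x = \<psi> (?B x)"
        by (simp add: blinfun.sum_left blinfun.sum_right blinfun.scaleR_left blinfun.scaleR_right
            dual_tensor_def mult.commute)
      moreover have "norm (\<psi> (?B x)) \<le> norm \<psi> * norm (?B x)"
        by (rule norm_blinfun)
      moreover have "norm \<psi> * norm (?B x) \<le> 1 * norm (?B x)"
        using 1 by (intro mult_right_mono) auto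
      moreover have "norm (?B x) \<le> norm ?B * norm x"
        by (rule norm_blinfun)
      ultimately show "norm (?G x) \<le> norm ?B * norm x" by simp
    qed simp
    moreover have "norm (\<phi> ?G) \<le> norm \<phi> * norm ?G"
      by (rule norm_blinfun)
    moreover have "norm \<phi> * norm ?G \<le> 1 * norm ?G"
      using 1 by (intro mult_right_mono) auto
    moreover have "?F p = norm (\<phi> ?G)"
      by (simp add: p[symmetric] blinfun.sum_right blinfun.scaleR_right mult.commute)
    ultimately show ?thesis by simp
  qed
  have ne: "(0, 0) \<in> ?U" by simp
  show "(SUP p\<in>?U. ?F p) \<le> norm ?B"
    using ne upper by (intro cSUP_least) blast+
  have bdd: "bdd_above (?F ` ?U)"
    using upper by (intro bdd_aboveI2)
  let ?S = "SUP p\<in>?U. ?F p"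
  have S0: "0 \<le> ?S"
    using cSUP_upper[OF ne bdd] by simp
  define ev :: "'y \<Rightarrow> (('y \<Rightarrow>\<^sub>L real) \<Rightarrow>\<^sub>L real)" where "ev x = Blinfun (\<lambda>g. blinfun_apply g x)" for x
  have ev: "ev x g = g x" for x g
    unfolding ev_def by (subst bounded_linear_Blinfun_apply)
      (auto intro: bounded_linear_intros)
  have ev_norm: "norm (ev x) \<le> norm x" for x
    by (rule norm_blinfun_bound, simp) (metis ev norm_blinfun mult.commute)
  have unit: "\<bar>?B x z\<bar> \<le> ?S" if "norm x \<le> 1" "norm z \<le> 1" for x z
  proof -
    have "(ev x, ev z) \<in> ?U"
      using that ev_norm[of x] ev_norm[of z] by auto
    from cSUP_upper[OF this bdd] show ?thesis
      by (simp add: ev blinfun.sum_left)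
  qed
  have bound: "\<bar>?B x z\<bar> \<le> ?S * norm x * norm z" for x z
  proof (cases "x = 0 \<or> z = 0")
    case True
    then show ?thesis by (auto simp: blinfun.zero_right)
  next
    case False
    then have "\<bar>?B (x /\<^sub>R norm x) (z /\<^sub>R norm z)\<bar> \<le> ?S"
      by (intro unit) auto
    then have "\<bar>?B x z\<bar> / (norm x * norm z) \<le> ?S"
      by (simp only: blinfun.scaleR_right blinfun.scaleR_left real_scaleR_def abs_mult)
        (simp add: field_simps)
    with False show ?thesis by (simp add: field_simps)
  qed
  show "norm ?B \<le> ?S"
    using S0 bound by (intro norm_blinfun_bound) (auto simp: mult_nonneg_nonneg)
qed


section \<open>Admissible manifold and metric\<close>

definition compact_operator :: "('v::real_normed_vector \<Rightarrow> 'y::real_normed_vector) \<Rightarrow> bool"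
  where "compact_operator T \<longleftrightarrow>
    bounded_linear T \<and> (\<forall>S. bounded S \<longrightarrow> compact (closure (T ` S)))"

definition compact_embedding :: "('v::real_normed_vector \<Rightarrow> 'y::real_normed_vector) \<Rightarrow> bool"
  where "compact_embedding \<iota> \<longleftrightarrow> compact_operator \<iota> \<and> inj \<iota>"

text \<open>The manifold is the space \<open>V\<close> itself, embedded in \<open>Y\<close> by \<open>\<iota>\<close>; \<open>g y v w\<close> is the metric at
  \<open>y\<close>. Its extension to base points \<open>p\<close> in \<open>Y\<close> is \<open>gc p (\<iota> v) (\<iota> w) + Q v w\<close>.\<close>

definition admissible_metric ::
  "('v::real_inner \<Rightarrow> 'y::real_normed_vector) \<Rightarrow> ('v \<Rightarrow> 'v \<Rightarrow> 'v \<Rightarrow> real) \<Rightarrow> bool"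
  where "admissible_metric \<iota> g \<longleftrightarrow>
    (\<exists>(gc :: 'y \<Rightarrow> ('y \<Rightarrow>\<^sub>L 'y \<Rightarrow>\<^sub>L real)) (Q :: 'v \<Rightarrow> 'v \<Rightarrow> real).
      range gc \<subseteq> injective_tensor \<and>
      (\<forall>y v w. g y v w = gc (\<iota> y) (\<iota> v) (\<iota> w) + Q v w) \<and>
      (\<forall>p v w. gc p (\<iota> v) (\<iota> w) = gc p (\<iota> w) (\<iota> v)) \<and>
      (\<exists>C. \<forall>p v. gc p (\<iota> v) (\<iota> v) \<le> C * (norm (\<iota> v))\<^sup>2) \<and>
      (\<exists>(D1 :: 'y \<Rightarrow> ('y \<Rightarrow>\<^sub>L ('y \<Rightarrow>\<^sub>L 'y \<Rightarrow>\<^sub>L real)))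
        (D2 :: 'y \<Rightarrow> ('y \<Rightarrow>\<^sub>L ('y \<Rightarrow>\<^sub>L ('y \<Rightarrow>\<^sub>L 'y \<Rightarrow>\<^sub>L real)))).
          (\<forall>p. (gc has_derivative blinfun_apply (D1 p)) (at p)) \<and>
          (\<forall>p. (D1 has_derivative blinfun_apply (D2 p)) (at p)) \<and>
          bounded (range D1) \<and> bounded (range D2)) \<and>
      bilinear Q \<and>
      (\<forall>v w. Q v w = Q w v) \<and>
      (\<forall>v. 0 \<le> Q v v) \<and>
      (\<exists>C. \<forall>v. Q v v \<le> C * (norm v)\<^sup>2) \<and>
      (\<exists>c>0. \<forall>p v. c * (norm v)\<^sup>2 \<le> gc p (\<iota> v) (\<iota> v) + Q v v))"

text \<open>\<open>metric_deriv g y u v w\<close> is the derivative of \<open>p \<mapsto> g p v w\<close> at \<open>y\<close> in direction \<open>u\<close>.\<close>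

definition metric_deriv ::
  "('v::real_normed_vector \<Rightarrow> 'v \<Rightarrow> 'v \<Rightarrow> real) \<Rightarrow> 'v \<Rightarrow> 'v \<Rightarrow> 'v \<Rightarrow> 'v \<Rightarrow> real"
  where "metric_deriv g y u v w = frechet_derivative (\<lambda>p. g p v w) (at y) u"

definition christoffel ::
  "('v::real_normed_vector \<Rightarrow> 'v \<Rightarrow> 'v \<Rightarrow> real) \<Rightarrow> 'v \<Rightarrow> 'v \<Rightarrow> 'v \<Rightarrow> 'v"
  where "christoffel g y v w =
    (THE u. \<forall>z. 2 * g y u z =
       metric_deriv g y w v z - metric_deriv g y z v w + metric_deriv g y v w z)"


section \<open>Sobolev and Hoelder regularity of curves\<close>

text \<open>Test functions on the open interval \<open>(0,1)\<close>, extended by zero to the real line.\<close>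

definition test_function :: "(real \<Rightarrow> real) \<Rightarrow> bool"
  where "test_function \<phi> \<longleftrightarrow>
    (\<forall>k t. (deriv ^^ k) \<phi> differentiable (at t)) \<and>
    (\<exists>a b. 0 < a \<and> b < 1 \<and> (\<forall>t. t \<notin> {a..b} \<longrightarrow> \<phi> t = 0))"

definition locally_integrable :: "(real \<Rightarrow> 'v::{banach, second_countable_topology}) \<Rightarrow> bool"
  where "locally_integrable f \<longleftrightarrow>
    (\<forall>a b. 0 < a \<longrightarrow> b < 1 \<longrightarrow> integrable (lebesgue_on {a..b}) f)"

definition has_weak_derivative ::
  "(real \<Rightarrow> 'v::{banach, second_countable_topology}) \<Rightarrow> (real \<Rightarrow> 'v) \<Rightarrow> bool"
  where "has_weak_derivative f u \<longleftrightarrow>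
    locally_integrable f \<and> locally_integrable u \<and>
    (\<forall>\<phi>. test_function \<phi> \<longrightarrow>
      (LINT t|lebesgue_on {0<..<1}. deriv \<phi> t *\<^sub>R f t) =
      - (LINT t|lebesgue_on {0<..<1}. \<phi> t *\<^sub>R u t))"

definition weak_derivative ::
  "(real \<Rightarrow> 'v::{banach, second_countable_topology}) \<Rightarrow> real \<Rightarrow> 'v"
  where "weak_derivative f = (SOME u. has_weak_derivative f u)"

definition square_integrable :: "(real \<Rightarrow> 'v::{banach, second_countable_topology}) \<Rightarrow> bool"
  where "square_integrable f \<longleftrightarrow>
    f \<in> borel_measurable (lebesgue_on {0<..<1}) \<and>
    integrable (lebesgue_on {0<..<1}) (\<lambda>t. (norm (f t))\<^sup>2)"

text \<open>The curves of class \<open>W\<^sup>2\<^sup>,\<^sup>2\<close> on \<open>(0,1)\<close>. Each equivalence class modulo null sets is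
  represented by its member that is continuous on \<open>[0,1]\<close>, which is even continuously
  differentiable there. So point values and the classical velocity, one-sided at the end points,
  make sense. Values outside \<open>[0,1]\<close> are irrelevant.\<close>

definition W22 :: "(real \<Rightarrow> 'v::{banach, second_countable_topology}) set"
  where "W22 = {y. continuous_on {0..1} y \<and>
    (\<exists>u w. has_weak_derivative y u \<and> has_weak_derivative u w \<and>
       square_integrable y \<and> square_integrable u \<and> square_integrable w)}"

definition velocity :: "(real \<Rightarrow> 'v::real_normed_vector) \<Rightarrow> real \<Rightarrow> 'v"
  where "velocity y t = vector_derivative y (at t within {0..1})"

definition holder_C2 :: "real \<Rightarrow> real set \<Rightarrow> (real \<Rightarrow> 'v::real_normed_vector) \<Rightarrow> bool"
  where "holder_C2 \<alpha> S y \<longleftrightarrow>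
    (\<exists>y1 y2.
      (\<forall>t\<in>S. (y has_vector_derivative y1 t) (at t within S)) \<and>
      (\<forall>t\<in>S. (y1 has_vector_derivative y2 t) (at t within S)) \<and>
      continuous_on S y2 \<and>
      (\<exists>C. \<forall>s\<in>S. \<forall>t\<in>S. norm (y2 s - y2 t) \<le> C * \<bar>s - t\<bar> powr \<alpha>))"


section \<open>Energies\<close>

text \<open>The second derivative of a curve exists only in the weak sense and up to null sets, which
  do not affect the energies. For an admissible metric the integrands below are nonnegative, and they
  are integrable for every curve in \<open>W22\<close>, so the integrals never take their default value.\<close>

definition covariant_accel ::
  "('v::{real_inner, banach, second_countable_topology} \<Rightarrow> 'v \<Rightarrow> 'v \<Rightarrow> real) \<Rightarrow>
    (real \<Rightarrow> 'v) \<Rightarrow> real \<Rightarrow> 'v"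
  where "covariant_accel g y t =
    weak_derivative (velocity y) t + christoffel g (y t) (velocity y t) (velocity y t)"

definition path_energy ::
  "('v::{real_inner, banach, second_countable_topology} \<Rightarrow> 'v \<Rightarrow> 'v \<Rightarrow> real) \<Rightarrow>
    (real \<Rightarrow> 'v) \<Rightarrow> real"
  where "path_energy g y =
    (LINT t|lebesgue_on {0<..<1}. g (y t) (velocity y t) (velocity y t))"

definition spline_energy ::
  "('v::{real_inner, banach, second_countable_topology} \<Rightarrow> 'v \<Rightarrow> 'v \<Rightarrow> real) \<Rightarrow>
    (real \<Rightarrow> 'v) \<Rightarrow> real"
  where "spline_energy g y =
    (LINT t|lebesgue_on {0<..<1}. g (y t) (covariant_accel g y t) (covariant_accel g y t))"

definition reg_spline_energy ::
  "real \<Rightarrow> ('v::{real_inner, banach, second_countable_topology} \<Rightarrow> 'v \<Rightarrow> 'v \<Rightarrow> real) \<Rightarrow>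
    (real \<Rightarrow> 'v) \<Rightarrow> real"
  where "reg_spline_energy \<sigma> g y = spline_energy g y + \<sigma> * path_energy g y"


section \<open>Boundary conditions and spline interpolations\<close>

datatype 'v boundary_condition = Natural | Hermite 'v 'v | Periodic

primrec satisfies_bc ::
  "'v boundary_condition \<Rightarrow> (real \<Rightarrow> 'v::real_normed_vector) \<Rightarrow> bool"
  where
    "satisfies_bc Natural y \<longleftrightarrow> True"
  | "satisfies_bc (Hermite v0 v1) y \<longleftrightarrow> velocity y 0 = v0 \<and> velocity y 1 = v1"
  | "satisfies_bc Periodic y \<longleftrightarrow> y 0 = y 1 \<and> velocity y 0 = velocity y 1"

text \<open>The additional assumption on the first and last interpolation time.\<close>

primrec bc_times_ok :: "'v boundary_condition \<Rightarrow> real \<Rightarrow> real \<Rightarrow> bool"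
  where
    "bc_times_ok Natural a b \<longleftrightarrow> True"
  | "bc_times_ok (Hermite v0 v1) a b \<longleftrightarrow> a = 0 \<and> b = 1"
  | "bc_times_ok Periodic a b \<longleftrightarrow> a \<noteq> 0 \<or> b \<noteq> 1"

definition interpolating_curves ::
  "nat \<Rightarrow> (nat \<Rightarrow> real) \<Rightarrow> (nat \<Rightarrow> 'v) \<Rightarrow> 'v boundary_condition \<Rightarrow>
    (real \<Rightarrow> 'v::{banach, second_countable_topology}) set"
  where "interpolating_curves I t ybar bc =
    {y \<in> W22. (\<forall>i\<in>{1..I}. y (t i) = ybar i) \<and> satisfies_bc bc y}"

definition is_spline_interpolation ::
  "real \<Rightarrow> ('v::{real_inner, banach, second_countable_topology} \<Rightarrow> 'v \<Rightarrow> 'v \<Rightarrow> real) \<Rightarrow>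
    nat \<Rightarrow> (nat \<Rightarrow> real) \<Rightarrow> (nat \<Rightarrow> 'v) \<Rightarrow> 'v boundary_condition \<Rightarrow> (real \<Rightarrow> 'v) \<Rightarrow> bool"
  where "is_spline_interpolation \<sigma> g I t ybar bc y \<longleftrightarrow>
    y \<in> interpolating_curves I t ybar bc \<and>
    (\<forall>z \<in> interpolating_curves I t ybar bc. reg_spline_energy \<sigma> g y \<le> reg_spline_energy \<sigma> g z)"

end

theory Submission
  imports Defs "HOL-Computational_Algebra.Polynomial" "HOL-Library.Diagonal_Subsequence"
begin

text \<open>A curve of class \<open>W\<^sup>2\<^sup>,\<^sup>2\<close> is determined by its initial position \<open>a\<close>, its initial velocity \<open>b\<close>
  and its acceleration \<open>w\<close>, and it depends linearly on \<open>(a, b, w)\<close>. So the admissible curves form a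
  closed affine subset of the Hilbert space \<open>V \<times> V \<times> L\<^sup>2\<close> (\<open>W22_imp_primitive_curve\<close>,
  \<open>primitive_curve_in_W22\<close>), which Hermite interpolation by polynomials shows to be nonempty. Of the metric
  the proof uses only what the locale \<open>spline_metric\<close> collects: ellipticity, and Lipschitz bounds for
  \<open>g\<close> and the Christoffel operator in which the dependence on position and velocity is measured in
  the weak norm of \<open>Y\<close>.

  Existence is the direct method. The path energy controls the velocity in \<open>L\<^sup>2\<close>; since the
  Christoffel term is quadratic in the velocity, the acceleration is then bounded in \<open>L\<^sup>1\<close>, the
  velocity uniformly, and so the acceleration in \<open>L\<^sup>2\<close> (\<open>curve_energy_coercive\<close>). A minimizing
  sequence is thus bounded in \<open>W\<^sup>2\<^sup>,\<^sup>2\<close>, and by the compact embedding a subsequence \<open>y\<^sub>j\<close> is uniformly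
  Cauchy in \<open>Y\<close> together with its velocities (\<open>uniformly_Cauchy_subsequence\<close>). The energy is not convex,
  but it becomes convex if the coefficients are evaluated along a fixed curve \<open>y\<^sub>j\<close>, which costs only an error
  that tends to zero with the distance to \<open>y\<^sub>j\<close> in \<open>Y\<close> (\<open>frozen_energy_close\<close>). Hence being close to
  \<open>y\<^sub>0, \<dots>, y\<^sub>j\<close> in \<open>Y\<close> and having almost minimal energy with coefficients along these curves defines a
  decreasing sequence of nonempty, bounded, closed, convex sets. They have a common
  point (\<open>decreasing_convex_sets_intersect\<close>), because elements of almost minimal norm form a Cauchy sequence by
  the parallelogram law, and the common point is a minimizer (\<open>curve_energy_minimizer\<close>). This
  plays the role of weak compactness and weak lower semicontinuity.

  For the regularity let \<open>m\<close> be the covariant acceleration of a minimizer, turned into a curve in \<open>V\<close> by the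
  Riesz isomorphism of the metric. Comparing the energy with that of perturbed curves gives
  \<open>\<bar>\<integral>h m\<bar> \<le> E \<bar>h\<^sub>1\<bar>\<close>, where \<open>h\<^sub>1\<close> is the primitive of \<open>h\<close>, measured in \<open>L\<^sup>2\<close>, and \<open>h\<close> is the second
  derivative of a scalar function that respects the constraints (\<open>first_variation_bound\<close>); the terms of
  lower order are estimated by the Lipschitz bounds. The interpolation
  constraints are removed by subtracting polynomials (\<open>remove_interpolation_constraints\<close>). If \<open>h\<close> is the
  difference of two averaging kernels, then \<open>h\<^sub>1\<close> is bounded by one and lives on a short interval. So the
  averages of \<open>m\<close> are Hoelder continuous with exponent one half, and so is \<open>m\<close>
  (\<open>Hoelder_representative\<close>). Inverting the Riesz isomorphism gives the Hoelder continuity of the second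
  derivative on all of \<open>[0,1]\<close> (\<open>minimizer_acceleration_Hoelder\<close>).\<close>

section \<open>Integration on the unit interval\<close>

abbreviation unit_measure :: "real measure"
  where "unit_measure \<equiv> lebesgue_on {0<..<1}"

interpretation unit_measure: finite_measure unit_measure
  by (rule finite_measure_lebesgue_on) auto

lemma borel_measurable_unit [measurable (raw)]:
  "f \<in> borel_measurable borel \<Longrightarrow> f \<in> borel_measurable unit_measure"
  by (auto intro!: measurable_restrict_space1 measurable_completion)

lemma integrable_unit_bounded:
  fixes f :: "real \<Rightarrow> 'v::{banach, second_countable_topology}"
  assumes "f \<in> borel_measurable unit_measure" and "\<And>t. 0 < t \<Longrightarrow> t < 1 \<Longrightarrow> norm (f t) \<le> C"
  shows "integrable unit_measure f"
  by (rule unit_measure.integrable_const_bound[where B=C]) (use assms in auto)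

lemma measure_unit_Ioc:
  assumes "0 \<le> s" "s \<le> t" "t \<le> 1"
  shows "(LINT x|unit_measure. indicator {s<..t} x) = t - s"
proof -
  have "(LINT x|unit_measure. indicator {s<..t} x :: real) = measure unit_measure ({s<..t} \<inter> {0<..<1})"
    by simp
  also have "\<dots> = measure lebesgue ({s<..t} \<inter> {0<..<1})"
    by (subst measure_restrict_space) auto
  also have "\<dots> = measure lebesgue {s<..<t}"
  proof (rule measure_eq_AE)
    have "AE x in lebesgue. x \<noteq> t"
      by (rule AE_completion) (rule AE_lborel_singleton)
    then show "AE x in lebesgue. (x \<in> {s<..t} \<inter> {0<..<1}) = (x \<in> {s<..<t})"
      by eventually_elim (use assms in auto)
  qed auto
  finally show ?thesis using assms by simp
qed

lemma AE_unit_lborel: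
  assumes "AE t in lborel. P t"
  shows "AE t in unit_measure. P t"
  using AE_completion[OF assms] by (subst AE_restrict_space_iff) (auto elim: eventually_mono)

lemma AE_unit_neq: "AE t in unit_measure. t \<noteq> c"
  by (rule AE_unit_lborel[OF AE_lborel_singleton])

lemma AE_unit_mem: "AE t in unit_measure. 0 < t \<and> t < 1"
  by (rule AE_I2) auto

lemma measure_unit [simp]: "measure unit_measure {0<..<1} = 1"
  by (simp add: measure_restrict_space)

lemma integral_unit_const [simp]:
  fixes c :: "'v::{banach, second_countable_topology}"
  shows "(LINT x|unit_measure. c) = c"
  by simp

text \<open>The primitive that vanishes at \<open>0\<close>. It is constant to the left of
  \<open>0\<close> and to the right of \<open>1\<close>, so it is a function on the whole real
  line.\<close>

definition primitive :: "(real \<Rightarrow> 'v::{banach, second_countable_topology}) \<Rightarrow> real \<Rightarrow> 'v"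
  where "primitive u t = (LINT s|unit_measure. indicat_real {..t} s *\<^sub>R u s)"

lemma integrable_unit_indicator:
  fixes u :: "real \<Rightarrow> 'v::{banach, second_countable_topology}"
  assumes "integrable unit_measure u" "A \<in> sets borel"
  shows "integrable unit_measure (\<lambda>s. indicat_real A s *\<^sub>R u s)"
proof (rule Bochner_Integration.integrable_bound[OF assms(1)])
  have [measurable]: "u \<in> borel_measurable unit_measure" using assms(1) by auto
  have [measurable]: "indicat_real A \<in> borel_measurable unit_measure"
    using assms(2) by (intro borel_measurable_unit) auto
  show "(\<lambda>s. indicat_real A s *\<^sub>R u s) \<in> borel_measurable unit_measure" by measurable
qed (auto simp: indicator_def)

lemma primitive_diff:
  assumes "integrable unit_measure u" "s \<le> t"
  shows "primitive u t - primitive u s = (LINT x|unit_measure. indicat_real {s<..t} x *\<^sub>R u x)"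
proof -
  have "primitive u t - primitive u s =
      (LINT x|unit_measure. indicat_real {..t} x *\<^sub>R u x - indicat_real {..s} x *\<^sub>R u x)"
    unfolding primitive_def
    by (rule Bochner_Integration.integral_diff[symmetric]) (auto intro!: integrable_unit_indicator assms)
  also have "\<dots> = (LINT x|unit_measure. indicat_real {s<..t} x *\<^sub>R u x)"
    by (rule Bochner_Integration.integral_cong) (use assms(2) in \<open>auto simp: indicator_def\<close>)
  finally show ?thesis .
qed

lemma primitive_0 [simp]: "primitive u 0 = 0"
proof -
  have "primitive u 0 = (LINT s|unit_measure. 0)"
    unfolding primitive_def by (rule Bochner_Integration.integral_cong) (auto simp: indicator_def)
  then show ?thesis by simp
qed

lemma primitive_1: "primitive u 1 = (LINT s|unit_measure. u s)"
  unfolding primitive_def by (rule Bochner_Integration.integral_cong) (auto simp: indicator_def)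

lemma primitive_cong_AE:
  assumes "AE t in unit_measure. u t = w t"
    "u \<in> borel_measurable unit_measure" "w \<in> borel_measurable unit_measure"
  shows "primitive u t = primitive w t"
proof -
  note [measurable] = assms(2,3)
  have [measurable]: "indicat_real {..t} \<in> borel_measurable unit_measure"
    by (intro borel_measurable_unit) auto
  show ?thesis unfolding primitive_def
    by (rule integral_cong_AE) (use assms(1) in \<open>auto elim: eventually_mono\<close>)
qed

lemma primitive_cong:
  assumes "\<And>t. 0 < t \<Longrightarrow> t < 1 \<Longrightarrow> u t = w t"
  shows "primitive u t = primitive w t"
  unfolding primitive_def by (rule Bochner_Integration.integral_cong) (use assms in auto)

lemma primitive_add:
  assumes "integrable unit_measure u" "integrable unit_measure w"
  shows "primitive (\<lambda>t. u t + w t) t = primitive u t + primitive w t"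
  unfolding primitive_def
  by (subst Bochner_Integration.integral_add[symmetric])
    (auto intro!: integrable_unit_indicator assms simp: scaleR_add_right)

lemma primitive_scaleR: "primitive (\<lambda>t. c *\<^sub>R u t) t = c *\<^sub>R primitive u t"
proof -
  have "primitive (\<lambda>t. c *\<^sub>R u t) t = (LINT s|unit_measure. c *\<^sub>R (indicat_real {..t} s *\<^sub>R u s))"
    unfolding primitive_def by (simp add: mult.commute)
  also have "\<dots> = c *\<^sub>R primitive u t"
    unfolding primitive_def by (rule integral_scaleR_right)
  finally show ?thesis .
qed

lemma primitive_minus:
  assumes "integrable unit_measure u" "integrable unit_measure v"
  shows "primitive (\<lambda>t. u t - v t) r = primitive u r - primitive v r"
  using primitive_add[OF assms(1) integrable_scaleR_right[OF assms(2), of "-1"], of r] primitive_scaleR[of "-1" v r]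
  by simp

lemma primitive_scaleR_left:
  assumes "integrable unit_measure h"
  shows "primitive (\<lambda>t. h t *\<^sub>R x) t = primitive h t *\<^sub>R x"
  unfolding primitive_def
  using integrable_unit_indicator[OF assms, of "{..t}"]
  by (subst integral_scaleR_left[symmetric]) auto

lemma norm_primitive_diff_le:
  assumes "integrable unit_measure u" "s \<le> t"
  shows "norm (primitive u t - primitive u s) \<le> (LINT x|unit_measure. indicat_real {s<..t} x * norm (u x))"
proof -
  have "norm (primitive u t - primitive u s) \<le> (LINT x|unit_measure. norm (indicat_real {s<..t} x *\<^sub>R u x))"
    unfolding primitive_diff[OF assms] by (rule integral_norm_bound)
  then show ?thesis by simp
qed

lemma norm_primitive_le:
  assumes "integrable unit_measure u"
  shows "norm (primitive u t) \<le> (LINT x|unit_measure. norm (u x))"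
proof -
  have "norm (primitive u t) \<le> (LINT x|unit_measure. norm (indicat_real {..t} x *\<^sub>R u x))"
    unfolding primitive_def by (rule integral_norm_bound)
  also have "\<dots> \<le> (LINT x|unit_measure. norm (u x))"
  proof (rule integral_mono)
    show "integrable unit_measure (\<lambda>x. norm (indicat_real {..t} x *\<^sub>R u x))"
      by (intro integrable_norm integrable_unit_indicator assms) auto
    show "integrable unit_measure (\<lambda>x. norm (u x))"
      by (intro integrable_norm assms)
  qed (auto simp: indicator_def)
  finally show ?thesis .
qed

text \<open>Where \<open>u\<close> is continuous, this bounds the difference quotients of its
  primitive from both sides, also at the end points of the unit interval.\<close>

lemma primitive_increment_approx:
  assumes u: "integrable unit_measure u" and st: "0 \<le> s" "s \<le> t" "t \<le> 1"
    and e: "\<And>x. s < x \<Longrightarrow> x < t \<Longrightarrow> norm (u x - c) \<le> e" and "0 \<le> e"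
  shows "norm (primitive u t - primitive u s - (t - s) *\<^sub>R c) \<le> e * (t - s)"
proof -
  have i: "integrable unit_measure (\<lambda>x. indicat_real {s<..t} x *\<^sub>R c)"
    by (rule integrable_unit_indicator) auto
  have "primitive u t - primitive u s - (t - s) *\<^sub>R c =
      (LINT x|unit_measure. indicat_real {s<..t} x *\<^sub>R u x) - (LINT x|unit_measure. indicat_real {s<..t} x *\<^sub>R c)"
    using integral_scaleR_left[of c unit_measure "indicat_real {s<..t}"] measure_unit_Ioc[OF st]
    by (simp add: primitive_diff[OF u st(2)] integrable_unit_bounded[where C=1] indicator_def)
  also have "\<dots> = (LINT x|unit_measure. indicat_real {s<..t} x *\<^sub>R (u x - c))"
    by (subst Bochner_Integration.integral_diff[symmetric])
      (auto intro!: integrable_unit_indicator u simp: scaleR_diff_right)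
  also have "norm \<dots> \<le> (LINT x|unit_measure. norm (indicat_real {s<..t} x *\<^sub>R (u x - c)))"
    by (rule integral_norm_bound)
  also have "\<dots> \<le> (LINT x|unit_measure. e * indicat_real {s<..t} x)"
  proof (rule integral_mono_AE)
    show "integrable unit_measure (\<lambda>x. norm (indicat_real {s<..t} x *\<^sub>R (u x - c)))"
      by (intro integrable_norm integrable_unit_indicator) (auto intro!: u)
    show "integrable unit_measure (\<lambda>x. e * indicat_real {s<..t} x)"
      by (intro integrable_mult_right integrable_unit_bounded[where C=1]) (auto simp: indicator_def)
    show "AE x in unit_measure. norm (indicat_real {s<..t} x *\<^sub>R (u x - c)) \<le> e * indicat_real {s<..t} x"
      using AE_unit_neq[of t] by eventually_elim (use e \<open>0 \<le> e\<close> in \<open>auto simp: indicator_def\<close>)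
  qed
  also have "\<dots> = e * (t - s)"
    by (simp add: measure_unit_Ioc[OF st] del: Bochner_Integration.integral_indicator)
  finally show ?thesis .
qed


lemma primitive_has_vector_derivative:
  assumes u: "integrable unit_measure u" and cont: "continuous_on {0..1} u" and t: "t \<in> {0..1}"
  shows "(primitive u has_vector_derivative u t) (at t within {0..1})"
  unfolding has_vector_derivative_def has_derivative_within_alt
proof (intro conjI allI impI)
  show "bounded_linear (\<lambda>h. h *\<^sub>R u t)" by (rule bounded_linear_scaleR_left)
  fix e :: real assume e: "0 < e"
  with cont t obtain d where d: "d > 0" "\<And>x. x \<in> {0..1} \<Longrightarrow> dist x t < d \<Longrightarrow> dist (u x) (u t) < e"
    unfolding continuous_on_iff by blast
  show "\<exists>d>0. \<forall>y\<in>{0..1}. norm (y - t) < d \<longrightarrow>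
      norm (primitive u y - primitive u t - (y - t) *\<^sub>R u t) \<le> e * norm (y - t)"
  proof (intro exI[of _ d] conjI ballI impI d(1))
    fix y :: real assume y: "y \<in> {0..1}" "norm (y - t) < d"
    show "norm (primitive u y - primitive u t - (y - t) *\<^sub>R u t) \<le> e * norm (y - t)"
    proof (cases "t \<le> y")
      case True
      have "norm (primitive u y - primitive u t - (y - t) *\<^sub>R u t) \<le> e * (y - t)"
      proof (rule primitive_increment_approx[OF u])
        fix x assume "t < x" "x < y"
        then show "norm (u x - u t) \<le> e"
          using d(2)[of x] y t by (simp add: dist_norm)
      qed (use True y t e in auto)
      with True show ?thesis by simp
    next
      case False
      have "norm (primitive u t - primitive u y - (t - y) *\<^sub>R u t) \<le> e * (t - y)"
      proof (rule primitive_increment_approx[OF u])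
        fix x assume "y < x" "x < t"
        then show "norm (u x - u t) \<le> e"
          using d(2)[of x] y t by (simp add: dist_norm)
      qed (use False y t e in auto)
      moreover have "norm (primitive u y - primitive u t - (y - t) *\<^sub>R u t) =
          norm (primitive u t - primitive u y - (t - y) *\<^sub>R u t)"
        by (subst norm_minus_cancel[symmetric]) (simp add: algebra_simps)
      ultimately show ?thesis using False by simp
    qed
  qed
qed

lemma continuous_bounded_unit:
  fixes u :: "real \<Rightarrow> 'v::real_normed_vector"
  assumes "continuous_on {0..1} u"
  obtains C where "\<And>t. t \<in> {0..1} \<Longrightarrow> norm (u t) \<le> C"
  using compact_imp_bounded[OF compact_continuous_image[OF assms compact_Icc]]
  unfolding bounded_iff by blast

lemma continuous_integrable_unit:
  fixes u :: "real \<Rightarrow> 'v::{banach, second_countable_topology}"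
  assumes "continuous_on {0..1} u"
  shows "integrable unit_measure u"
proof -
  obtain C where C: "\<And>t. t \<in> {0..1} \<Longrightarrow> norm (u t) \<le> C"
    by (rule continuous_bounded_unit[OF assms]) blast
  have "u \<in> borel_measurable unit_measure"
    by (rule continuous_imp_measurable_on_sets_lebesgue)
      (use assms in \<open>auto intro: continuous_on_subset\<close>)
  then show ?thesis
    by (rule integrable_unit_bounded[where C=C]) (use C in auto)
qed

text \<open>The fundamental theorem of calculus for the Bochner integral with values in any
  separable Banach space: the difference of both sides has derivative zero.\<close>

lemma primitive_of_derivative:
  fixes f :: "real \<Rightarrow> 'v::{banach, second_countable_topology}"
  assumes der: "\<And>t. 0 < t \<Longrightarrow> t < 1 \<Longrightarrow> (f has_vector_derivative f' t) (at t)"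
    and f: "continuous_on {0..1} f" and f': "continuous_on {0..1} f'"
    and t: "t \<in> {0..1}"
  shows "f t = f 0 + primitive f' t"
proof -
  note int = continuous_integrable_unit[OF f']
  note P = primitive_has_vector_derivative[OF int f']
  have "continuous_on {0..1} (primitive f')"
    unfolding continuous_on_eq_continuous_within
    using P by (blast intro: has_vector_derivative_continuous)
  with f have cont: "continuous_on {0..1} (\<lambda>t. f t - primitive f' t)"
    by (intro continuous_intros)
  have "((\<lambda>t. f t - primitive f' t) has_derivative (\<lambda>h. 0)) (at s within {0..1})"
    if "s \<in> {0..1} - {0,1}" for s
  proof -
    have "(f has_vector_derivative f' s) (at s within {0..1})"
      using der[of s] that by (auto intro: has_vector_derivative_at_within)
    from has_vector_derivative_diff[OF this P[of s]] that show ?thesis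
      by (simp add: has_vector_derivative_def)
  qed
  then have "f t - primitive f' t = f 0 - primitive f' 0"
    by (rule has_derivative_zero_unique_strong_interval[OF _ cont refl _ t, where k = "{0,1}", rotated]) auto
  then show ?thesis by (simp add: algebra_simps)
qed


section \<open>Square integrable functions\<close>

lemma square_integrable_measurable: "square_integrable f \<Longrightarrow> f \<in> borel_measurable unit_measure"
  and square_integrable_norm_sq: "square_integrable f \<Longrightarrow> integrable unit_measure (\<lambda>t. (norm (f t))\<^sup>2)"
  by (auto simp: square_integrable_def)

lemma le_one_plus_square: "x \<le> 1 + x\<^sup>2" for x :: real
  using zero_le_power2[of "x - 1/2"] by (simp add: power2_eq_square algebra_simps)

lemma square_integrable_imp_integrable:
  assumes "square_integrable f"
  shows "integrable unit_measure f"
proof (rule Bochner_Integration.integrable_bound)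
  show "integrable unit_measure (\<lambda>t. 1 + (norm (f t))\<^sup>2)"
    by (intro Bochner_Integration.integrable_add square_integrable_norm_sq assms) simp
  show "AE t in unit_measure. norm (f t) \<le> norm (1 + (norm (f t))\<^sup>2)"
    by (intro AE_I2) (simp add: abs_of_nonneg le_one_plus_square)
qed (rule square_integrable_measurable[OF assms])

lemma norm_add_sq_le: "(norm (x + y))\<^sup>2 \<le> 2 * (norm x)\<^sup>2 + 2 * (norm (y::'a::real_normed_vector))\<^sup>2"
proof -
  have "(norm (x + y))\<^sup>2 \<le> (norm x + norm y)\<^sup>2"
    by (intro power_mono norm_triangle_ineq) auto
  also have "\<dots> \<le> 2 * (norm x)\<^sup>2 + 2 * (norm y)\<^sup>2"
    using zero_le_power2[of "norm x - norm y"] by (simp add: power2_diff power2_sum)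
  finally show ?thesis .
qed

lemma square_integrable_bound:
  fixes f :: "real \<Rightarrow> 'v::{banach, second_countable_topology}"
  assumes "f \<in> borel_measurable unit_measure" "integrable unit_measure S"
    "AE t in unit_measure. (norm (f t))\<^sup>2 \<le> S t"
  shows "square_integrable f"
  unfolding square_integrable_def
proof (intro conjI assms(1) Bochner_Integration.integrable_bound[OF assms(2)])
  note [measurable] = assms(1)
  show "(\<lambda>t. (norm (f t))\<^sup>2) \<in> borel_measurable unit_measure" by measurable
  show "AE t in unit_measure. norm ((norm (f t))\<^sup>2) \<le> norm (S t)"
    using assms(3) by eventually_elim simp
qed

lemma square_integrable_bounded:
  fixes f :: "real \<Rightarrow> 'v::{banach, second_countable_topology}"
  assumes "f \<in> borel_measurable unit_measure" and "\<And>t. 0 < t \<Longrightarrow> t < 1 \<Longrightarrow> norm (f t) \<le> C"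
  shows "square_integrable f"
proof (rule square_integrable_bound[where S="\<lambda>_. C\<^sup>2"])
  show "AE t in unit_measure. (norm (f t))\<^sup>2 \<le> C\<^sup>2"
    by (rule AE_I2) (use assms(2) in \<open>auto intro!: power_mono\<close>)
qed (use assms(1) in auto)

lemma square_integrable_add:
  assumes "square_integrable f" "square_integrable h"
  shows "square_integrable (\<lambda>t. f t + h t)"
proof (rule square_integrable_bound[where S="\<lambda>t. 2 * (norm (f t))\<^sup>2 + 2 * (norm (h t))\<^sup>2"])
  note [measurable] = square_integrable_measurable[OF assms(1)] square_integrable_measurable[OF assms(2)]
  show "(\<lambda>t. f t + h t) \<in> borel_measurable unit_measure" by measurable
  show "integrable unit_measure (\<lambda>t. 2 * (norm (f t))\<^sup>2 + 2 * (norm (h t))\<^sup>2)"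
    by (intro Bochner_Integration.integrable_add integrable_mult_right square_integrable_norm_sq assms)
  show "AE t in unit_measure. (norm (f t + h t))\<^sup>2 \<le> 2 * (norm (f t))\<^sup>2 + 2 * (norm (h t))\<^sup>2"
    by (rule AE_I2) (rule norm_add_sq_le)
qed

lemma square_integrable_scaleR:
  assumes "square_integrable f"
  shows "square_integrable (\<lambda>t. c *\<^sub>R f t)"
proof (rule square_integrable_bound[where S="\<lambda>t. c\<^sup>2 * (norm (f t))\<^sup>2"])
  note [measurable] = square_integrable_measurable[OF assms(1)]
  show "(\<lambda>t. c *\<^sub>R f t) \<in> borel_measurable unit_measure" by measurable
  show "integrable unit_measure (\<lambda>t. c\<^sup>2 * (norm (f t))\<^sup>2)"
    by (intro integrable_mult_right square_integrable_norm_sq assms)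
qed (simp add: power_mult_distrib)

lemma square_integrable_diff:
  assumes "square_integrable f" "square_integrable h"
  shows "square_integrable (\<lambda>t. f t - h t)"
  using square_integrable_add[OF assms(1) square_integrable_scaleR[OF assms(2), of "-1"]] by simp

lemma integrable_square_integrable_mult:
  fixes f h :: "real \<Rightarrow> real"
  assumes "square_integrable f" "square_integrable h"
  shows "integrable unit_measure (\<lambda>t. f t * h t)"
proof (rule Bochner_Integration.integrable_bound)
  note [measurable] = square_integrable_measurable[OF assms(1)] square_integrable_measurable[OF assms(2)]
  show "(\<lambda>t. f t * h t) \<in> borel_measurable unit_measure" by measurable
  show "integrable unit_measure (\<lambda>t. (norm (f t))\<^sup>2 + (norm (h t))\<^sup>2)"
    by (intro Bochner_Integration.integrable_add square_integrable_norm_sq assms)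
  have "\<bar>a * b\<bar> \<le> \<bar>a\<bar>\<^sup>2 + \<bar>b\<bar>\<^sup>2" for a b :: real
  proof -
    have "2 * (\<bar>a\<bar> * \<bar>b\<bar>) \<le> \<bar>a\<bar>\<^sup>2 + \<bar>b\<bar>\<^sup>2"
      using zero_le_power2[of "\<bar>a\<bar> - \<bar>b\<bar>"] by (simp add: power2_diff)
    moreover have "0 \<le> \<bar>a\<bar> * \<bar>b\<bar>" by simp
    ultimately show ?thesis unfolding abs_mult by linarith
  qed
  then show "AE t in unit_measure. norm (f t * h t) \<le> norm ((norm (f t))\<^sup>2 + (norm (h t))\<^sup>2)"
    by (intro AE_I2) (simp add: abs_of_nonneg del: power2_abs)
qed

lemma square_integrable_norm: "square_integrable f \<Longrightarrow> square_integrable (\<lambda>t. norm (f t))"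
  by (auto simp: square_integrable_def)

lemma square_integrable_one_plus_norm:
  assumes "square_integrable f"
  shows "square_integrable (\<lambda>t. 1 + norm (f t))"
  by (rule square_integrable_add[OF square_integrable_bounded[where C=1] square_integrable_norm[OF assms]]) auto

lemma integrable_square_integrable_scaleR:
  fixes m :: "real \<Rightarrow> 'v::{banach, second_countable_topology}"
  assumes "square_integrable u" "square_integrable m"
  shows "integrable unit_measure (\<lambda>t. u t *\<^sub>R m t)"
proof (rule Bochner_Integration.integrable_bound)
  show "integrable unit_measure (\<lambda>t. u t * norm (m t))"
    by (rule integrable_square_integrable_mult[OF assms(1) square_integrable_norm[OF assms(2)]])
  note [measurable] = assms[THEN square_integrable_measurable]
  show "(\<lambda>t. u t *\<^sub>R m t) \<in> borel_measurable unit_measure" by measurable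
qed (simp add: abs_mult)

text \<open>The integral of \<open>(f - s h)\<^sup>2\<close> is nonnegative; the choice of
  \<open>s\<close> balances the two squares.\<close>

lemma integral_Cauchy_Schwarz:
  fixes f h :: "real \<Rightarrow> real"
  assumes f: "square_integrable f" and h: "square_integrable h"
  shows "(LINT t|unit_measure. f t * h t)
    \<le> sqrt (LINT t|unit_measure. (f t)\<^sup>2) * sqrt (LINT t|unit_measure. (h t)\<^sup>2)"
    (is "?B \<le> sqrt ?A * sqrt ?C")
proof -
  note [measurable] = square_integrable_measurable[OF f] square_integrable_measurable[OF h]
  have fi: "integrable unit_measure (\<lambda>t. (f t)\<^sup>2)" and hi: "integrable unit_measure (\<lambda>t. (h t)\<^sup>2)"
    using square_integrable_norm_sq[OF f] square_integrable_norm_sq[OF h] by simp_all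
  note fhi = integrable_square_integrable_mult[OF f h]
  have AC: "0 \<le> ?A" "0 \<le> ?C" by (auto intro!: integral_nonneg_AE)
  show ?thesis
  proof (cases "?A = 0 \<or> ?C = 0")
    case True
    then have "(AE t in unit_measure. (f t)\<^sup>2 = 0) \<or> (AE t in unit_measure. (h t)\<^sup>2 = 0)"
      using integral_nonneg_eq_0_iff_AE[OF fi] integral_nonneg_eq_0_iff_AE[OF hi] by auto
    then have "AE t in unit_measure. f t * h t = 0"
      by (auto elim: eventually_mono)
    then have "?B = 0" by (rule integral_eq_zero_AE)
    then show ?thesis using AC by simp
  next
    case False
    then have "?A \<noteq> 0" "?C \<noteq> 0" by blast+
    with AC have pos: "0 < ?A" "0 < ?C" by linarith+
    define s where "s = sqrt ?A / sqrt ?C"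
    have "0 \<le> (LINT t|unit_measure. (f t - s * h t)\<^sup>2)" by (rule integral_nonneg_AE) simp
    also have "\<dots> = (LINT t|unit_measure. (f t)\<^sup>2 - 2 * s * (f t * h t) + s\<^sup>2 * (h t)\<^sup>2)"
      by (rule Bochner_Integration.integral_cong) (auto simp: power2_eq_square algebra_simps)
    also have "\<dots> = ?A - 2 * s * ?B + s\<^sup>2 * ?C"
      using fi hi fhi by (simp add: Bochner_Integration.integral_add Bochner_Integration.integral_diff)
    also have "s\<^sup>2 * ?C = ?A" using pos by (simp add: s_def power_divide)
    finally have "s * ?B \<le> ?A" by simp
    then have "sqrt ?A * ?B \<le> sqrt ?C * ?A" using pos by (simp add: s_def field_simps)
    also have "\<dots> = sqrt ?A * (sqrt ?A * sqrt ?C)" using pos by simp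
    finally show ?thesis using pos by (simp del: real_sqrt_mult_self)
  qed
qed

text \<open>The embedding of \<open>W\<^sup>1\<^sup>,\<^sup>2\<close> into the Hoelder functions of
  exponent one half, the source of all equicontinuity.\<close>

lemma norm_primitive_diff_le_sqrt:
  assumes u: "square_integrable u" and st: "0 \<le> s" "s \<le> t" "t \<le> 1"
  shows "norm (primitive u t - primitive u s)
    \<le> sqrt (t - s) * sqrt (LINT x|unit_measure. (norm (u x))\<^sup>2)"
proof -
  note [measurable] = square_integrable_measurable[OF u]
  have ind: "square_integrable (indicat_real {s<..t})"
    by (rule square_integrable_bounded[where C=1]) (auto simp: indicator_def)
  note un = square_integrable_norm[OF u]
  have "norm (primitive u t - primitive u s) \<le> (LINT x|unit_measure. indicat_real {s<..t} x * norm (u x))"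
    by (rule norm_primitive_diff_le[OF square_integrable_imp_integrable[OF u] st(2)])
  also have "\<dots> \<le> sqrt (LINT x|unit_measure. (indicat_real {s<..t} x)\<^sup>2) *
      sqrt (LINT x|unit_measure. (norm (u x))\<^sup>2)"
    by (rule integral_Cauchy_Schwarz[OF ind un])
  also have "(LINT x|unit_measure. (indicat_real {s<..t} x)\<^sup>2) = (LINT x|unit_measure. indicat_real {s<..t} x)"
    by (rule Bochner_Integration.integral_cong) (auto simp: indicator_def)
  finally show ?thesis using measure_unit_Ioc[OF st] by simp
qed

lemma norm_primitive_le_sqrt:
  assumes u: "square_integrable u" and t: "t \<in> {0..1}"
  shows "norm (primitive u t) \<le> sqrt (LINT x|unit_measure. (norm (u x))\<^sup>2)"
proof -
  have "norm (primitive u t - primitive u 0) \<le> sqrt (t - 0) * sqrt (LINT x|unit_measure. (norm (u x))\<^sup>2)"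
    by (rule norm_primitive_diff_le_sqrt[OF u]) (use t in auto)
  also have "\<dots> \<le> 1 * sqrt (LINT x|unit_measure. (norm (u x))\<^sup>2)"
    using t by (intro mult_right_mono real_sqrt_ge_zero integral_nonneg_AE) auto
  finally show ?thesis by simp
qed

lemma convergent_summable_increments:
  fixes c :: "nat \<Rightarrow> 'a::banach"
  assumes "summable (\<lambda>n. norm (c (Suc n) - c n))"
  shows "convergent c"
proof -
  have "(\<lambda>n. c 0 + (\<Sum>k<n. c (Suc k) - c k)) \<longlonglongrightarrow> c 0 + (\<Sum>k. c (Suc k) - c k)"
    by (intro tendsto_intros summable_LIMSEQ summable_norm_cancel[OF assms])
  moreover have "c 0 + (\<Sum>k<n. c (Suc k) - c k) = c n" for n
    by (simp add: sum_lessThan_telescope)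
  ultimately show ?thesis by (auto simp: convergent_def)
qed

lemma convergent_geometric_increments:
  fixes c :: "nat \<Rightarrow> 'a::banach"
  assumes "\<And>n. norm (c (Suc n) - c n) \<le> (1/4) ^ n"
  shows "convergent c"
proof (rule convergent_summable_increments[OF summable_comparison_test'])
  show "summable (\<lambda>n. (1/4::real) ^ n)" by (rule summable_geometric) simp
qed (use assms in simp)

text \<open>Completeness of \<open>L\<^sup>2\<close>, in a form that also yields convergence almost
  everywhere and a common integrable majorant of the squares, so that dominated convergence applies
  to integrands of quadratic growth. The sum \<open>T\<close> of the squared increments with the
  weights \<open>4\<^sup>n\<close> is still integrable, and where it is finite the Cauchy-Schwarz
  inequality for sums controls the sequence by \<open>T\<close>.\<close>

lemma square_integrable_fast_Cauchy:
  fixes z :: "nat \<Rightarrow> real \<Rightarrow> 'v::{banach, second_countable_topology}"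
  assumes sq: "\<And>n. square_integrable (z n)"
    and fast: "\<And>n. (LINT t|unit_measure. (norm (z (Suc n) t - z n t))\<^sup>2) \<le> (1/16) ^ n"
  obtains w S where "square_integrable w" "integrable unit_measure S"
    "AE t in unit_measure. (\<forall>n. (norm (z n t))\<^sup>2 \<le> S t) \<and> (\<lambda>n. z n t) \<longlonglongrightarrow> w t"
proof -
  define d where "d n t = norm (z (Suc n) t - z n t)" for n t
  define f where "f n t = 4 ^ n * (d n t)\<^sup>2" for n t
  note [measurable] = square_integrable_measurable[OF sq]
  have f0: "0 \<le> f n t" for n t by (simp add: f_def)
  have fi: "integrable unit_measure (f n)" for n
    unfolding f_def d_def
    by (intro integrable_mult_right square_integrable_norm_sq square_integrable_diff sq)
  have fle: "(LINT t|unit_measure. f n t) \<le> (1/4) ^ n" for n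
  proof -
    have "(LINT t|unit_measure. f n t) = 4 ^ n * (LINT t|unit_measure. (d n t)\<^sup>2)"
      by (simp add: f_def)
    also have "\<dots> \<le> 4 ^ n * (1/16) ^ n"
      using fast[of n] by (intro mult_left_mono) (auto simp: d_def)
    also have "\<dots> = (1/4) ^ n" by (simp flip: power_mult_distrib)
    finally show ?thesis .
  qed
  have fm [measurable]: "f n \<in> borel_measurable unit_measure" for n
    using fi by auto
  have "(\<integral>\<^sup>+ t. (\<Sum>n. ennreal (f n t)) \<partial>unit_measure) = (\<Sum>n. \<integral>\<^sup>+ t. ennreal (f n t) \<partial>unit_measure)"
    by (rule nn_integral_suminf) measurable
  also have "\<dots> = (\<Sum>n. ennreal (LINT t|unit_measure. f n t))"
    by (intro suminf_cong nn_integral_eq_integral fi) (auto simp: f0)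
  also have "\<dots> \<le> (\<Sum>n. ennreal ((1/4) ^ n))"
    by (intro suminf_le ennreal_leI fle) auto
  also have "\<dots> = ennreal (\<Sum>n. (1/4) ^ n)"
    by (rule suminf_ennreal2) (auto intro!: summable_geometric)
  also have "\<dots> < \<infinity>" by simp
  finally have "AE t in unit_measure. (\<Sum>n. ennreal (f n t)) \<noteq> \<infinity>"
    by (intro nn_integral_noteq_infinite) auto
  then have summ: "AE t in unit_measure. summable (\<lambda>n. f n t)"
    by eventually_elim (rule summable_suminf_not_top, auto simp: f0)
  define T where "T t = (\<Sum>n. f n t)" for t
  have Ti: "integrable unit_measure T"
    unfolding T_def
  proof (rule integrable_suminf[OF fi])
    show "AE t in unit_measure. summable (\<lambda>n. norm (f n t))"
      using summ by (simp add: f0)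
    show "summable (\<lambda>n. LINT t|unit_measure. norm (f n t))"
      by (rule summable_comparison_test'[where g="\<lambda>n. (1/4) ^ n" and N=0])
        (use fle in \<open>auto simp: f0 abs_of_nonneg integral_nonneg_AE intro!: summable_geometric\<close>)
  qed
  define w where "w t = lim (\<lambda>n. z n t)" for t
  define S where "S t = 2 * (norm (z 0 t))\<^sup>2 + 4 * T t" for t
  have Si: "integrable unit_measure S"
    unfolding S_def
    by (intro Bochner_Integration.integrable_add integrable_mult_right Ti square_integrable_norm_sq sq)
  have wm: "w \<in> borel_measurable unit_measure" unfolding w_def by measurable
  have main: "(\<forall>n. (norm (z n t))\<^sup>2 \<le> S t) \<and> (\<lambda>n. z n t) \<longlonglongrightarrow> w t" if s: "summable (\<lambda>n. f n t)" for t
  proof (intro conjI allI)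
    have geo: "summable (\<lambda>n. (1/4::real) ^ n)" by (simp add: summable_geometric)
    have dle: "d n t \<le> (1/4) ^ n + f n t" for n
    proof -
      have "2 * ((1/2) ^ n * (2 ^ n * d n t)) \<le> ((1/2) ^ n)\<^sup>2 + (2 ^ n * d n t)\<^sup>2"
        using zero_le_power2[of "(1/2) ^ n - 2 ^ n * d n t"] unfolding power2_diff by linarith
      also have "\<dots> = (1/4) ^ n + f n t"
        by (simp add: f_def power_mult_distrib power2_eq_square flip: power_mult_distrib)
      also have "(1/2) ^ n * (2 ^ n * d n t) = d n t" by (simp add: power_one_over)
      finally show ?thesis using d_def by (smt (verit) norm_ge_zero)
    qed
    have "summable (\<lambda>n. d n t)"
      by (rule summable_comparison_test'[OF summable_add[OF geo s], where N=0])
        (use dle in \<open>simp add: d_def\<close>)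
    then have "convergent (\<lambda>n. z n t)"
      unfolding d_def by (rule convergent_summable_increments)
    then show "(\<lambda>n. z n t) \<longlonglongrightarrow> w t" by (simp add: w_def convergent_LIMSEQ_iff)
    fix n
    have "z n t - z 0 t = (\<Sum>k<n. z (Suc k) t - z k t)"
      by (rule sum_lessThan_telescope[of "\<lambda>k. z k t", symmetric])
    then have "norm (z n t - z 0 t) \<le> (\<Sum>k<n. d k t)"
      unfolding d_def by (simp add: norm_sum)
    also have "\<dots> = (\<Sum>k<n. (1/2) ^ k * (2 ^ k * d k t))" by (simp add: power_one_over)
    finally have "(norm (z n t - z 0 t))\<^sup>2 \<le> (\<Sum>k<n. (1/2) ^ k * (2 ^ k * d k t))\<^sup>2"
      by (intro power_mono) auto
    also have "\<dots> \<le> (\<Sum>k<n. ((1/2) ^ k)\<^sup>2) * (\<Sum>k<n. (2 ^ k * d k t)\<^sup>2)"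
      by (rule Cauchy_Schwarz_ineq_sum)
    also have "\<dots> = (\<Sum>k<n. (1/4) ^ k) * (\<Sum>k<n. f k t)"
    proof -
      have "((1/2::real) ^ k)\<^sup>2 = (1/4) ^ k" "((2::real) ^ k)\<^sup>2 = 4 ^ k" for k
        by (simp_all add: power2_eq_square flip: power_mult_distrib)
      then show ?thesis by (simp add: f_def power_mult_distrib)
    qed
    also have "\<dots> \<le> 2 * T t"
    proof (rule mult_mono)
      have "(\<Sum>k<n. (1/4::real) ^ k) \<le> (\<Sum>k. (1/4) ^ k)"
        by (rule sum_le_suminf[OF geo]) auto
      also have "\<dots> \<le> 2" by (subst suminf_geometric) auto
      finally show "(\<Sum>k<n. (1/4::real) ^ k) \<le> 2" .
      show "(\<Sum>k<n. f k t) \<le> T t" unfolding T_def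
        by (rule sum_le_suminf[OF s]) (auto simp: f0)
    qed (auto intro: sum_nonneg f0)
    finally have "(norm (z n t - z 0 t))\<^sup>2 \<le> 2 * T t" .
    then show "(norm (z n t))\<^sup>2 \<le> S t"
      using norm_add_sq_le[of "z 0 t" "z n t - z 0 t"] by (simp add: S_def)
  qed
  have AE: "AE t in unit_measure. (\<forall>n. (norm (z n t))\<^sup>2 \<le> S t) \<and> (\<lambda>n. z n t) \<longlonglongrightarrow> w t"
    using summ by eventually_elim (rule main)
  then have "AE t in unit_measure. (norm (w t))\<^sup>2 \<le> S t"
  proof eventually_elim
    case (elim t)
    then have "(\<lambda>n. (norm (z n t))\<^sup>2) \<longlonglongrightarrow> (norm (w t))\<^sup>2" by (intro tendsto_intros) auto
    then show ?case by (rule LIMSEQ_le_const2) (use elim in auto)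
  qed
  then have "square_integrable w" by (rule square_integrable_bound[OF wm Si])
  from this Si AE show ?thesis by (rule that)
qed

text \<open>The squared norm of the product Hilbert space \<open>H \<times>
  L\<^sup>2\<close>.\<close>

definition pair_norm_sq :: "'h::real_normed_vector \<Rightarrow> (real \<Rightarrow> 'v::{banach, second_countable_topology}) \<Rightarrow> real"
  where "pair_norm_sq c w = (norm c)\<^sup>2 + (LINT t|unit_measure. (norm (w t))\<^sup>2)"

lemma parallelogram: "(norm (x - y))\<^sup>2 = 2 * (norm x)\<^sup>2 + 2 * (norm y)\<^sup>2 - 4 * (norm ((1/2) *\<^sub>R (x + y)))\<^sup>2"
  for x y :: "'a::real_inner"
  by (simp add: power2_norm_eq_inner inner_add_left inner_add_right inner_diff_left inner_diff_right
      inner_commute algebra_simps)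

lemma pair_norm_sq_parallelogram:
  fixes c c' :: "'h::real_inner" and w w' :: "real \<Rightarrow> 'v::{real_inner, banach, second_countable_topology}"
  assumes w: "square_integrable w" and w': "square_integrable w'"
  shows "pair_norm_sq (c - c') (\<lambda>t. w t - w' t) = 2 * pair_norm_sq c w + 2 * pair_norm_sq c' w' -
    4 * pair_norm_sq ((1/2) *\<^sub>R (c + c')) (\<lambda>t. (1/2) *\<^sub>R (w t + w' t))"
proof -
  have i: "integrable unit_measure (\<lambda>t. (norm (w t))\<^sup>2)" "integrable unit_measure (\<lambda>t. (norm (w' t))\<^sup>2)"
     "integrable unit_measure (\<lambda>t. (norm ((1/2) *\<^sub>R (w t + w' t)))\<^sup>2)"
    by (intro square_integrable_norm_sq w w' square_integrable_scaleR square_integrable_add)+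
  have "(LINT t|unit_measure. (norm (w t - w' t))\<^sup>2) =
     (LINT t|unit_measure. 2 * (norm (w t))\<^sup>2 + 2 * (norm (w' t))\<^sup>2 - 4 * (norm ((1/2) *\<^sub>R (w t + w' t)))\<^sup>2)"
    unfolding parallelogram ..
  also have "\<dots> = 2 * (LINT t|unit_measure. (norm (w t))\<^sup>2) + 2 * (LINT t|unit_measure. (norm (w' t))\<^sup>2)
     - 4 * (LINT t|unit_measure. (norm ((1/2) *\<^sub>R (w t + w' t)))\<^sup>2)"
    using i by (simp only: Bochner_Integration.integral_add Bochner_Integration.integral_diff
        Bochner_Integration.integrable_add integrable_mult_right integral_mult_right_zero)
  finally show ?thesis unfolding pair_norm_sq_def parallelogram[of c c'] by simp
qed


lemma pair_norm_sq_nonneg: "0 \<le> pair_norm_sq c w"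
  by (simp add: pair_norm_sq_def integral_nonneg_AE)

text \<open>A substitute for weak compactness. The minimal norms over the sets increase to a limit
  \<open>e\<close>. By the parallelogram law two elements of \<open>D n\<close> whose norms are
  almost minimal there are close to each other, since their midpoint also belongs to \<open>D
  n\<close>. So elements of almost minimal norm converge strongly, and closedness under the
  resulting mode of convergence suffices.\<close>

proposition decreasing_convex_sets_intersect:
  fixes D :: "nat \<Rightarrow> ('h::{real_inner, banach} \<times> (real \<Rightarrow> 'v::{real_inner, banach, second_countable_topology})) set"
  assumes sq: "\<And>n c w. (c, w) \<in> D n \<Longrightarrow> square_integrable w"
    and dec: "\<And>m n. m \<le> n \<Longrightarrow> D n \<subseteq> D m"
    and bounded: "\<And>n. \<exists>c w. (c, w) \<in> D n \<and> pair_norm_sq c w \<le> R"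
    and midpoint: "\<And>n c w c' w'. (c, w) \<in> D n \<Longrightarrow> (c', w') \<in> D n \<Longrightarrow>
      ((1/2) *\<^sub>R (c + c'), \<lambda>t. (1/2) *\<^sub>R (w t + w' t)) \<in> D n"
    and closed: "\<And>n c z c0 w S. (\<And>k. (c k, z k) \<in> D n) \<Longrightarrow> c \<longlonglongrightarrow> c0 \<Longrightarrow> square_integrable w \<Longrightarrow>
      integrable unit_measure S \<Longrightarrow>
      AE t in unit_measure. (\<forall>k. (norm (z k t))\<^sup>2 \<le> S t) \<and> (\<lambda>k. z k t) \<longlonglongrightarrow> w t \<Longrightarrow> (c0, w) \<in> D n"
  obtains c w where "\<And>n. (c, w) \<in> D n"
proof -
  define N where "N x = pair_norm_sq (fst x) (snd x)" for x :: "'h \<times> (real \<Rightarrow> 'v)"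
  define d where "d n = (INF x\<in>D n. N x)" for n
  have bdd: "bdd_below (N ` A)" for A
    by (rule bdd_belowI2[where m=0]) (simp add: N_def pair_norm_sq_nonneg)
  have ne: "D n \<noteq> {}" for n using bounded[of n] by auto
  have dR: "d n \<le> R" for n
  proof -
    obtain c w where "(c, w) \<in> D n" "pair_norm_sq c w \<le> R" using bounded by blast
    then show ?thesis unfolding d_def
      by (intro cINF_lower2[OF bdd]) (auto simp: N_def)
  qed
  have dmono: "d m \<le> d n" if "m \<le> n" for m n
    unfolding d_def by (rule cINF_superset_mono[OF ne bdd dec[OF that]]) auto
  have "incseq d" using dmono by (auto simp: incseq_def)
  then obtain e where e: "d \<longlonglongrightarrow> e" "\<And>n. d n \<le> e"
    by (rule incseq_convergent[where B=R]) (auto simp: dR)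
  define eps where "eps k = (1/16::real) ^ k / 8" for k :: nat
  have eps: "0 < eps k" "eps (Suc k) \<le> eps k" for k by (auto simp: eps_def)
  have "\<exists>n. e - eps k < d n" for k
    using order_tendstoD(1)[OF e(1), of "e - eps k"] eps[of k]
    by (auto simp: eventually_sequentially)
  then obtain n where n: "\<And>k. e - eps k < d (n k)" by metis
  \<comment> \<open>The indices are summed up to make them increase; then consecutive elements lie
    in a common set.\<close>
  define m where "m k = (\<Sum>i\<le>k. n i + 1)" for k
  have mn: "n k \<le> m k" for k
    unfolding m_def by (rule order_trans[OF _ member_le_sum[of k]]) auto
  have mmono: "m j \<le> m k" if "j \<le> k" for j k
    unfolding m_def by (rule sum_mono2) (use that in auto)
  have mk: "k \<le> m k" for k
    unfolding m_def by (induction k) auto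
  have dm: "e - eps k < d (m k)" for k
    using n[of k] dmono[OF mn[of k]] by simp
  have "\<exists>x. x \<in> D (m k) \<and> N x < e + eps k" for k
  proof -
    have "d (m k) < e + eps k" using e(2)[of "m k"] eps(1)[of k] by simp
    then show ?thesis unfolding d_def using cINF_less_iff[OF ne bdd] by blast
  qed
  then obtain x where x: "\<And>k. x k \<in> D (m k)" "\<And>k. N (x k) < e + eps k" by metis
  define c z where "c k = fst (x k)" and "z k = snd (x k)" for k
  have cz: "(c k, z k) \<in> D (m k)" for k using x(1)[of k] by (simp add: c_def z_def)
  have zsq: "square_integrable (z k)" for k using sq[OF cz] .
  have small: "pair_norm_sq (c (Suc k) - c k) (\<lambda>t. z (Suc k) t - z k t) \<le> (1/16) ^ k" for k
  proof -
    have 1: "(c (Suc k), z (Suc k)) \<in> D (m k)"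
      using cz[of "Suc k"] dec[OF mmono[of k "Suc k"]] by auto
    have "d (m k) \<le> N ((1/2) *\<^sub>R (c (Suc k) + c k), \<lambda>t. (1/2) *\<^sub>R (z (Suc k) t + z k t))"
      unfolding d_def by (rule cINF_lower[OF bdd midpoint[OF 1 cz]])
    moreover have "pair_norm_sq (c (Suc k)) (z (Suc k)) < e + eps (Suc k)"
      "pair_norm_sq (c k) (z k) < e + eps k"
      using x(2)[of k] x(2)[of "Suc k"] by (auto simp: N_def c_def z_def)
    ultimately have "pair_norm_sq (c (Suc k) - c k) (\<lambda>t. z (Suc k) t - z k t) \<le> 8 * eps k"
      unfolding pair_norm_sq_parallelogram[OF zsq zsq] using dm[of k] eps(2)[of k]
      by (simp add: N_def)
    then show ?thesis by (simp add: eps_def)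
  qed
  have "(norm (c (Suc k) - c k))\<^sup>2 \<le> ((1/4) ^ k)\<^sup>2" for k
  proof -
    have "(norm (c (Suc k) - c k))\<^sup>2 \<le> (1/16) ^ k"
    proof -
      have "0 \<le> (LINT t|unit_measure. (norm (z (Suc k) t - z k t))\<^sup>2)"
        by (rule integral_nonneg_AE) simp
      then show ?thesis using small[of k] unfolding pair_norm_sq_def by linarith
    qed
    also have "\<dots> = ((1/4) ^ k)\<^sup>2" by (simp add: power2_eq_square flip: power_mult_distrib)
    finally show ?thesis .
  qed
  then have cle: "norm (c (Suc k) - c k) \<le> (1/4) ^ k" for k
    by (rule power2_le_imp_le) simp
  from convergent_geometric_increments[OF cle] obtain c0 where c0: "c \<longlonglongrightarrow> c0"
    by (auto simp: convergent_def)
  have "(LINT t|unit_measure. (norm (z (Suc k) t - z k t))\<^sup>2) \<le> (1/16) ^ k" for k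
    using small[of k] zero_le_power2[of "norm (c (Suc k) - c k)"] unfolding pair_norm_sq_def by linarith
  from square_integrable_fast_Cauchy[OF zsq this] obtain w S where w: "square_integrable w"
    "integrable unit_measure S"
    "AE t in unit_measure. (\<forall>n. (norm (z n t))\<^sup>2 \<le> S t) \<and> (\<lambda>n. z n t) \<longlonglongrightarrow> w t" .
  have "(c0, w) \<in> D n" for n
  proof (rule closed[OF _ _ w(1,2)])
    show "(c (k + n), z (k + n)) \<in> D n" for k
      using cz[of "k + n"] dec[of n "m (k + n)"] mk[of "k + n"] by auto
    show "(\<lambda>k. c (k + n)) \<longlonglongrightarrow> c0" by (rule LIMSEQ_ignore_initial_segment[OF c0])
    show "AE t in unit_measure. (\<forall>k. (norm (z (k + n) t))\<^sup>2 \<le> S t) \<and> (\<lambda>k. z (k + n) t) \<longlonglongrightarrow> w t"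
      using w(3) by eventually_elim (auto intro: LIMSEQ_ignore_initial_segment)
  qed
  then show ?thesis by (rule that)
qed

text \<open>Intervals generate the Borel sets, and Lebesgue sets differ from Borel sets by null
  sets, so the integral vanishes over every measurable set.\<close>

lemma AE_zero_if_interval_integrals_zero:
  fixes f :: "real \<Rightarrow> 'v::{banach, second_countable_topology}"
  assumes f: "integrable unit_measure f"
    and zero: "\<And>a b. 0 < a \<Longrightarrow> a < b \<Longrightarrow> b < 1 \<Longrightarrow> (LINT t|unit_measure. indicat_real {a<..<b} t *\<^sub>R f t) = 0"
  shows "AE t in unit_measure. f t = 0"
proof (rule unit_measure.density_zero[OF f])
  have I: "integrable unit_measure (\<lambda>t. indicat_real A t *\<^sub>R f t)" if "A \<in> sets borel" for A
    by (rule integrable_unit_indicator[OF f that])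
  \<comment> \<open>Arbitrary intervals are exhausted by intervals that stay away from the end
    points.\<close>
  have ab: "(LINT t|unit_measure. indicat_real {a<..<b} t *\<^sub>R f t) = 0" for a b
  proof (rule LIMSEQ_unique)
    let ?I = "\<lambda>n. {max a (1 / real (n + 3))<..<min b (1 - 1 / real (n + 3))}"
    show "(\<lambda>n. LINT t|unit_measure. indicat_real (?I n) t *\<^sub>R f t) \<longlonglongrightarrow>
      (LINT t|unit_measure. indicat_real {a<..<b} t *\<^sub>R f t)"
    proof (rule integral_dominated_convergence[where w="\<lambda>t. norm (f t)"])
      show "AE t in unit_measure. (\<lambda>n. indicat_real (?I n) t *\<^sub>R f t) \<longlonglongrightarrow> indicat_real {a<..<b} t *\<^sub>R f t"
      proof (rule AE_I2)
        fix t :: real assume "t \<in> space unit_measure"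
        then have t: "0 < t" "t < 1" by auto
        have "(\<lambda>n. 1 / real (n + 3)) \<longlonglongrightarrow> 0"
          by (rule LIMSEQ_ignore_initial_segment[OF lim_1_over_n])
        from order_tendstoD(2)[OF this, of "min t (1 - t)"] t
        have "\<forall>\<^sub>F n in sequentially. 1 / real (n + 3) < min t (1 - t)" by auto
        then have "\<forall>\<^sub>F n in sequentially. indicat_real (?I n) t *\<^sub>R f t = indicat_real {a<..<b} t *\<^sub>R f t"
          by eventually_elim (use t in \<open>auto simp: indicator_def\<close>)
        then show "(\<lambda>n. indicat_real (?I n) t *\<^sub>R f t) \<longlonglongrightarrow> indicat_real {a<..<b} t *\<^sub>R f t"
          by (rule tendsto_eventually)
      qed
    qed (use I f in \<open>auto simp: indicator_def intro: borel_measurable_integrable\<close>)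
    have "(LINT t|unit_measure. indicat_real (?I n) t *\<^sub>R f t) = 0" for n
    proof (cases "max a (1 / real (n + 3)) < min b (1 - 1 / real (n + 3))")
      case True
      have p: "0 < 1 / real (n + 3)" by simp
      show ?thesis by (rule zero[OF _ True]) (use p in \<open>linarith+\<close>)
    next
      case False
      then have "{max a (1 / real (n + 3))<..<min b (1 - 1 / real (n + 3))} = {}"
        by (simp only: greaterThanLessThan_empty_iff not_less)
      then have "indicat_real {max a (1 / real (n + 3))<..<min b (1 - 1 / real (n + 3))} = (\<lambda>_. 0)"
        by (simp only:) (simp add: indicator_def fun_eq_iff)
      then show ?thesis by (simp only:) simp
    qed
    then show "(\<lambda>n. LINT t|unit_measure. indicat_real (?I n) t *\<^sub>R f t) \<longlonglongrightarrow> 0" by simp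
  qed
  have "(LINT t|unit_measure. indicat_real {0<..<1} t *\<^sub>R f t) = 0" by (rule ab)
  then have total: "(LINT t|unit_measure. f t) = 0"
    by (subst (asm) Bochner_Integration.integral_cong[OF refl, where g=f]) auto
  have borel_zero: "(LINT t|unit_measure. indicat_real A t *\<^sub>R f t) = 0" if "A \<in> sets borel" for A
    using that
  proof (induction rule: borel_set_induct)
    case empty
    show ?case by simp
  next
    case (interval a b)
    have "(LINT t|unit_measure. indicat_real {a..b} t *\<^sub>R f t) = (LINT t|unit_measure. indicat_real {a<..<b} t *\<^sub>R f t)"
    proof (rule integral_cong_AE)
      show "AE t in unit_measure. indicat_real {a..b} t *\<^sub>R f t = indicat_real {a<..<b} t *\<^sub>R f t"
        using AE_unit_neq[of a] AE_unit_neq[of b] by eventually_elim (auto simp: indicator_def)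
    qed (intro borel_measurable_integrable I; simp)+
    with ab show ?case by simp
  next
    case (compl A)
    have "indicat_real (-A) t *\<^sub>R f t = f t - indicat_real A t *\<^sub>R f t" for t
      by (auto simp: indicator_def)
    then have "(LINT t|unit_measure. indicat_real (-A) t *\<^sub>R f t) =
        (LINT t|unit_measure. f t) - (LINT t|unit_measure. indicat_real A t *\<^sub>R f t)"
      using I[OF compl(1)] f by (simp add: Bochner_Integration.integral_diff)
    with compl total show ?case by simp
  next
    case (union A)
    let ?A = "\<lambda>n. \<Union>i<n. A i"
    show ?case
    proof (rule LIMSEQ_unique)
      have [measurable]: "?A n \<in> sets borel" "\<Union>(range A) \<in> sets borel" for n using union(2) by auto
      have ind: "indicat_real (?A n) t = (\<Sum>i<n. indicat_real (A i) t)" for n t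
        by (rule indicator_UN_disjoint[of "{..<n}" A, simplified])
           (use union(1) in \<open>auto intro: disjoint_family_on_mono\<close>)
      show "(\<lambda>n. LINT t|unit_measure. indicat_real (?A n) t *\<^sub>R f t) \<longlonglongrightarrow>
        (LINT t|unit_measure. indicat_real (\<Union>(range A)) t *\<^sub>R f t)"
      proof (rule integral_dominated_convergence[where w="\<lambda>t. norm (f t)"])
        show "AE t in unit_measure. (\<lambda>n. indicat_real (?A n) t *\<^sub>R f t) \<longlonglongrightarrow> indicat_real (\<Union>(range A)) t *\<^sub>R f t"
        proof (rule AE_I2)
          fix t :: real
          show "(\<lambda>n. indicat_real (?A n) t *\<^sub>R f t) \<longlonglongrightarrow> indicat_real (\<Union>(range A)) t *\<^sub>R f t"
            by (intro tendsto_intros LIMSEQ_indicator_UN)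
        qed
        show "(\<lambda>t. indicat_real (\<Union>(range A)) t *\<^sub>R f t) \<in> borel_measurable unit_measure"
          by (rule borel_measurable_integrable[OF I]) measurable
        show "(\<lambda>t. indicat_real (?A n) t *\<^sub>R f t) \<in> borel_measurable unit_measure" for n
          by (rule borel_measurable_integrable[OF I]) measurable
      qed (use f in \<open>auto simp: indicator_def\<close>)
      have "(LINT t|unit_measure. indicat_real (?A n) t *\<^sub>R f t) = 0" for n
      proof -
        have "(LINT t|unit_measure. indicat_real (?A n) t *\<^sub>R f t) =
            (\<Sum>i<n. LINT t|unit_measure. indicat_real (A i) t *\<^sub>R f t)"
          unfolding ind scaleR_sum_left by (rule Bochner_Integration.integral_sum) (rule I[OF union(2)])
        also have "\<dots> = 0" by (rule sum.neutral, rule ballI) (rule union(3))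
        finally show ?thesis .
      qed
      then show "(\<lambda>n. LINT t|unit_measure. indicat_real (?A n) t *\<^sub>R f t) \<longlonglongrightarrow> 0" by simp
    qed
  qed
  fix A assume "A \<in> sets unit_measure"
  then obtain B where B: "B \<in> sets lebesgue" "A = B \<inter> {0<..<1}"
    by (auto simp: sets_restrict_space)
  obtain S N N' where SN: "B = S \<union> N" "N \<subseteq> N'" "N' \<in> null_sets lborel" "S \<in> sets lborel"
    by (rule sets_completionE[OF B(1)])
  have N': "AE t in unit_measure. t \<notin> N'"
    by (rule AE_unit_lborel[OF AE_not_in[OF SN(3)]])
  have fm: "f \<in> borel_measurable unit_measure" using f by auto
  note [measurable] = fm \<open>A \<in> sets unit_measure\<close>
  have "(LINT t|unit_measure. indicat_real A t *\<^sub>R f t) = (LINT t|unit_measure. indicat_real S t *\<^sub>R f t)"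
  proof (rule integral_cong_AE)
    show "AE t in unit_measure. indicat_real A t *\<^sub>R f t = indicat_real S t *\<^sub>R f t"
      using N' AE_unit_mem by eventually_elim (use SN B in \<open>auto simp: indicator_def\<close>)
    show "(\<lambda>t. indicat_real S t *\<^sub>R f t) \<in> borel_measurable unit_measure"
      using I[of S] SN(4) by auto
  qed measurable
  also have "\<dots> = 0" by (rule borel_zero) (use SN(4) in auto)
  finally show "set_lebesgue_integral unit_measure A f = 0"
    by (simp add: set_lebesgue_integral_def)
qed

section \<open>Test functions\<close>

text \<open>These functions are flat at \<open>0\<close>, since the exponential beats every power,
  and the derivative of one of them is again one of them.\<close>

definition flat_exp :: "real poly \<Rightarrow> real \<Rightarrow> real"
  where "flat_exp p x = (if 0 < x then poly p (1 / x) * exp (- (1 / x)) else 0)"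

lemma poly_mult_exp_minus_tendsto_0: "((\<lambda>x. poly p x * exp (- x)) \<longlongrightarrow> (0::real)) at_top"
proof -
  have "((\<lambda>x. \<Sum>i\<le>degree p. coeff p i * (x ^ i / exp x)) \<longlongrightarrow> (\<Sum>i\<le>degree p. coeff p i * 0)) at_top"
    by (intro tendsto_intros tendsto_power_div_exp_0)
  moreover have "(\<lambda>x. \<Sum>i\<le>degree p. coeff p i * (x ^ i / exp x)) = (\<lambda>x. poly p x * exp (- x))"
    by (rule ext) (simp add: poly_altdef exp_minus sum_distrib_right divide_inverse mult.assoc)
  ultimately show ?thesis by simp
qed

lemma flat_exp_has_derivative:
  "(flat_exp p has_real_derivative flat_exp ([:0, 0, 1:] * (p - pderiv p)) x) (at x)"
proof -
  consider "x > 0" | "x < 0" | "x = 0" by linarith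
  then show ?thesis
  proof cases
    case 1
    have "((\<lambda>x. poly p (1 / x) * exp (- (1 / x))) has_real_derivative
        poly (pderiv p) (1 / x) * (- 1 / x\<^sup>2) * exp (- (1 / x)) + poly p (1 / x) * (exp (- (1 / x)) * (1 / x\<^sup>2))) (at x)"
      using 1 by (auto intro!: derivative_eq_intros DERIV_chain'[OF _ poly_DERIV] simp: power2_eq_square field_simps)
    moreover have "poly (pderiv p) (1 / x) * (- 1 / x\<^sup>2) * exp (- (1 / x)) + poly p (1 / x) * (exp (- (1 / x)) * (1 / x\<^sup>2))
        = flat_exp ([:0, 0, 1:] * (p - pderiv p)) x"
      using 1 by (simp add: flat_exp_def power2_eq_square field_simps)
    ultimately have "((\<lambda>x. poly p (1 / x) * exp (- (1 / x))) has_real_derivative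
        flat_exp ([:0, 0, 1:] * (p - pderiv p)) x) (at x)" by simp
    then show ?thesis
      by (rule has_field_derivative_transform_within_open[where S="{0<..}"]) (use 1 in \<open>auto simp: flat_exp_def\<close>)
  next
    case 2
    have "((\<lambda>x. 0) has_real_derivative flat_exp ([:0, 0, 1:] * (p - pderiv p)) x) (at x)"
      using 2 by (simp add: flat_exp_def)
    then show ?thesis
      by (rule has_field_derivative_transform_within_open[where S="{..<0}"]) (use 2 in \<open>auto simp: flat_exp_def\<close>)
  next
    case 3
    have "((\<lambda>x. poly (pCons 0 p) x * exp (- x)) \<longlongrightarrow> 0) at_top"
      by (rule poly_mult_exp_minus_tendsto_0)
    then have "((\<lambda>h. poly (pCons 0 p) (inverse h) * exp (- inverse h)) \<longlongrightarrow> 0) (at_right 0)"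
      by (rule filterlim_compose) (rule filterlim_inverse_at_top_right)
    then have R: "((\<lambda>h. (flat_exp p (0 + h) - flat_exp p 0) / h) \<longlongrightarrow> 0) (at_right 0)"
      by (rule Lim_transform_eventually)
        (auto simp: eventually_at_right_field flat_exp_def field_simps intro!: exI[of _ 1])
    have L: "((\<lambda>h. (flat_exp p (0 + h) - flat_exp p 0) / h) \<longlongrightarrow> 0) (at_left 0)"
      by (rule tendsto_eventually)
        (auto simp: eventually_at_left_field flat_exp_def intro!: exI[of _ "-1"])
    show ?thesis using filterlim_split_at[OF L R] 3 by (simp add: DERIV_def flat_exp_def)
  qed
qed

text \<open>A class of compositions with the polynomial \<open>q\<close> that is closed under
  differentiation; hence all its members are smooth.\<close>

inductive_set flat_functions :: "real poly \<Rightarrow> (real \<Rightarrow> real) set" for q where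
  base: "(\<lambda>t. poly r t * flat_exp p (poly q t)) \<in> flat_functions q"
| add: "f \<in> flat_functions q \<Longrightarrow> h \<in> flat_functions q \<Longrightarrow> (\<lambda>t. f t + h t) \<in> flat_functions q"

lemma flat_functions_derivative:
  assumes "f \<in> flat_functions q"
  shows "\<exists>f'\<in>flat_functions q. \<forall>t. (f has_real_derivative f' t) (at t)"
  using assms
proof induction
  case (base r p)
  let ?f = "\<lambda>t. poly (pderiv r) t * flat_exp p (poly q t) +
      poly (r * pderiv q) t * flat_exp ([:0, 0, 1:] * (p - pderiv p)) (poly q t)"
  have "((\<lambda>t. poly r t * flat_exp p (poly q t)) has_real_derivative ?f t) (at t)" for t
    by (rule DERIV_cong, rule DERIV_mult[OF poly_DERIV DERIV_chain2[OF flat_exp_has_derivative poly_DERIV]]) simp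
  moreover have "?f \<in> flat_functions q" by (intro flat_functions.intros)
  ultimately show ?case by (intro bexI[where x="?f"] allI)
next
  case (add f h)
  then obtain f' h' where "f' \<in> flat_functions q" "h' \<in> flat_functions q"
    "\<And>t. (f has_real_derivative f' t) (at t)" "\<And>t. (h has_real_derivative h' t) (at t)" by blast
  then show ?case
    by (intro bexI[of _ "\<lambda>t. f' t + h' t"]) (auto intro!: DERIV_add flat_functions.add)
qed

lemma flat_functions_smooth:
  assumes "f \<in> flat_functions q"
  shows "(deriv ^^ k) f differentiable (at t)"
proof -
  have "(deriv ^^ k) f \<in> flat_functions q"
  proof (induction k)
    case (Suc k)
    obtain f' where f': "f' \<in> flat_functions q" "\<And>t. ((deriv ^^ k) f has_real_derivative f' t) (at t)"
      using flat_functions_derivative[OF Suc] by blast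
    then have "deriv ((deriv ^^ k) f) = f'" by (intro ext DERIV_imp_deriv)
    with f' show ?case by simp
  qed (use assms in simp)
  from flat_functions_derivative[OF this] show ?thesis
    using real_differentiable_def by blast
qed

text \<open>The argument is positive exactly on \<open>(a, b)\<close> and tends to infinity there
  with \<open>n\<close>, so the bumps approximate the indicator function of \<open>(a,
  b)\<close>.\<close>

definition bump :: "real \<Rightarrow> real \<Rightarrow> nat \<Rightarrow> real \<Rightarrow> real"
  where "bump a b n t = flat_exp 1 (real n * ((t - a) * (b - t)))"

lemma bump_test_function:
  assumes "0 < a" "a < b" "b < 1"
  shows "test_function (bump a b n)"
  unfolding test_function_def
proof (intro conjI allI)
  have "(\<lambda>t. poly 1 t * flat_exp 1 (poly (smult (real n) ([:-a, 1:] * [:b, -1:])) t))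
      \<in> flat_functions (smult (real n) ([:-a, 1:] * [:b, -1:]))"
    by (rule flat_functions.base)
  also have "(\<lambda>t. poly 1 t * flat_exp 1 (poly (smult (real n) ([:-a, 1:] * [:b, -1:])) t)) = bump a b n"
    by (rule ext) (simp add: bump_def algebra_simps)
  finally show "(deriv ^^ k) (bump a b n) differentiable (at t)" for k t
    by (rule flat_functions_smooth)
  have "bump a b n t = 0" if "t \<notin> {a..b}" for t
  proof -
    have "(t - a) * (b - t) \<le> 0"
      using that assms(2) by (auto simp: mult_le_0_iff)
    then have "real n * ((t - a) * (b - t)) \<le> 0" by (simp add: mult_nonneg_nonpos)
    then show ?thesis by (simp add: bump_def flat_exp_def)
  qed
  then show "\<exists>a' b'. 0 < a' \<and> b' < 1 \<and> (\<forall>t. t \<notin> {a'..b'} \<longrightarrow> bump a b n t = 0)"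
    using assms by blast
qed

lemma bump_bounds: "0 \<le> bump a b n t" "bump a b n t \<le> 1"
  by (auto simp: bump_def flat_exp_def)

lemma bump_outside:
  assumes "a < b" "t \<notin> {a<..<b}"
  shows "bump a b n t = 0"
proof -
  have "(t - a) * (b - t) \<le> 0"
    using assms by (auto simp: mult_le_0_iff)
  then have "real n * ((t - a) * (b - t)) \<le> 0" by (simp add: mult_nonneg_nonpos)
  then show ?thesis by (simp add: bump_def flat_exp_def)
qed

lemma bump_tendsto_indicator:
  assumes "a < b"
  shows "(\<lambda>n. bump a b n t) \<longlonglongrightarrow> indicat_real {a<..<b} t"
proof (cases "t \<in> {a<..<b}")
  case True
  define c where "c = (t - a) * (b - t)"
  have c: "0 < c" using True by (simp add: c_def)
  have "(\<lambda>n. exp (- (1 / c * (1 / real n)))) \<longlonglongrightarrow> exp (- (1 / c * 0))"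
    by (intro tendsto_intros lim_1_over_n)
  then have "(\<lambda>n. exp (- (1 / c * (1 / real n)))) \<longlonglongrightarrow> 1" by simp
  then have "(\<lambda>n. bump a b n t) \<longlonglongrightarrow> 1"
  proof (rule Lim_transform_eventually)
    show "\<forall>\<^sub>F n in sequentially. exp (- (1 / c * (1 / real n))) = bump a b n t"
      using eventually_gt_at_top[of 0]
    proof eventually_elim
      case (elim n)
      have "bump a b n t = flat_exp 1 (real n * c)" by (simp add: bump_def c_def)
      also have "\<dots> = exp (- (1 / c * (1 / real n)))"
        using elim c by (simp add: flat_exp_def mult.commute)
      finally show ?case ..
    qed
  qed
  with True show ?thesis by simp
next
  case False
  then show ?thesis using bump_outside[OF assms] by simp
qed

lemma test_function_derivative:
  assumes "test_function \<phi>"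
  shows "(\<phi> has_real_derivative deriv \<phi> t) (at t)"
proof -
  have "(deriv ^^ 0) \<phi> differentiable (at t)" using assms unfolding test_function_def by blast
  then show ?thesis by (simp add: DERIV_deriv_iff_real_differentiable)
qed

lemma test_function_continuous:
  assumes "test_function \<phi>"
  shows "continuous_on S \<phi>" "continuous_on S (deriv \<phi>)"
proof -
  have "(deriv ^^ k) \<phi> differentiable (at t)" for k t
    using assms unfolding test_function_def by blast
  then have "isCont ((deriv ^^ k) \<phi>) t" for k t
    by (rule differentiable_imp_continuous_within)
  then have "continuous_on S ((deriv ^^ k) \<phi>)" for k
    by (intro continuous_at_imp_continuous_on) auto
  from this[of 0] this[of 1] show "continuous_on S \<phi>" "continuous_on S (deriv \<phi>)" by simp_all
qed

lemma test_function_endpoints: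
  assumes "test_function \<phi>"
  shows "\<phi> 0 = 0" "\<phi> 1 = 0"
  using assms unfolding test_function_def by (metis atLeastAtMost_iff not_less)+

lemma test_function_bounded:
  assumes "test_function \<phi>"
  obtains C where "\<And>t. t \<in> {0..1} \<Longrightarrow> \<bar>\<phi> t\<bar> \<le> C" "\<And>t. t \<in> {0..1} \<Longrightarrow> \<bar>deriv \<phi> t\<bar> \<le> C"
proof -
  obtain C1 where C1: "\<And>t. t \<in> {0..1} \<Longrightarrow> norm (\<phi> t) \<le> C1"
    by (rule continuous_bounded_unit[OF test_function_continuous(1)[OF assms]]) blast
  obtain C2 where C2: "\<And>t. t \<in> {0..1} \<Longrightarrow> norm (deriv \<phi> t) \<le> C2"
    by (rule continuous_bounded_unit[OF test_function_continuous(2)[OF assms]]) blast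
  show ?thesis by (rule that[of "max C1 C2"]) (use C1 C2 in \<open>auto simp: le_max_iff_disj\<close>)
qed

lemma test_function_linear:
  assumes f: "test_function f" and h: "test_function h"
  shows "test_function (\<lambda>t. a * f t - b * h t)"
  unfolding test_function_def
proof (intro conjI allI)
  have df: "(deriv ^^ k) f differentiable (at t)" and dh: "(deriv ^^ k) h differentiable (at t)" for k t
    using f h unfolding test_function_def by blast+
  have "(deriv ^^ k) (\<lambda>t. a * f t - b * h t) = (\<lambda>t. a * (deriv ^^ k) f t - b * (deriv ^^ k) h t)" for k
  proof (induction k)
    case (Suc k)
    have "deriv (\<lambda>t. a * (deriv ^^ k) f t - b * (deriv ^^ k) h t) t =
        a * deriv ((deriv ^^ k) f) t - b * deriv ((deriv ^^ k) h) t" for t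
      using df[of k t] dh[of k t]
      by (intro DERIV_imp_deriv DERIV_diff DERIV_cmult) (simp_all add: DERIV_deriv_iff_real_differentiable)
    then show ?case by (simp add: Suc)
  qed simp
  then show "(deriv ^^ k) (\<lambda>t. a * f t - b * h t) differentiable (at t)" for k t
    using df dh by (auto intro!: differentiable_diff differentiable_mult)
  from f h obtain a1 b1 a2 b2 where "0 < a1" "b1 < 1" "\<And>t. t \<notin> {a1..b1} \<Longrightarrow> f t = 0"
    "0 < a2" "b2 < 1" "\<And>t. t \<notin> {a2..b2} \<Longrightarrow> h t = 0"
    unfolding test_function_def by blast
  then show "\<exists>a' b'. 0 < a' \<and> b' < 1 \<and> (\<forall>t. t \<notin> {a'..b'} \<longrightarrow> a * f t - b * h t = 0)"
  proof (intro exI conjI allI impI)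
    show "0 < min a1 a2" "max b1 b2 < 1" using \<open>0 < a1\<close> \<open>0 < a2\<close> \<open>b1 < 1\<close> \<open>b2 < 1\<close> by auto
    fix t assume "t \<notin> {min a1 a2..max b1 b2}"
    then have "t \<notin> {a1..b1}" "t \<notin> {a2..b2}" by auto
    then show "a * f t - b * h t = 0"
      using \<open>\<And>t. t \<notin> {a1..b1} \<Longrightarrow> f t = 0\<close> \<open>\<And>t. t \<notin> {a2..b2} \<Longrightarrow> h t = 0\<close> by simp
  qed
qed

lemma test_function_antiderivative:
  assumes \<psi>: "test_function \<psi>" and zero: "(LINT t|unit_measure. \<psi> t) = 0"
  shows "test_function (primitive \<psi>)" "deriv (primitive \<psi>) = \<psi>"
proof -
  obtain a b where ab: "0 < a" "b < 1" "\<And>t. t \<notin> {a..b} \<Longrightarrow> \<psi> t = 0"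
    using \<psi> unfolding test_function_def by blast
  have below: "primitive \<psi> t = 0" if "t < a" for t
  proof -
    have "primitive \<psi> t = (LINT s|unit_measure. 0)"
      unfolding primitive_def by (rule Bochner_Integration.integral_cong) (use ab(3) that in \<open>auto simp: indicator_def\<close>)
    then show ?thesis by simp
  qed
  have above: "primitive \<psi> t = 0" if "b < t" for t
  proof -
    have "primitive \<psi> t = (LINT s|unit_measure. \<psi> s)"
      unfolding primitive_def by (rule Bochner_Integration.integral_cong) (use ab(3) that in \<open>force simp: indicator_def\<close>)+
    then show ?thesis using zero by simp
  qed
  note cont = test_function_continuous(1)[OF \<psi>]
  have der: "(primitive \<psi> has_real_derivative \<psi> t) (at t)" for t
  proof -
    consider "t < a" | "b < t" | "0 < t" "t < 1" using ab by linarith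
    then show ?thesis
    proof cases
      case 1
      have "((\<lambda>x. 0) has_real_derivative \<psi> t) (at t)" using ab(3) 1 by simp
      then show ?thesis
        by (rule has_field_derivative_transform_within_open[where S="{..<a}"]) (use 1 below in auto)
    next
      case 2
      have "((\<lambda>x. 0) has_real_derivative \<psi> t) (at t)" using ab(3) 2 by simp
      then show ?thesis
        by (rule has_field_derivative_transform_within_open[where S="{b<..}"]) (use 2 above in auto)
    next
      case 3
      have "(primitive \<psi> has_vector_derivative \<psi> t) (at t within {0..1})"
        using 3 by (intro primitive_has_vector_derivative continuous_integrable_unit cont) auto
      then have "(primitive \<psi> has_vector_derivative \<psi> t) (at t within {0<..<1})"
        by (rule has_vector_derivative_within_subset) auto
      moreover have "at t within {0<..<1} = at t" by (rule at_within_open) (use 3 in auto)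
      ultimately show ?thesis
        unfolding has_real_derivative_iff_has_vector_derivative by (simp only:)
    qed
  qed
  then show d: "deriv (primitive \<psi>) = \<psi>" by (intro ext DERIV_imp_deriv)
  show "test_function (primitive \<psi>)"
    unfolding test_function_def
  proof (intro conjI allI)
    fix k t
    show "(deriv ^^ k) (primitive \<psi>) differentiable (at t)"
    proof (cases k)
      case 0
      then show ?thesis using der real_differentiable_def by auto
    next
      case (Suc m)
      then have "(deriv ^^ k) (primitive \<psi>) = (deriv ^^ m) \<psi>"
        by (simp add: funpow_swap1 d)
      then show ?thesis using \<psi> unfolding test_function_def by metis
    qed
    show "\<exists>a b. 0 < a \<and> b < 1 \<and> (\<forall>t. t \<notin> {a..b} \<longrightarrow> primitive \<psi> t = 0)"
    proof (rule exI[of _ a], rule exI[of _ b], intro conjI allI impI ab(1,2))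
      fix t assume "t \<notin> {a..b}"
      then have "t < a \<or> b < t" by auto
      then show "primitive \<psi> t = 0" using below above by blast
    qed
  qed
qed

section \<open>Weak derivatives\<close>

lemma integrable_lebesgue_on_Icc_iff:
  fixes f :: "real \<Rightarrow> 'v::{banach, second_countable_topology}"
  assumes "0 < a" "b < 1"
  shows "integrable (lebesgue_on {a..b}) f \<longleftrightarrow> integrable unit_measure (\<lambda>t. indicat_real {a..b} t *\<^sub>R f t)"
proof -
  have "(\<lambda>t. indicat_real {0<..<1} t *\<^sub>R indicat_real {a..b} t *\<^sub>R f t) = (\<lambda>t. indicat_real {a..b} t *\<^sub>R f t)"
    using assms by (auto simp: indicator_def)
  then show ?thesis
    by (simp add: integrable_restrict_space del: scaleR_scaleR)
qed

lemma integrable_imp_locally_integrable: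
  "integrable unit_measure f \<Longrightarrow> locally_integrable f"
  unfolding locally_integrable_def
  by (auto simp: integrable_lebesgue_on_Icc_iff intro: integrable_unit_indicator)

lemma locally_integrable_cong:
  assumes "\<And>t. 0 < t \<Longrightarrow> t < 1 \<Longrightarrow> f t = h t"
  shows "locally_integrable f \<longleftrightarrow> locally_integrable h"
proof -
  have "integrable (lebesgue_on {a..b}) f \<longleftrightarrow> integrable (lebesgue_on {a..b}) h" if "0 < a" "b < 1" for a b
    by (rule Bochner_Integration.integrable_cong) (use assms that in auto)
  then show ?thesis unfolding locally_integrable_def by blast
qed

lemma has_weak_derivative_cong:
  assumes "\<And>t. 0 < t \<Longrightarrow> t < 1 \<Longrightarrow> f t = h t"
  shows "has_weak_derivative f u \<longleftrightarrow> has_weak_derivative h u"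
proof -
  have "(LINT t|unit_measure. deriv \<phi> t *\<^sub>R f t) = (LINT t|unit_measure. deriv \<phi> t *\<^sub>R h t)" for \<phi>
    by (rule Bochner_Integration.integral_cong) (use assms in auto)
  then show ?thesis
    unfolding has_weak_derivative_def using locally_integrable_cong[OF assms] by simp
qed

lemma eventually_inside_unit:
  assumes "0 < t" "t < (1::real)"
  shows "\<forall>\<^sub>F n in sequentially. t \<in> {1 / real (n + 3)..1 - 1 / real (n + 3)}"
proof -
  have "(\<lambda>n. 1 / real (n + 3)) \<longlonglongrightarrow> 0"
    by (rule LIMSEQ_ignore_initial_segment[OF lim_1_over_n])
  from order_tendstoD(2)[OF this, of "min t (1 - t)"] assms
  have "\<forall>\<^sub>F n in sequentially. 1 / real (n + 3) < min t (1 - t)" by auto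
  then show ?thesis by eventually_elim auto
qed

lemma locally_integrable_measurable:
  assumes "locally_integrable f"
  shows "f \<in> borel_measurable unit_measure"
proof (rule borel_measurable_LIMSEQ_metric)
  show "(\<lambda>t. indicat_real {1 / real (n + 3)..1 - 1 / real (n + 3)} t *\<^sub>R f t) \<in> borel_measurable unit_measure" for n
  proof (rule borel_measurable_integrable)
    have "integrable (lebesgue_on {1 / real (n + 3)..1 - 1 / real (n + 3)}) f"
      using assms unfolding locally_integrable_def by auto
    then show "integrable unit_measure (\<lambda>t. indicat_real {1 / real (n + 3)..1 - 1 / real (n + 3)} t *\<^sub>R f t)"
      by (subst (asm) integrable_lebesgue_on_Icc_iff) auto
  qed
  fix t :: real assume "t \<in> space unit_measure"
  then have "\<forall>\<^sub>F n in sequentially. t \<in> {1 / real (n + 3)..1 - 1 / real (n + 3)}"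
    by (intro eventually_inside_unit) auto
  then have "\<forall>\<^sub>F n in sequentially. indicat_real {1 / real (n + 3)..1 - 1 / real (n + 3)} t *\<^sub>R f t = f t"
    by eventually_elim (simp add: indicator_def)
  then show "(\<lambda>n. indicat_real {1 / real (n + 3)..1 - 1 / real (n + 3)} t *\<^sub>R f t) \<longlonglongrightarrow> f t"
    by (rule tendsto_eventually)
qed

lemma bump_integral_tendsto:
  assumes f: "locally_integrable f" and ab: "0 < a" "a < b" "b < 1"
  shows "(\<lambda>n. LINT t|unit_measure. bump a b n t *\<^sub>R f t) \<longlonglongrightarrow> (LINT t|unit_measure. indicat_real {a<..<b} t *\<^sub>R f t)"
proof (rule integral_dominated_convergence[where w="\<lambda>t. norm (indicat_real {a..b} t *\<^sub>R f t)"])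
  note [measurable] = locally_integrable_measurable[OF f]
  have [measurable]: "indicat_real {a<..<b} \<in> borel_measurable unit_measure"
    by (intro borel_measurable_unit) auto
  have [measurable]: "bump a b n \<in> borel_measurable unit_measure" for n
    by (intro borel_measurable_unit borel_measurable_continuous_onI test_function_continuous(1)
        bump_test_function ab)
  show "(\<lambda>t. indicat_real {a<..<b} t *\<^sub>R f t) \<in> borel_measurable unit_measure" by measurable
  show "(\<lambda>t. bump a b n t *\<^sub>R f t) \<in> borel_measurable unit_measure" for n by measurable
  show "integrable unit_measure (\<lambda>t. norm (indicat_real {a..b} t *\<^sub>R f t))"
    using f ab unfolding locally_integrable_def
    by (intro integrable_norm) (simp flip: integrable_lebesgue_on_Icc_iff)
  show "AE t in unit_measure. (\<lambda>n. bump a b n t *\<^sub>R f t) \<longlonglongrightarrow> indicat_real {a<..<b} t *\<^sub>R f t"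
    by (intro AE_I2 tendsto_intros bump_tendsto_indicator ab)
  show "AE t in unit_measure. norm (bump a b n t *\<^sub>R f t) \<le> norm (indicat_real {a..b} t *\<^sub>R f t)" for n
  proof (rule AE_I2)
    fix t
    show "norm (bump a b n t *\<^sub>R f t) \<le> norm (indicat_real {a..b} t *\<^sub>R f t)"
      using bump_outside[OF ab(2), of t n] bump_bounds[of a b n t]
      by (cases "t \<in> {a<..<b}") (auto simp: mult_left_le_one_le)
  qed
qed

text \<open>By dominated convergence bumps may be replaced by indicator functions of intervals. As
  \<open>f\<close> is only locally integrable, the unit interval is exhausted by smaller
  ones.\<close>

proposition fundamental_lemma_of_variations:
  assumes f: "locally_integrable f"
    and zero: "\<And>\<phi>. test_function \<phi> \<Longrightarrow> (LINT t|unit_measure. \<phi> t *\<^sub>R f t) = 0"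
  shows "AE t in unit_measure. f t = 0"
proof -
  have int0: "(LINT t|unit_measure. indicat_real {a<..<b} t *\<^sub>R f t) = 0" if "0 < a" "a < b" "b < 1" for a b
    using bump_integral_tendsto[OF f that] zero[OF bump_test_function[OF that]] by (simp add: LIMSEQ_const_iff)
  have "AE t in unit_measure. indicat_real {1 / real (n + 3)<..<1 - 1 / real (n + 3)} t *\<^sub>R f t = 0" for n
  proof (rule AE_zero_if_interval_integrals_zero)
    let ?c = "1 / real (n + 3)" and ?d = "1 - 1 / real (n + 3)"
    have c: "0 < ?c" by simp
    have "integrable unit_measure (\<lambda>t. indicat_real {?c..?d} t *\<^sub>R f t)"
      using f unfolding locally_integrable_def by (subst integrable_lebesgue_on_Icc_iff[symmetric]) auto
    then have "integrable unit_measure (\<lambda>t. indicat_real {?c<..<?d} t *\<^sub>R indicat_real {?c..?d} t *\<^sub>R f t)"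
      by (rule integrable_unit_indicator) auto
    moreover have "(\<lambda>t. indicat_real {?c<..<?d} t *\<^sub>R indicat_real {?c..?d} t *\<^sub>R f t) = (\<lambda>t. indicat_real {?c<..<?d} t *\<^sub>R f t)"
      by (auto simp: indicator_def)
    ultimately show "integrable unit_measure (\<lambda>t. indicat_real {?c<..<?d} t *\<^sub>R f t)" by simp
    fix a b :: real assume ab: "0 < a" "a < b" "b < 1"
    have "(LINT t|unit_measure. indicat_real {a<..<b} t *\<^sub>R indicat_real {?c<..<?d} t *\<^sub>R f t) =
        (LINT t|unit_measure. indicat_real {max a ?c<..<min b ?d} t *\<^sub>R f t)"
      by (rule Bochner_Integration.integral_cong) (auto simp: indicator_def)
    also have "\<dots> = 0"
    proof (cases "max a ?c < min b ?d")
      case True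
      then show ?thesis using ab c by (intro int0) (simp_all only: less_max_iff_disj min_less_iff_disj, auto)
    next
      case False
      then have "{max a ?c<..<min b ?d} = {}"
        by (simp only: greaterThanLessThan_empty_iff not_less)
      then have "indicat_real {max a ?c<..<min b ?d} = (\<lambda>_. 0)"
        by (simp only:) (simp add: indicator_def fun_eq_iff)
      then show ?thesis by (simp only:) simp
    qed
    finally show "(LINT t|unit_measure. indicat_real {a<..<b} t *\<^sub>R indicat_real {?c<..<?d} t *\<^sub>R f t) = 0" .
  qed
  then have "AE t in unit_measure. \<forall>n. indicat_real {1 / real (n + 3)<..<1 - 1 / real (n + 3)} t *\<^sub>R f t = 0"
    by (intro AE_all_countable[THEN iffD2] allI)
  with AE_unit_mem show ?thesis
  proof eventually_elim
    case (elim t)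
    have "(\<lambda>n. 1 / real (n + 3)) \<longlonglongrightarrow> 0"
      by (rule LIMSEQ_ignore_initial_segment[OF lim_1_over_n])
    from order_tendstoD(2)[OF this, of "min t (1 - t)"] elim
    have "\<forall>\<^sub>F n in sequentially. 1 / real (n + 3) < min t (1 - t)" by auto
    then obtain n where "1 / real (n + 3) < min t (1 - t)" by (auto simp: eventually_sequentially)
    then have "t \<in> {1 / real (n + 3)<..<1 - 1 / real (n + 3)}" by auto
    moreover have "indicat_real {1 / real (n + 3)<..<1 - 1 / real (n + 3)} t *\<^sub>R f t = 0" using elim by blast
    ultimately show ?case by (simp only: indicator_simps) simp
  qed
qed


lemma weak_derivative_AE_unique:
  assumes "has_weak_derivative f u" "has_weak_derivative f w"
  shows "AE t in unit_measure. u t = w t"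
proof -
  have u: "locally_integrable u" and w: "locally_integrable w"
    using assms by (auto simp: has_weak_derivative_def)
  have "locally_integrable (\<lambda>t. u t - w t)"
    using u w by (auto simp: locally_integrable_def)
  moreover have "(LINT t|unit_measure. \<phi> t *\<^sub>R (u t - w t)) = 0" if \<phi>: "test_function \<phi>" for \<phi>
  proof -
    obtain a b where ab: "0 < a" "b < 1" "\<And>t. t \<notin> {a..b} \<Longrightarrow> \<phi> t = 0"
      using \<phi> unfolding test_function_def by blast
    obtain C where C: "\<And>t. t \<in> {0..1} \<Longrightarrow> \<bar>\<phi> t\<bar> \<le> C" using test_function_bounded[OF \<phi>] by metis
    have i: "integrable unit_measure (\<lambda>t. \<phi> t *\<^sub>R h t)" if h: "locally_integrable h" for h :: "real \<Rightarrow> 'a"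
    proof (rule Bochner_Integration.integrable_bound)
      show "integrable unit_measure (\<lambda>t. C *\<^sub>R (indicat_real {a..b} t *\<^sub>R h t))"
        using h ab unfolding locally_integrable_def
        by (intro integrable_scaleR_right) (simp flip: integrable_lebesgue_on_Icc_iff)
      have [measurable]: "\<phi> \<in> borel_measurable unit_measure" "h \<in> borel_measurable unit_measure"
        by (intro borel_measurable_unit borel_measurable_continuous_onI test_function_continuous(1) \<phi>)
          (rule locally_integrable_measurable[OF h])
      show "(\<lambda>t. \<phi> t *\<^sub>R h t) \<in> borel_measurable unit_measure" by measurable
      show "AE t in unit_measure. norm (\<phi> t *\<^sub>R h t) \<le> norm (C *\<^sub>R (indicat_real {a..b} t *\<^sub>R h t))"
      proof (rule AE_I2)
        fix t assume "t \<in> space unit_measure"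
        then have "\<bar>\<phi> t\<bar> \<le> \<bar>C\<bar>" using C[of t] by auto
        then show "norm (\<phi> t *\<^sub>R h t) \<le> norm (C *\<^sub>R (indicat_real {a..b} t *\<^sub>R h t))"
          using ab(3)[of t] by (cases "t \<in> {a..b}") (auto simp: mult_right_mono)
      qed
    qed
    have "(LINT t|unit_measure. \<phi> t *\<^sub>R (u t - w t)) =
        (LINT t|unit_measure. \<phi> t *\<^sub>R u t) - (LINT t|unit_measure. \<phi> t *\<^sub>R w t)"
      unfolding scaleR_diff_right by (rule Bochner_Integration.integral_diff[OF i[OF u] i[OF w]])
    also have "\<dots> = 0" using assms \<phi> unfolding has_weak_derivative_def by auto
    finally show ?thesis .
  qed
  ultimately have "AE t in unit_measure. u t - w t = 0" by (rule fundamental_lemma_of_variations)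
  then show ?thesis by eventually_elim simp
qed

lemma integrable_test_scaleR:
  fixes u :: "real \<Rightarrow> 'v::{banach, second_countable_topology}"
  assumes u: "integrable unit_measure u" and \<phi>: "continuous_on UNIV \<phi>"
  shows "integrable unit_measure (\<lambda>t. \<phi> t *\<^sub>R u t)"
proof -
  obtain C where C: "\<And>t. t \<in> {0..1} \<Longrightarrow> norm (\<phi> t) \<le> C"
    by (rule continuous_bounded_unit[OF continuous_on_subset[OF \<phi>]]) blast+
  have [measurable]: "\<phi> \<in> borel_measurable unit_measure" "u \<in> borel_measurable unit_measure"
    using u by (auto intro: borel_measurable_unit borel_measurable_continuous_onI[OF \<phi>])
  show ?thesis
  proof (rule Bochner_Integration.integrable_bound)
    show "integrable unit_measure (\<lambda>t. C *\<^sub>R u t)" using u by (rule integrable_scaleR_right)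
    show "AE t in unit_measure. norm (\<phi> t *\<^sub>R u t) \<le> norm (C *\<^sub>R u t)"
    proof (rule AE_I2)
      fix t assume "t \<in> space unit_measure"
      then have "\<bar>\<phi> t\<bar> \<le> \<bar>C\<bar>" using C[of t] by auto
      then show "norm (\<phi> t *\<^sub>R u t) \<le> norm (C *\<^sub>R u t)" by (simp add: mult_right_mono)
    qed
  qed measurable
qed

lemma continuous_on_primitive:
  assumes "square_integrable u"
  shows "continuous_on {0..1} (primitive u)"
proof (rule continuous_onI)
  fix x e :: real assume x: "x \<in> {0..1}" and e: "0 < e"
  define K where "K = sqrt (LINT x|unit_measure. (norm (u x))\<^sup>2)"
  have K: "0 \<le> K" unfolding K_def by (intro real_sqrt_ge_zero integral_nonneg_AE) auto
  define d where "d = (e / (K + 1))\<^sup>2"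
  have bound: "dist (primitive u s) (primitive u t) \<le> e" if "s \<le> t" "t - s < d" "s \<in> {0..1}" "t \<in> {0..1}" for s t
  proof -
    have "norm (primitive u t - primitive u s) \<le> sqrt (t - s) * K"
      unfolding K_def by (rule norm_primitive_diff_le_sqrt[OF assms]) (use that in auto)
    also have "\<dots> \<le> sqrt d * K" using that K by (intro mult_right_mono) auto
    also have "\<dots> = e * (K / (K + 1))" using e K by (simp add: d_def)
    also have "\<dots> \<le> e * 1" using e K by (intro mult_left_mono) (auto simp: field_simps)
    finally show ?thesis by (simp add: dist_norm norm_minus_commute)
  qed
  show "\<exists>d>0. \<forall>x'\<in>{0..1}. dist x' x < d \<longrightarrow> dist (primitive u x') (primitive u x) \<le> e"
  proof (intro exI[of _ d] conjI ballI impI)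
    show "0 < d" using e K by (auto simp: d_def intro!: zero_less_power divide_pos_pos)
    fix y assume y: "y \<in> {0..1}" "dist y x < d"
    show "dist (primitive u y) (primitive u x) \<le> e"
    proof (cases "x \<le> y")
      case True
      then show ?thesis using bound[of x y] x y by (simp add: dist_commute dist_real_def)
    next
      case False
      then show ?thesis using bound[of y x] x y by (simp add: dist_real_def)
    qed
  qed
qed

text \<open>Integration by parts, by Fubini's theorem on the triangle \<open>s \<le>
  t\<close>.\<close>

lemma integral_test_derivative_primitive:
  fixes u :: "real \<Rightarrow> 'v::{banach, second_countable_topology}"
  assumes sq: "square_integrable u" and \<phi>: "test_function \<phi>"
  shows "(LINT t|unit_measure. deriv \<phi> t *\<^sub>R primitive u t) = - (LINT t|unit_measure. \<phi> t *\<^sub>R u t)"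
proof -
  interpret P: pair_sigma_finite unit_measure unit_measure ..
  note u = square_integrable_imp_integrable[OF sq]
  note cont = test_function_continuous[OF \<phi>]
  obtain C where C: "\<And>t. t \<in> {0..1} \<Longrightarrow> \<bar>\<phi> t\<bar> \<le> C" "\<And>t. t \<in> {0..1} \<Longrightarrow> \<bar>deriv \<phi> t\<bar> \<le> C"
    using test_function_bounded[OF \<phi>] by metis
  have \<phi>t: "\<phi> t = primitive (deriv \<phi>) t" if "t \<in> {0..1}" for t
    using primitive_of_derivative[of \<phi> "deriv \<phi>", OF _ cont that] test_function_derivative[OF \<phi>]
      test_function_endpoints[OF \<phi>]
    by (simp add: has_real_derivative_iff_has_vector_derivative)
  have [measurable]: "u \<in> borel_measurable unit_measure" using u by auto
  have [measurable]: "deriv \<phi> \<in> borel_measurable unit_measure"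
    by (intro borel_measurable_unit borel_measurable_continuous_onI cont)
  have id [measurable]: "(\<lambda>x. x) \<in> borel_measurable unit_measure"
    by (rule borel_measurable_unit) simp
  have fst_m [measurable]: "fst \<in> borel_measurable (unit_measure \<Otimes>\<^sub>M unit_measure)"
    and snd_m [measurable]: "snd \<in> borel_measurable (unit_measure \<Otimes>\<^sub>M unit_measure)"
    using measurable_compose[OF measurable_fst id] measurable_compose[OF measurable_snd id] by auto
  define F where "F t s = (deriv \<phi> t * (if s \<le> t then 1 else 0)) *\<^sub>R u s" for t s
  have Fi: "integrable (unit_measure \<Otimes>\<^sub>M unit_measure) (case_prod F)"
  proof (rule P.Fubini_integrable)
    have "(\<lambda>p. (deriv \<phi> (fst p) * (if snd p \<le> fst p then 1 else 0)) *\<^sub>R u (snd p))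
        \<in> borel_measurable (unit_measure \<Otimes>\<^sub>M unit_measure)" by measurable
    then show m: "case_prod F \<in> borel_measurable (unit_measure \<Otimes>\<^sub>M unit_measure)"
      by (simp add: F_def case_prod_beta' cong: if_cong)
    have "integrable unit_measure (\<lambda>t. LINT s|unit_measure. norm (F t s))"
    proof (rule integrable_unit_bounded[where C="C * (LINT s|unit_measure. norm (u s))"])
      have "(\<lambda>(t, s). norm (F t s)) \<in> borel_measurable (unit_measure \<Otimes>\<^sub>M unit_measure)"
        using m by (simp add: case_prod_beta')
      then show "(\<lambda>t. LINT s|unit_measure. norm (F t s)) \<in> borel_measurable unit_measure"
        by (rule unit_measure.borel_measurable_lebesgue_integral)
      fix t :: real assume t: "0 < t" "t < 1"
      have "(LINT s|unit_measure. norm (F t s)) \<le> (LINT s|unit_measure. C * norm (u s))"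
      proof (rule integral_mono_AE')
        show "integrable unit_measure (\<lambda>s. C * norm (u s))"
          by (intro integrable_mult_right integrable_norm u)
        have "norm (F t s) \<le> C * norm (u s)" for s
          using C(2)[of t] t by (auto simp: F_def mult_right_mono)
        then show "AE s in unit_measure. norm (F t s) \<le> C * norm (u s)" by simp
      qed (use C(1)[of 0] in auto)
      then show "norm (LINT s|unit_measure. norm (F t s)) \<le> C * (LINT s|unit_measure. norm (u s))"
        by (simp add: integral_nonneg_AE)
    qed
    then show "integrable unit_measure (\<lambda>x. LINT y|unit_measure. norm (case_prod F (x, y)))" by simp
    show "AE x in unit_measure. integrable unit_measure (\<lambda>y. case_prod F (x, y))"
    proof (rule AE_I2)
      fix x
      have "integrable unit_measure (\<lambda>s. deriv \<phi> x *\<^sub>R (indicat_real {..x} s *\<^sub>R u s))"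
        by (intro integrable_scaleR_right integrable_unit_indicator u) auto
      then show "integrable unit_measure (\<lambda>y. case_prod F (x, y))"
        by (simp add: F_def indicator_def of_bool_def cong: if_cong)
    qed
  qed
  have "(LINT t|unit_measure. deriv \<phi> t *\<^sub>R primitive u t) = (LINT t|unit_measure. LINT s|unit_measure. F t s)"
  proof (rule Bochner_Integration.integral_cong[OF refl])
    fix t
    have "deriv \<phi> t *\<^sub>R primitive u t = (LINT s|unit_measure. deriv \<phi> t *\<^sub>R (indicat_real {..t} s *\<^sub>R u s))"
      unfolding primitive_def by (rule integral_scaleR_right[symmetric])
    also have "\<dots> = (LINT s|unit_measure. F t s)"
      by (rule Bochner_Integration.integral_cong) (auto simp: F_def indicator_def)
    finally show "deriv \<phi> t *\<^sub>R primitive u t = (LINT s|unit_measure. F t s)" .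
  qed
  also have "\<dots> = (LINT s|unit_measure. LINT t|unit_measure. F t s)"
    by (rule P.Fubini_integral[OF Fi, symmetric])
  also have "\<dots> = (LINT s|unit_measure. - (\<phi> s *\<^sub>R u s))"
  proof (rule Bochner_Integration.integral_cong[OF refl])
    fix s assume "s \<in> space unit_measure"
    then have s: "0 < s" "s < 1" by auto
    have i: "integrable unit_measure (\<lambda>t. indicat_real {s<..1} t *\<^sub>R deriv \<phi> t)"
      by (intro integrable_unit_indicator continuous_integrable_unit cont) auto
    have "(LINT t|unit_measure. F t s) = (LINT t|unit_measure. (indicat_real {s<..1} t *\<^sub>R deriv \<phi> t) *\<^sub>R u s)"
    proof (rule integral_cong_AE)
      show "AE t in unit_measure. F t s = (indicat_real {s<..1} t *\<^sub>R deriv \<phi> t) *\<^sub>R u s"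
        using AE_unit_neq[of s] AE_unit_mem by eventually_elim (auto simp: F_def indicator_def)
      show "(\<lambda>t. (indicat_real {s<..1} t *\<^sub>R deriv \<phi> t) *\<^sub>R u s) \<in> borel_measurable unit_measure"
        using i by (intro borel_measurable_scaleR borel_measurable_integrable[OF i]) simp
      show "(\<lambda>t. F t s) \<in> borel_measurable unit_measure" unfolding F_def by measurable
    qed
    also have "\<dots> = (LINT t|unit_measure. indicat_real {s<..1} t *\<^sub>R deriv \<phi> t) *\<^sub>R u s"
      by (rule integral_scaleR_left) (rule i)
    also have "(LINT t|unit_measure. indicat_real {s<..1} t *\<^sub>R deriv \<phi> t) = primitive (deriv \<phi>) 1 - primitive (deriv \<phi>) s"
      by (rule primitive_diff[symmetric]) (use s in \<open>auto intro: continuous_integrable_unit cont\<close>)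
    also have "\<dots> = - \<phi> s" using \<phi>t[of 1] \<phi>t[of s] s test_function_endpoints[OF \<phi>] by simp
    finally show "(LINT t|unit_measure. F t s) = - (\<phi> s *\<^sub>R u s)" by simp
  qed
  finally show ?thesis by simp
qed

lemma integral_test_derivative:
  assumes \<phi>: "test_function \<phi>"
  shows "(LINT t|unit_measure. deriv \<phi> t) = 0"
proof -
  note cont = test_function_continuous[OF \<phi>]
  have "\<phi> 1 = \<phi> 0 + primitive (deriv \<phi>) 1"
    using primitive_of_derivative[of \<phi> "deriv \<phi>", OF _ cont, of 1] test_function_derivative[OF \<phi>]
    by (simp add: has_real_derivative_iff_has_vector_derivative)
  then show ?thesis using test_function_endpoints[OF \<phi>] by (simp add: primitive_1)
qed

lemma square_integrable_primitive:
  assumes "square_integrable u"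
  shows "integrable unit_measure (\<lambda>t. c + primitive u t)"
  by (intro continuous_integrable_unit continuous_intros continuous_on_primitive assms)

lemma has_weak_derivative_primitive:
  assumes "square_integrable u"
  shows "has_weak_derivative (\<lambda>t. c + primitive u t) u"
  unfolding has_weak_derivative_def
proof (intro conjI allI impI)
  show "locally_integrable (\<lambda>t. c + primitive u t)"
    by (intro integrable_imp_locally_integrable square_integrable_primitive assms)
  show "locally_integrable u"
    by (intro integrable_imp_locally_integrable square_integrable_imp_integrable assms)
  fix \<phi> assume \<phi>: "test_function \<phi>"
  note cont = test_function_continuous[OF \<phi>]
  have "(LINT t|unit_measure. deriv \<phi> t *\<^sub>R (c + primitive u t)) =
      (LINT t|unit_measure. deriv \<phi> t *\<^sub>R c) + (LINT t|unit_measure. deriv \<phi> t *\<^sub>R primitive u t)"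
    unfolding scaleR_add_right
    by (rule Bochner_Integration.integral_add)
      (intro integrable_test_scaleR cont continuous_integrable_unit continuous_on_primitive assms continuous_intros)+
  also have "(LINT t|unit_measure. deriv \<phi> t *\<^sub>R c) = (LINT t|unit_measure. deriv \<phi> t) *\<^sub>R c"
    by (rule integral_scaleR_left) (intro continuous_integrable_unit cont)
  finally show "(LINT t|unit_measure. deriv \<phi> t *\<^sub>R (c + primitive u t)) = - (LINT t|unit_measure. \<phi> t *\<^sub>R u t)"
    by (simp add: integral_test_derivative[OF \<phi>] integral_test_derivative_primitive[OF assms \<phi>])
qed

text \<open>The lemma of du Bois-Reymond: \<open>h = f - primitive u\<close> is orthogonal to the
  derivatives of all test functions, that is, to all test functions of mean zero. Subtracting a
  multiple of a fixed bump \<open>\<psi>\<close> gives any test function mean zero, so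
  \<open>h\<close> minus a constant is orthogonal to all test functions.\<close>

lemma weak_derivative_imp_primitive:
  assumes fu: "has_weak_derivative f u" and f: "square_integrable f" and u: "square_integrable u"
  obtains c where "AE t in unit_measure. f t = c + primitive u t"
proof -
  define h where "h t = f t - primitive u t" for t
  have hi: "integrable unit_measure h"
    unfolding h_def
    using square_integrable_imp_integrable[OF f] square_integrable_primitive[OF u, of 0] by simp
  have zero: "(LINT t|unit_measure. deriv \<phi> t *\<^sub>R h t) = 0" if \<phi>: "test_function \<phi>" for \<phi>
  proof -
    have "(LINT t|unit_measure. deriv \<phi> t *\<^sub>R h t) =
      (LINT t|unit_measure. deriv \<phi> t *\<^sub>R f t) - (LINT t|unit_measure. deriv \<phi> t *\<^sub>R primitive u t)"
      unfolding h_def scaleR_diff_right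
      by (rule Bochner_Integration.integral_diff)
        (intro integrable_test_scaleR test_function_continuous[OF \<phi>] square_integrable_imp_integrable f
          continuous_integrable_unit continuous_on_primitive u)+
    also have "(LINT t|unit_measure. deriv \<phi> t *\<^sub>R f t) = - (LINT t|unit_measure. \<phi> t *\<^sub>R u t)"
      using fu \<phi> unfolding has_weak_derivative_def by blast
    finally show ?thesis by (simp add: integral_test_derivative_primitive[OF u \<phi>])
  qed
  have "(\<lambda>n. LINT t|unit_measure. bump (1/4) (3/4) n t *\<^sub>R (1::real)) \<longlonglongrightarrow> (LINT t|unit_measure. indicat_real {1/4<..<3/4} t *\<^sub>R (1::real))"
    by (rule bump_integral_tendsto) (auto intro!: integrable_imp_locally_integrable)
  moreover have "(LINT t|unit_measure. indicat_real {1/4<..<3/4} t *\<^sub>R (1::real)) = 1/2"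
  proof -
    have "(LINT t|unit_measure. indicat_real {1/4<..<3/4} t *\<^sub>R (1::real)) = (LINT t|unit_measure. indicat_real {1/4<..3/4} t)"
    proof (rule integral_cong_AE)
      show "AE t in unit_measure. indicat_real {1/4<..<3/4} t *\<^sub>R (1::real) = indicat_real {1/4<..3/4} t"
        using AE_unit_neq[of "3/4"] by eventually_elim (auto simp: indicator_def)
    qed (intro borel_measurable_unit; simp)+
    then show ?thesis using measure_unit_Ioc[of "1/4" "3/4"] by simp
  qed
  ultimately have lim: "(\<lambda>n. LINT t|unit_measure. bump (1/4) (3/4) n t) \<longlonglongrightarrow> 1/2"
    by (simp only: real_scaleR_def mult_1_right)
  obtain n where n: "(LINT t|unit_measure. bump (1/4) (3/4) n t) > 0"
    using order_tendstoD(1)[OF lim, of 0] by (auto simp: eventually_sequentially)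
  define \<psi> where "\<psi> = bump (1/4) (3/4) n"
  define m where "m = (LINT t|unit_measure. \<psi> t)"
  have m: "m > 0" using n by (simp add: m_def \<psi>_def)
  have \<psi>: "test_function \<psi>" unfolding \<psi>_def by (rule bump_test_function) auto
  define c where "c = (1 / m) *\<^sub>R (LINT t|unit_measure. \<psi> t *\<^sub>R h t)"
  have "AE t in unit_measure. h t - c = 0"
  proof (rule fundamental_lemma_of_variations)
    show "locally_integrable (\<lambda>t. h t - c)" using hi by (intro integrable_imp_locally_integrable) auto
    fix \<phi> assume \<phi>: "test_function \<phi>"
    define I where "I = (LINT t|unit_measure. \<phi> t)"
    define \<theta> where "\<theta> t = 1 * \<phi> t - (I / m) * \<psi> t" for t
    have \<theta>: "test_function \<theta>" unfolding \<theta>_def by (rule test_function_linear[OF \<phi> \<psi>])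
    have i: "integrable unit_measure \<phi>" "integrable unit_measure \<psi>"
      by (intro continuous_integrable_unit test_function_continuous \<phi> \<psi>)+
    have ih: "integrable unit_measure (\<lambda>t. \<phi> t *\<^sub>R h t)" "integrable unit_measure (\<lambda>t. \<psi> t *\<^sub>R h t)"
      by (intro integrable_test_scaleR hi test_function_continuous \<phi> \<psi>)+
    have "(LINT t|unit_measure. \<theta> t) = I - I / m * m"
      unfolding \<theta>_def using i by (simp add: I_def m_def)
    with m have "(LINT t|unit_measure. \<theta> t) = 0" by simp
    from zero[OF test_function_antiderivative(1)[OF \<theta> this]]
    have "0 = (LINT t|unit_measure. \<theta> t *\<^sub>R h t)"
      unfolding test_function_antiderivative(2)[OF \<theta> \<open>(LINT t|unit_measure. \<theta> t) = 0\<close>] by simp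
    also have "\<dots> = (LINT t|unit_measure. \<phi> t *\<^sub>R h t - (I / m) *\<^sub>R (\<psi> t *\<^sub>R h t))"
      by (simp add: \<theta>_def scaleR_diff_left)
    also have "\<dots> = (LINT t|unit_measure. \<phi> t *\<^sub>R h t) - (LINT t|unit_measure. (I / m) *\<^sub>R (\<psi> t *\<^sub>R h t))"
      by (rule Bochner_Integration.integral_diff[OF ih(1) integrable_scaleR_right[OF ih(2)]])
    also have "(LINT t|unit_measure. (I / m) *\<^sub>R (\<psi> t *\<^sub>R h t)) = (I / m) *\<^sub>R (LINT t|unit_measure. \<psi> t *\<^sub>R h t)"
      by (rule integral_scaleR_right)
    also have "\<dots> = I *\<^sub>R c" by (simp add: c_def)
    finally have 1: "(LINT t|unit_measure. \<phi> t *\<^sub>R h t) = I *\<^sub>R c" by simp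
    have "(LINT t|unit_measure. \<phi> t *\<^sub>R (h t - c)) = (LINT t|unit_measure. \<phi> t *\<^sub>R h t) - (LINT t|unit_measure. \<phi> t *\<^sub>R c)"
      unfolding scaleR_diff_right
      by (rule Bochner_Integration.integral_diff[OF ih(1) integrable_scaleR_left[OF i(1)]])
    also have "(LINT t|unit_measure. \<phi> t *\<^sub>R c) = I *\<^sub>R c"
      unfolding I_def by (rule integral_scaleR_left) (rule i(1))
    finally show "(LINT t|unit_measure. \<phi> t *\<^sub>R (h t - c)) = 0" using 1 by simp
  qed
  then have "AE t in unit_measure. f t = c + primitive u t"
    by eventually_elim (simp add: h_def algebra_simps)
  then show ?thesis by (rule that)
qed

lemma continuous_AE_eq_imp_eq:
  fixes f h :: "real \<Rightarrow> 'v::{banach, second_countable_topology}"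
  assumes f: "continuous_on {0..1} f" and h: "continuous_on {0..1} h"
    and AE: "AE t in unit_measure. f t = h t" and t: "t \<in> {0..1}"
  shows "f t = h t"
proof -
  have cont: "continuous_on {0..1} (\<lambda>t. f t - h t)" by (intro continuous_intros f h)
  note i = continuous_integrable_unit[OF cont]
  have "primitive (\<lambda>t. f t - h t) s = primitive (\<lambda>t. 0) s" for s
    by (rule primitive_cong_AE) (use AE i in \<open>auto intro: borel_measurable_integrable elim: eventually_mono\<close>)
  then have "primitive (\<lambda>t. f t - h t) = (\<lambda>s. 0)" by (simp add: primitive_def fun_eq_iff)
  with primitive_has_vector_derivative[OF i cont t]
  have "((\<lambda>s. 0) has_vector_derivative (f t - h t)) (at t within {0..1})" by (simp only:)
  moreover have "((\<lambda>s. 0) has_vector_derivative 0) (at t within {0..1})" by simp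
  ultimately have "f t - h t = 0"
    by (rule vector_derivative_unique_within_closed_interval[of 0 1 t, unfolded cbox_interval, rotated 2]) (use t in auto)
  then show ?thesis by simp
qed

section \<open>Curves of class \<open>W\<^sup>2\<^sup>,\<^sup>2\<close> as second primitives\<close>

text \<open>The data \<open>(a, b, w)\<close>, initial position, initial velocity and acceleration,
  serve as coordinates of the space of \<open>W\<^sup>2\<^sup>,\<^sup>2\<close> curves. The velocity
  and the curve depend linearly on them.\<close>

definition primitive_velocity :: "'v::{banach, second_countable_topology} \<Rightarrow> (real \<Rightarrow> 'v) \<Rightarrow> real \<Rightarrow> 'v"
  where "primitive_velocity b w t = b + primitive w t"

definition primitive_curve :: "'v::{banach, second_countable_topology} \<Rightarrow> 'v \<Rightarrow> (real \<Rightarrow> 'v) \<Rightarrow> real \<Rightarrow> 'v"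
  where "primitive_curve a b w t = a + primitive (primitive_velocity b w) t"

lemma continuous_primitive_velocity:
  "square_integrable w \<Longrightarrow> continuous_on {0..1} (primitive_velocity b w)"
  unfolding primitive_velocity_def by (intro continuous_intros continuous_on_primitive)

lemma continuous_square_integrable:
  fixes u :: "real \<Rightarrow> 'v::{banach, second_countable_topology}"
  assumes "continuous_on {0..1} u"
  shows "square_integrable u"
proof -
  obtain C where C: "\<And>t. t \<in> {0..1} \<Longrightarrow> norm (u t) \<le> C"
    by (rule continuous_bounded_unit[OF assms]) blast
  show ?thesis
    by (rule square_integrable_bounded[where C=C])
      (use C in \<open>auto intro: borel_measurable_integrable[OF continuous_integrable_unit[OF assms]]\<close>)
qed

lemma square_integrable_primitive_velocity:
  "square_integrable w \<Longrightarrow> square_integrable (primitive_velocity b w)"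
  by (rule continuous_square_integrable[OF continuous_primitive_velocity])

lemma continuous_primitive_curve:
  "square_integrable w \<Longrightarrow> continuous_on {0..1} (primitive_curve a b w)"
  unfolding primitive_curve_def
  by (intro continuous_intros continuous_on_primitive square_integrable_primitive_velocity)

lemma primitive_curve_has_vector_derivative:
  assumes "square_integrable w" "t \<in> {0..1}"
  shows "(primitive_curve a b w has_vector_derivative primitive_velocity b w t) (at t within {0..1})"
proof -
  have "((\<lambda>t. a + primitive (primitive_velocity b w) t) has_vector_derivative 0 + primitive_velocity b w t) (at t within {0..1})"
    by (rule has_vector_derivative_add[OF has_vector_derivative_const primitive_has_vector_derivative[OF
        square_integrable_imp_integrable[OF square_integrable_primitive_velocity[OF assms(1)]]
        continuous_primitive_velocity[OF assms(1)] assms(2)]])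
  then show ?thesis by (simp add: primitive_curve_def[abs_def])
qed

lemma velocity_primitive_curve:
  assumes w: "square_integrable w" and y: "\<And>t. t \<in> {0..1} \<Longrightarrow> y t = primitive_curve a b w t"
    and t: "t \<in> {0..1}"
  shows "velocity y t = primitive_velocity b w t"
proof -
  have "(y has_vector_derivative primitive_velocity b w t) (at t within {0..1})"
    using primitive_curve_has_vector_derivative[OF w t, of a b] y t
    by (metis has_vector_derivative_transform)
  then show ?thesis unfolding velocity_def
    using t by (intro vector_derivative_within_cbox[of 0 1, unfolded cbox_interval]) auto
qed

text \<open>Both weak derivatives are undone by primitives almost everywhere, and two continuous
  functions that agree almost everywhere agree.\<close>

proposition W22_imp_primitive_curve:
  assumes "y \<in> W22"
  obtains a b w where "square_integrable w" "\<And>t. t \<in> {0..1} \<Longrightarrow> y t = primitive_curve a b w t"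
proof -
  from assms obtain u w where cont: "continuous_on {0..1} y" and yu: "has_weak_derivative y u"
    and uw: "has_weak_derivative u w" and sq: "square_integrable y" "square_integrable u" "square_integrable w"
    unfolding W22_def by blast
  obtain b where b: "AE t in unit_measure. u t = b + primitive w t"
    by (rule weak_derivative_imp_primitive[OF uw sq(2,3)])
  obtain a where a: "AE t in unit_measure. y t = a + primitive u t"
    by (rule weak_derivative_imp_primitive[OF yu sq(1,2)])
  have "primitive u t = primitive (primitive_velocity b w) t" for t
    by (rule primitive_cong_AE)
      (use b sq in \<open>auto simp: primitive_velocity_def[abs_def] intro: square_integrable_measurable
         borel_measurable_integrable[OF square_integrable_primitive]\<close>)
  with a have "AE t in unit_measure. y t = primitive_curve a b w t"
    by (simp add: primitive_curve_def)
  then have "y t = primitive_curve a b w t" if "t \<in> {0..1}" for t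
    by (rule continuous_AE_eq_imp_eq[OF cont continuous_primitive_curve[OF sq(3)] _ that])
  with sq(3) show ?thesis by (rule that)
qed

proposition primitive_curve_in_W22:
  assumes w: "square_integrable w" and y: "\<And>t. t \<in> {0..1} \<Longrightarrow> y t = primitive_curve a b w t"
  shows "y \<in> W22"
proof -
  have cont: "continuous_on {0..1} y"
    using continuous_primitive_curve[OF w, of a b] y by (metis continuous_on_cong)
  have "has_weak_derivative (primitive_curve a b w) (primitive_velocity b w)"
    unfolding primitive_curve_def[abs_def]
    by (intro has_weak_derivative_primitive square_integrable_primitive_velocity w)
  then have "has_weak_derivative y (primitive_velocity b w)"
    by (subst has_weak_derivative_cong[where h="primitive_curve a b w"]) (auto simp: y)
  moreover have "has_weak_derivative (primitive_velocity b w) w"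
    unfolding primitive_velocity_def[abs_def] by (rule has_weak_derivative_primitive[OF w])
  ultimately show ?thesis unfolding W22_def
    using cont w continuous_square_integrable[OF cont] square_integrable_primitive_velocity[OF w, of b] by blast
qed

text \<open>The weak derivative chosen by the Hilbert operator is almost everywhere the given
  acceleration, so the choice does not affect the energies.\<close>

lemma weak_derivative_velocity:
  assumes w: "square_integrable w" and y: "\<And>t. t \<in> {0..1} \<Longrightarrow> y t = primitive_curve a b w t"
  shows "AE t in unit_measure. weak_derivative (velocity y) t = w t"
    and "weak_derivative (velocity y) \<in> borel_measurable unit_measure"
proof -
  have "has_weak_derivative (primitive_velocity b w) w"
    unfolding primitive_velocity_def[abs_def] by (rule has_weak_derivative_primitive[OF w])
  moreover have vel: "velocity y t = primitive_velocity b w t" if "t \<in> {0..1}" for t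
    by (rule velocity_primitive_curve[OF w y that])
  ultimately have 1: "has_weak_derivative (velocity y) w"
    by (subst has_weak_derivative_cong[where h="primitive_velocity b w"])
      (use vel in auto)
  have 2: "has_weak_derivative (velocity y) (weak_derivative (velocity y))"
    unfolding weak_derivative_def by (rule someI[of "has_weak_derivative (velocity y)", OF 1])
  show "AE t in unit_measure. weak_derivative (velocity y) t = w t"
    by (rule weak_derivative_AE_unique[OF 2 1])
  show "weak_derivative (velocity y) \<in> borel_measurable unit_measure"
    using 2 unfolding has_weak_derivative_def by (blast intro: locally_integrable_measurable)
qed

section \<open>Symmetric coercive forms\<close>

lemma bilinear_add_left: "bilinear B \<Longrightarrow> B (x + y) z = B x z + B y z"
  and bilinear_add_right: "bilinear B \<Longrightarrow> B z (x + y) = B z x + B z y"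
  and bilinear_scaleR_left: "bilinear B \<Longrightarrow> B (a *\<^sub>R x) z = a * B x z"
  and bilinear_scaleR_right: "bilinear B \<Longrightarrow> B z (a *\<^sub>R x) = a * B z x"
  and bilinear_diff_left: "bilinear B \<Longrightarrow> B (x - y) z = B x z - B y z"
  and bilinear_diff_right: "bilinear B \<Longrightarrow> B z (x - y) = B z x - B z y"
  for B :: "'v::real_vector \<Rightarrow> 'v \<Rightarrow> real"
  by (simp_all add: bilinear_ladd bilinear_radd bilinear_lmul bilinear_rmul bilinear_lsub bilinear_rsub)

lemmas bilinear_expand = bilinear_add_left bilinear_add_right bilinear_scaleR_left bilinear_scaleR_right
  bilinear_diff_left bilinear_diff_right

text \<open>By the polarization identity on unit vectors.\<close>

lemma bilinear_bound_from_diagonal: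
  fixes B :: "'v::real_normed_vector \<Rightarrow> 'v \<Rightarrow> real"
  assumes B: "bilinear B" and sym: "\<And>v w. B v w = B w v"
    and C: "\<And>v. \<bar>B v v\<bar> \<le> C * (norm v)\<^sup>2"
  shows "\<bar>B v w\<bar> \<le> 2 * C * norm v * norm w"
proof -
  have unit: "\<bar>B v w\<bar> \<le> 2 * C" if "norm v = 1" "norm w = 1" for v w
  proof -
    have "C \<ge> 0" using C[of v] that by (simp add: order_trans[OF abs_ge_zero])
    have "4 * B v w = B (v + w) (v + w) - B (v - w) (v - w)"
      using sym[of v w] by (simp add: bilinear_expand[OF B])
    moreover have "\<bar>B (v + w) (v + w)\<bar> \<le> C * 4"
    proof (rule order_trans[OF C])
      have "(norm (v + w))\<^sup>2 \<le> 2\<^sup>2" using norm_triangle_ineq[of v w] that by (intro power_mono) auto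
      then show "C * (norm (v + w))\<^sup>2 \<le> C * 4" using \<open>C \<ge> 0\<close> by (intro mult_left_mono) auto
    qed
    moreover have "\<bar>B (v - w) (v - w)\<bar> \<le> C * 4"
    proof (rule order_trans[OF C])
      have "(norm (v - w))\<^sup>2 \<le> 2\<^sup>2" using norm_triangle_ineq4[of v w] that by (intro power_mono) auto
      then show "C * (norm (v - w))\<^sup>2 \<le> C * 4" using \<open>C \<ge> 0\<close> by (intro mult_left_mono) auto
    qed
    ultimately show ?thesis by linarith
  qed
  show ?thesis
  proof (cases "v = 0 \<or> w = 0")
    case True
    then show ?thesis using bilinear_scaleR_left[OF B, of 0 0 w] bilinear_scaleR_right[OF B, of v 0 0] by auto
  next
    case False
    then have "\<bar>B (v /\<^sub>R norm v) (w /\<^sub>R norm w)\<bar> \<le> 2 * C" by (intro unit) auto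
    with False show ?thesis
      by (simp add: bilinear_expand[OF B] abs_mult field_simps)
  qed
qed

lemma linear_coefficient_zero:
  assumes "\<And>s. 0 \<le> 2 * s * a + s\<^sup>2 * (b::real)" and "0 \<le> b"
  shows "a = 0"
proof (rule ccontr)
  assume "a \<noteq> 0"
  define s where "s = - a / (b + 1)"
  have a: "a = - s * (b + 1)" using \<open>0 \<le> b\<close> by (simp add: s_def)
  have "0 \<le> 2 * s * a + s\<^sup>2 * b" by (rule assms)
  also have "\<dots> = - (s\<^sup>2 * (b + 2))" unfolding a by (simp add: algebra_simps power2_eq_square)
  finally have "s\<^sup>2 * (b + 2) \<le> 0" by simp
  moreover have "0 < s\<^sup>2 * (b + 2)" using \<open>a \<noteq> 0\<close> \<open>0 \<le> b\<close> a by auto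
  ultimately show False by simp
qed

text \<open>The theorem of Lax and Milgram for symmetric forms, hence also that of Riesz: the
  quadratic functional \<open>J u = B u u - 2 f u\<close> is bounded below, a fast minimizing
  sequence is Cauchy by the parallelogram law, and the first variation of \<open>J\<close> vanishes
  at its limit. The equation for the limit is obtained by passing to the limit in the inequalities
  for the sequence.\<close>

proposition coercive_representation:
  fixes B :: "'v::banach \<Rightarrow> 'v \<Rightarrow> real"
  assumes B: "bilinear B" and sym: "\<And>v w. B v w = B w v"
    and c: "0 < c" "\<And>v. c * (norm v)\<^sup>2 \<le> B v v"
    and C: "\<And>v w. \<bar>B v w\<bar> \<le> C * norm v * norm w"
    and f: "bounded_linear f"
  shows "\<exists>!u. \<forall>z. B u z = f z"
proof -
  define J where "J u = B u u - 2 * f u" for u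
  interpret f: bounded_linear f by fact
  have nonneg: "0 \<le> B v v" for v
    using c(2)[of v] c(1) by (smt (verit) mult_nonneg_nonneg zero_le_power2)
  obtain K where K: "\<And>x. \<bar>f x\<bar> \<le> norm x * K" using f.bounded by auto
  have low: "- (K\<^sup>2 / c) \<le> J u" for u
  proof -
    have "0 \<le> (c * norm u - K)\<^sup>2 / c" using c by simp
    also have "\<dots> = c * (norm u)\<^sup>2 - 2 * (norm u * K) + K\<^sup>2 / c"
      using c by (simp add: power2_eq_square field_simps)
    finally show ?thesis using c(2)[of u] K[of u] unfolding J_def by linarith
  qed
  have bdd: "bdd_below (range J)" using low by (intro bdd_belowI2)
  define m where "m = (INF u. J u)"
  have m: "m \<le> J u" for u unfolding m_def by (rule cINF_lower[OF bdd]) auto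
  define eps where "eps n = c * (1/16) ^ n / 8" for n :: nat
  have eps: "0 < eps n" "eps (Suc n) \<le> eps n" for n using c by (auto simp: eps_def)
  have "\<exists>u. J u < m + eps n" for n
    using cINF_less_iff[OF _ bdd, of "m + eps n"] eps(1)[of n] unfolding m_def by auto
  then obtain u where u: "\<And>n. J (u n) < m + eps n" by metis
  have le: "norm (u (Suc n) - u n) \<le> (1/4) ^ n" for n
  proof (rule power2_le_imp_le)
    have "c * (norm (u (Suc n) - u n))\<^sup>2 \<le> B (u (Suc n) - u n) (u (Suc n) - u n)" by (rule c(2))
    also have "\<dots> = 2 * J (u (Suc n)) + 2 * J (u n) - 4 * J ((1/2) *\<^sub>R (u (Suc n) + u n))"
      unfolding J_def by (simp add: bilinear_expand[OF B] f.add f.scale sym[of "u n" "u (Suc n)"] algebra_simps)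
    also have "\<dots> \<le> 4 * eps n"
      using u[of n] u[of "Suc n"] eps(2)[of n] m[of "(1/2) *\<^sub>R (u (Suc n) + u n)"] by linarith
    also have "\<dots> \<le> c * (1/16) ^ n" using c by (simp add: eps_def)
    finally have "(norm (u (Suc n) - u n))\<^sup>2 \<le> (1/16) ^ n" using c by simp
    also have "\<dots> = ((1/4) ^ n)\<^sup>2" by (simp add: power2_eq_square flip: power_mult_distrib)
    finally show "(norm (u (Suc n) - u n))\<^sup>2 \<le> ((1/4) ^ n)\<^sup>2" .
  qed simp
  have "convergent u" by (rule convergent_geometric_increments[OF le])
  then obtain v where v: "u \<longlonglongrightarrow> v" by (auto simp: convergent_def)
  have "B v z = f z" for z
  proof -
    have "bounded_linear (\<lambda>x. B x z)"
    proof (rule bounded_linear_intro[where K="C * norm z"])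
      show "norm (B x z) \<le> norm x * (C * norm z)" for x using C[of x z] by (simp add: ac_simps)
    qed (simp_all add: bilinear_expand[OF B])
    then have lim: "(\<lambda>n. B (u n) z) \<longlonglongrightarrow> B v z" using v by (rule bounded_linear.tendsto)
    have "0 \<le> 2 * s * (B v z - f z) + s\<^sup>2 * B z z" for s
    proof (rule LIMSEQ_le)
      have "(\<lambda>n. (1/16::real) ^ n) \<longlonglongrightarrow> 0" by (rule LIMSEQ_power_zero) simp
      then have "(\<lambda>n. - (c * (1/16) ^ n / 8)) \<longlonglongrightarrow> - (c * 0 / 8)" by (intro tendsto_intros) auto
      then show "(\<lambda>n. - eps n) \<longlonglongrightarrow> 0" by (simp add: eps_def)
      show "(\<lambda>n. 2 * s * (B (u n) z - f z) + s\<^sup>2 * B z z) \<longlonglongrightarrow> 2 * s * (B v z - f z) + s\<^sup>2 * B z z"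
        by (intro tendsto_intros lim)
      have "J (u n + s *\<^sub>R z) = J (u n) + (2 * s * (B (u n) z - f z) + s\<^sup>2 * B z z)" for n
        unfolding J_def by (simp add: bilinear_expand[OF B] f.add f.scale sym[of z "u n"] algebra_simps power2_eq_square)
      then have "- eps n \<le> 2 * s * (B (u n) z - f z) + s\<^sup>2 * B z z" for n
        using u[of n] m[of "u n + s *\<^sub>R z"] by (smt (verit))
      then show "\<exists>N. \<forall>n\<ge>N. - eps n \<le> 2 * s * (B (u n) z - f z) + s\<^sup>2 * B z z" by blast
    qed
    then have "B v z - f z = 0" using nonneg by (rule linear_coefficient_zero)
    then show ?thesis by simp
  qed
  moreover have "x = v" if "\<And>z. B x z = f z" for x
  proof -
    have "B (x - v) (x - v) = 0" using that calculation by (simp add: bilinear_diff_left[OF B])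
    then have "c * (norm (x - v))\<^sup>2 \<le> 0" using c(2)[of "x - v"] by simp
    then show ?thesis using c(1) by (simp add: mult_le_0_iff)
  qed
  ultimately show ?thesis by blast
qed

section \<open>The Christoffel operator of an admissible metric\<close>

text \<open>What the variational argument needs of the metric; \<open>\<Gamma> p v\<close> stands
  for the Christoffel operator at \<open>p\<close> applied to \<open>(v, v)\<close>. Positions and
  velocities are compared in the weak norm \<open>\<bar>\<iota> v\<bar>\<close> only; this makes the
  terms of lower order continuous along sequences that converge just in \<open>Y\<close>.\<close>

locale spline_metric =
  fixes \<iota> :: "'v::{real_inner, banach, second_countable_topology} \<Rightarrow> 'y::banach"
    and g :: "'v \<Rightarrow> 'v \<Rightarrow> 'v \<Rightarrow> real"
    and \<Gamma> :: "'v \<Rightarrow> 'v \<Rightarrow> 'v"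
    and c C L K :: real
  assumes \<iota>: "bounded_linear \<iota>"
    and bil: "\<And>p. bilinear (g p)"
    and sym: "\<And>p v w. g p v w = g p w v"
    and c_pos: "0 < c" and nonneg: "0 \<le> C" "0 \<le> L" "0 \<le> K"
    and lower: "\<And>p v. c * (norm v)\<^sup>2 \<le> g p v v"
    and upper: "\<And>p v w. \<bar>g p v w\<bar> \<le> C * norm v * norm w"
    and lipschitz: "\<And>p q v w. \<bar>g p v w - g q v w\<bar> \<le> L * norm (\<iota> p - \<iota> q) * norm v * norm w"
    and \<Gamma>_bound: "\<And>p v. norm (\<Gamma> p v) \<le> K * (norm v)\<^sup>2"
    and \<Gamma>_lipschitz: "\<And>p q v w. norm (\<Gamma> p v - \<Gamma> q w) \<le>
      K * (norm (\<iota> p - \<iota> q) * ((norm v)\<^sup>2 + (norm w)\<^sup>2) + norm (\<iota> v - \<iota> w) * (norm v + norm w))"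

lemma coercive_norm_le:
  fixes B :: "'v::real_normed_vector \<Rightarrow> 'v \<Rightarrow> real"
  assumes "0 < c" "c * (norm u)\<^sup>2 \<le> B u u" "B u u \<le> M * norm u" "0 \<le> M"
  shows "norm u \<le> M / c"
proof (cases "u = 0")
  case False
  have "c * norm u * norm u \<le> M * norm u" using assms by (simp add: power2_eq_square)
  then have "c * norm u \<le> M" using False by simp
  then show ?thesis using assms(1) by (simp add: field_simps)
qed (use assms in simp)

text \<open>The mean value theorem turns the bounds on the two derivatives of
  \<open>g\<^sup>c\<close> into Lipschitz bounds for the metric and for its first derivative
  \<open>T\<close>. The upper bound for \<open>g\<close> comes from its diagonal by polarization.
  Testing the equations of \<open>\<Gamma> p v\<close>, and of the difference of two such vectors,
  with these vectors themselves gives the bounds for \<open>\<Gamma>\<close> by ellipticity.\<close>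

proposition admissible_metric_imp_spline_metric:
  fixes \<iota> :: "'v::{real_inner, banach, second_countable_topology} \<Rightarrow> 'y::banach"
  assumes emb: "compact_embedding \<iota>" and adm: "admissible_metric \<iota> g"
  obtains c C L K where "spline_metric \<iota> g (\<lambda>p v. christoffel g p v v) c C L K"
proof -
  have \<iota>: "bounded_linear \<iota>" using emb by (simp add: compact_embedding_def compact_operator_def)
  interpret \<iota>: bounded_linear \<iota> by fact
  obtain N where N: "0 < N" "\<And>v. norm (\<iota> v) \<le> norm v * N" using \<iota>.pos_bounded by blast
  from adm obtain gc :: "'y \<Rightarrow> ('y \<Rightarrow>\<^sub>L 'y \<Rightarrow>\<^sub>L real)" and Q and C1 C2 c
    and D1 :: "'y \<Rightarrow> ('y \<Rightarrow>\<^sub>L ('y \<Rightarrow>\<^sub>L 'y \<Rightarrow>\<^sub>L real))" and D2 :: "'y \<Rightarrow> ('y \<Rightarrow>\<^sub>L ('y \<Rightarrow>\<^sub>L ('y \<Rightarrow>\<^sub>L 'y \<Rightarrow>\<^sub>L real)))"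
    where g: "\<And>y v w. g y v w = gc (\<iota> y) (\<iota> v) (\<iota> w) + Q v w"
      and gsym: "\<And>p v w. gc p (\<iota> v) (\<iota> w) = gc p (\<iota> w) (\<iota> v)"
      and C1: "\<And>p v. gc p (\<iota> v) (\<iota> v) \<le> C1 * (norm (\<iota> v))\<^sup>2"
      and D1: "\<And>p. (gc has_derivative blinfun_apply (D1 p)) (at p)"
      and D2: "\<And>p. (D1 has_derivative blinfun_apply (D2 p)) (at p)"
      and bd: "bounded (range D1)" "bounded (range D2)"
      and Q: "bilinear Q" "\<And>v w. Q v w = Q w v"
      and C2: "\<And>v. Q v v \<le> C2 * (norm v)\<^sup>2"
      and c: "0 < c" "\<And>p v. c * (norm v)\<^sup>2 \<le> gc p (\<iota> v) (\<iota> v) + Q v v"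
    unfolding admissible_metric_def by metis
  from bd obtain K1 K2 where K1: "\<And>p. norm (D1 p) \<le> K1" and K2: "\<And>p. norm (D2 p) \<le> K2"
    unfolding bounded_iff by auto
  have K0: "0 \<le> K1" "0 \<le> K2" using K1[of 0] K2[of 0] norm_ge_zero order_trans by blast+
  have gc_lip: "norm (gc p - gc q) \<le> K1 * norm (p - q)" for p q
    by (rule differentiable_bound[of UNIV gc "\<lambda>p. blinfun_apply (D1 p)"])
      (use D1 K1 in \<open>auto simp flip: norm_blinfun.rep_eq\<close>)
  have D1_lip: "norm (D1 p - D1 q) \<le> K2 * norm (p - q)" for p q
    by (rule differentiable_bound[of UNIV D1 "\<lambda>p. blinfun_apply (D2 p)"])
      (use D2 K2 in \<open>auto simp flip: norm_blinfun.rep_eq\<close>)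
  have bil2: "\<bar>A a b\<bar> \<le> norm A * norm a * norm b" for A :: "'y \<Rightarrow>\<^sub>L 'y \<Rightarrow>\<^sub>L real" and a b
  proof -
    have "\<bar>A a b\<bar> \<le> norm (A a) * norm b" using norm_blinfun[of "A a" b] by simp
    also have "\<dots> \<le> norm A * norm a * norm b" by (intro mult_right_mono norm_blinfun) auto
    finally show ?thesis .
  qed
  have tri: "\<bar>A a b d\<bar> \<le> norm A * norm a * norm b * norm d" for A :: "'y \<Rightarrow>\<^sub>L 'y \<Rightarrow>\<^sub>L 'y \<Rightarrow>\<^sub>L real" and a b d
  proof -
    have "\<bar>A a b d\<bar> \<le> norm (A a) * norm b * norm d" by (rule bil2)
    also have "\<dots> \<le> norm A * norm a * norm b * norm d" by (intro mult_right_mono norm_blinfun) auto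
    finally show ?thesis .
  qed
  have gbil: "bilinear (g p)" for p
  proof -
    have "bilinear (\<lambda>v w. gc (\<iota> p) (\<iota> v) (\<iota> w) + Q v w)"
      unfolding bilinear_def linear_iff
      by (simp add: \<iota>.add \<iota>.scaleR blinfun.add_left blinfun.add_right blinfun.scaleR_left blinfun.scaleR_right
          bilinear_expand[OF Q(1)] algebra_simps)
    moreover have "g p = (\<lambda>v w. gc (\<iota> p) (\<iota> v) (\<iota> w) + Q v w)" by (intro ext g)
    ultimately show ?thesis by simp
  qed
  have g_sym: "g p v w = g p w v" for p v w using gsym Q(2) by (simp add: g)
  have low: "c * (norm v)\<^sup>2 \<le> g p v v" for p v using c(2) by (simp add: g)
  define C where "C = \<bar>C1\<bar> * N\<^sup>2 + \<bar>C2\<bar>"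
  have diag: "\<bar>g p v v\<bar> \<le> C * (norm v)\<^sup>2" for p v
  proof -
    have "0 \<le> g p v v" using low[of v p] c(1) by (smt (verit) mult_nonneg_nonneg zero_le_power2)
    moreover have "gc (\<iota> p) (\<iota> v) (\<iota> v) \<le> \<bar>C1\<bar> * (norm v * N)\<^sup>2"
    proof (rule order_trans[OF C1])
      have "(norm (\<iota> v))\<^sup>2 \<le> (norm v * N)\<^sup>2" using N by (intro power_mono) auto
      then have "\<bar>C1\<bar> * (norm (\<iota> v))\<^sup>2 \<le> \<bar>C1\<bar> * (norm v * N)\<^sup>2" by (intro mult_left_mono) auto
      moreover have "C1 * (norm (\<iota> v))\<^sup>2 \<le> \<bar>C1\<bar> * (norm (\<iota> v))\<^sup>2" by (intro mult_right_mono) auto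
      ultimately show "C1 * (norm (\<iota> v))\<^sup>2 \<le> \<bar>C1\<bar> * (norm v * N)\<^sup>2" by linarith
    qed
    moreover have "Q v v \<le> \<bar>C2\<bar> * (norm v)\<^sup>2"
      by (rule order_trans[OF C2]) (intro mult_right_mono, auto)
    ultimately show ?thesis by (simp add: g C_def power_mult_distrib algebra_simps)
  qed
  have up: "\<bar>g p v w\<bar> \<le> 2 * C * norm v * norm w" for p v w
    by (rule bilinear_bound_from_diagonal[OF gbil g_sym diag])
  define L where "L = K1 * N\<^sup>2"
  have lip: "\<bar>g p v w - g q v w\<bar> \<le> L * norm (\<iota> p - \<iota> q) * norm v * norm w" for p q v w
  proof -
    have "\<bar>g p v w - g q v w\<bar> = \<bar>(gc (\<iota> p) - gc (\<iota> q)) (\<iota> v) (\<iota> w)\<bar>"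
      by (simp add: g blinfun.diff_left)
    also have "\<dots> \<le> norm (gc (\<iota> p) - gc (\<iota> q)) * norm (\<iota> v) * norm (\<iota> w)" by (rule bil2)
    also have "\<dots> \<le> (K1 * norm (\<iota> p - \<iota> q)) * (norm v * N) * (norm w * N)"
      using N K0 by (intro mult_mono gc_lip) auto
    finally show ?thesis by (simp add: L_def power2_eq_square ac_simps)
  qed
  define T where "T p u v w = D1 (\<iota> p) (\<iota> u) (\<iota> v) (\<iota> w)" for p u v w
  have deriv: "metric_deriv g y u v w = T y u v w" for y u v w
  proof -
    have 1: "((\<lambda>p. gc (\<iota> p)) has_derivative (\<lambda>h. D1 (\<iota> y) (\<iota> h))) (at y)"
      by (rule has_derivative_compose[OF bounded_linear.has_derivative[OF \<iota> has_derivative_ident] D1])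
    have "bounded_linear (\<lambda>A :: 'y \<Rightarrow>\<^sub>L 'y \<Rightarrow>\<^sub>L real. A (\<iota> v) (\<iota> w))"
      by (intro bounded_linear_compose[OF blinfun.bounded_linear_left blinfun.bounded_linear_left])
    from has_derivative_add[OF bounded_linear.has_derivative[OF this 1] has_derivative_const[of "Q v w"]]
    have "((\<lambda>p. g p v w) has_derivative (\<lambda>h. T y h v w)) (at y)"
      by (simp add: g T_def)
    then have "(\<lambda>h. T y h v w) = frechet_derivative (\<lambda>p. g p v w) (at y)"
      by (rule frechet_derivative_at)
    then show ?thesis by (simp add: metric_deriv_def fun_eq_iff)
  qed
  have T_bound: "\<bar>T p u v w\<bar> \<le> K1 * norm (\<iota> u) * norm (\<iota> v) * norm (\<iota> w)" for p u v w
    unfolding T_def by (rule order_trans[OF tri]) (intro mult_right_mono K1, auto)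
  have T_lip: "\<bar>T p u v w - T q u v w\<bar> \<le> K2 * norm (\<iota> p - \<iota> q) * norm (\<iota> u) * norm (\<iota> v) * norm (\<iota> w)" for p q u v w
  proof -
    have "\<bar>T p u v w - T q u v w\<bar> = \<bar>(D1 (\<iota> p) - D1 (\<iota> q)) (\<iota> u) (\<iota> v) (\<iota> w)\<bar>"
      by (simp add: T_def blinfun.diff_left)
    also have "\<dots> \<le> norm (D1 (\<iota> p) - D1 (\<iota> q)) * norm (\<iota> u) * norm (\<iota> v) * norm (\<iota> w)" by (rule tri)
    also have "\<dots> \<le> (K2 * norm (\<iota> p - \<iota> q)) * norm (\<iota> u) * norm (\<iota> v) * norm (\<iota> w)"
      by (intro mult_right_mono D1_lip) auto
    finally show ?thesis .
  qed
  define l where "l p v z = (T p v v z - T p z v v + T p v v z) / 2" for p v z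
  have l_bl: "bounded_linear (l p v)" for p v
    unfolding l_def T_def
    by (intro bounded_linear_divide[THEN bounded_linear_compose] bounded_linear_add bounded_linear_sub
        bounded_linear_compose[OF blinfun.bounded_linear_right \<iota>]
        bounded_linear_compose[OF blinfun.bounded_linear_left bounded_linear_compose[OF blinfun.bounded_linear_left
          bounded_linear_compose[OF blinfun.bounded_linear_right \<iota>]]])
  define G where "G p v = christoffel g p v v" for p v
  have G: "g p (G p v) z = l p v z" for p v z
  proof -
    have "\<exists>!u. \<forall>z. g p u z = l p v z"
      by (rule coercive_representation[OF gbil g_sym c(1) low up l_bl])
    moreover have "g p u z = l p v z \<longleftrightarrow>
        2 * g p u z = metric_deriv g p v v z - metric_deriv g p z v v + metric_deriv g p v v z" for u z
      by (auto simp: deriv l_def field_simps)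
    ultimately have "\<exists>!u. \<forall>z. 2 * g p u z =
        metric_deriv g p v v z - metric_deriv g p z v v + metric_deriv g p v v z"
      by (simp only:)
    from theI'[OF this]
    have "2 * g p (G p v) z = metric_deriv g p v v z - metric_deriv g p z v v + metric_deriv g p v v z"
      unfolding G_def christoffel_def by blast
    then show ?thesis unfolding l_def deriv by (metis nonzero_mult_div_cancel_left zero_neq_numeral)
  qed
  define M where "M = 3/2 * K1 * N ^ 3"
  have M0: "0 \<le> M" using K0 N by (simp add: M_def)
  have l_bound: "\<bar>l p v z\<bar> \<le> M * (norm v)\<^sup>2 * norm z" for p v z
  proof -
    have 1: "norm (\<iota> v) * norm (\<iota> v) * norm (\<iota> z) \<le> (norm v * N) * (norm v * N) * (norm z * N)"
      using N by (intro mult_mono) auto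
    have "\<bar>l p v z\<bar> \<le> 3/2 * K1 * (norm (\<iota> v) * norm (\<iota> v) * norm (\<iota> z))"
      using T_bound[of p v v z] T_bound[of p z v v] unfolding l_def by (simp add: ac_simps abs_le_iff)
    also have "\<dots> \<le> 3/2 * K1 * ((norm v * N) * (norm v * N) * (norm z * N))"
      using 1 K0 by (intro mult_left_mono) auto
    finally show ?thesis by (simp add: M_def power2_eq_square power3_eq_cube ac_simps)
  qed
  have G_bound: "norm (G p v) \<le> M / c * (norm v)\<^sup>2" for p v
  proof -
    have "norm (G p v) \<le> (M * (norm v)\<^sup>2) / c"
    proof (rule coercive_norm_le[where B="g p", OF c(1) low])
      show "g p (G p v) (G p v) \<le> M * (norm v)\<^sup>2 * norm (G p v)"
        using l_bound[of p v "G p v"] unfolding G by linarith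
    qed (use M0 in simp)
    then show ?thesis by simp
  qed
  define K where "K = (3/2 * K2 * N ^ 3 + 3/2 * K1 * N\<^sup>2 + L * (M / c) + M) / c"
  have L0: "0 \<le> L" using K0 by (simp add: L_def)
  have G_lip: "norm (G p v - G q w) \<le>
      K * (norm (\<iota> p - \<iota> q) * ((norm v)\<^sup>2 + (norm w)\<^sup>2) + norm (\<iota> v - \<iota> w) * (norm v + norm w))" for p q v w
  proof -
    define a b where "a = norm (\<iota> p - \<iota> q)" and "b = norm (\<iota> v - \<iota> w)"
    have ab: "0 \<le> a" "0 \<le> b" by (auto simp: a_def b_def)
    define V W where "V = norm v" and "W = norm w"
    have VW: "0 \<le> V" "0 \<le> W" "norm (\<iota> v) \<le> V * N" "norm (\<iota> w) \<le> W * N" using N by (auto simp: V_def W_def)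
    let ?X = "\<lambda>z. (K2 * a * (V * N)\<^sup>2 + K1 * b * (V * N + W * N)) * (norm z * N)"
    have X1: "\<bar>T p v v z - T q w w z\<bar> \<le> ?X z" for z
    proof -
      have "T p v v z - T q w w z = (T p v v z - T q v v z) + T q (v - w) v z + T q w (v - w) z"
        by (simp add: T_def \<iota>.diff blinfun.diff_left blinfun.diff_right)
      moreover have "\<bar>T p v v z - T q v v z\<bar> \<le> K2 * a * (V * N) * (V * N) * (norm z * N)"
        by (rule order_trans[OF T_lip], unfold a_def[symmetric])
          (use VW N K0 ab in \<open>intro mult_mono, auto intro!: mult_nonneg_nonneg\<close>)
      moreover have "\<bar>T q (v - w) v z\<bar> \<le> K1 * b * (V * N) * (norm z * N)"
        by (rule order_trans[OF T_bound], unfold \<iota>.diff b_def[symmetric])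
          (use VW N K0 ab in \<open>intro mult_mono, auto intro!: mult_nonneg_nonneg\<close>)
      moreover have "\<bar>T q w (v - w) z\<bar> \<le> K1 * (W * N) * b * (norm z * N)"
        by (rule order_trans[OF T_bound], unfold \<iota>.diff b_def[symmetric])
          (use VW N K0 ab in \<open>intro mult_mono, auto intro!: mult_nonneg_nonneg\<close>)
      moreover have "?X z = K2 * a * (V * N) * (V * N) * (norm z * N) + K1 * b * (V * N) * (norm z * N)
          + K1 * (W * N) * b * (norm z * N)"
        by (simp add: power2_eq_square algebra_simps)
      ultimately show ?thesis by linarith
    qed
    have X2: "\<bar>T p z v v - T q z w w\<bar> \<le> ?X z" for z
    proof -
      have "T p z v v - T q z w w = (T p z v v - T q z v v) + T q z (v - w) v + T q z w (v - w)"
        by (simp add: T_def \<iota>.diff blinfun.diff_left blinfun.diff_right)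
      moreover have "\<bar>T p z v v - T q z v v\<bar> \<le> K2 * a * (norm z * N) * (V * N) * (V * N)"
        by (rule order_trans[OF T_lip], unfold a_def[symmetric])
          (use VW N K0 ab in \<open>intro mult_mono, auto intro!: mult_nonneg_nonneg\<close>)
      moreover have "\<bar>T q z (v - w) v\<bar> \<le> K1 * (norm z * N) * b * (V * N)"
        by (rule order_trans[OF T_bound], unfold \<iota>.diff b_def[symmetric])
          (use VW N K0 ab in \<open>intro mult_mono, auto intro!: mult_nonneg_nonneg\<close>)
      moreover have "\<bar>T q z w (v - w)\<bar> \<le> K1 * (norm z * N) * (W * N) * b"
        by (rule order_trans[OF T_bound], unfold \<iota>.diff b_def[symmetric])
          (use VW N K0 ab in \<open>intro mult_mono, auto intro!: mult_nonneg_nonneg\<close>)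
      moreover have "?X z = K2 * a * (norm z * N) * (V * N) * (V * N) + K1 * (norm z * N) * b * (V * N)
          + K1 * (norm z * N) * (W * N) * b"
        by (simp add: power2_eq_square algebra_simps)
      ultimately show ?thesis by linarith
    qed
    have l_diff: "\<bar>l p v z - l q w z\<bar> \<le> 3/2 * ?X z" for z
      using X1[of z] X2[of z] unfolding l_def by (simp add: abs_le_iff field_simps)
    let ?D = "G p v - G q w"
    have "norm ?D \<le> (3/2 * (K2 * a * (V * N)\<^sup>2 + K1 * b * (V * N + W * N)) * N + L * a * (M / c * W\<^sup>2)) / c"
    proof (rule coercive_norm_le[where B="g p", OF c(1) low])
      have "g p ?D ?D = (l p v ?D - l q w ?D) + (g q (G q w) ?D - g p (G q w) ?D)"
        using G by (simp add: bilinear_diff_left[OF gbil])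
      also have "\<dots> \<le> 3/2 * ?X ?D + L * a * norm (G q w) * norm ?D"
      proof -
        have "\<bar>g q (G q w) ?D - g p (G q w) ?D\<bar> \<le> L * a * norm (G q w) * norm ?D"
          using lip[of q "G q w" ?D p] by (simp add: a_def norm_minus_commute)
        then show ?thesis using l_diff[of ?D] by linarith
      qed
      also have "L * a * norm (G q w) * norm ?D \<le> L * a * (M / c * W\<^sup>2) * norm ?D"
        using G_bound[of q w] L0 ab by (intro mult_right_mono mult_left_mono) (auto simp: W_def)
      finally show "g p ?D ?D \<le> (3/2 * (K2 * a * (V * N)\<^sup>2 + K1 * b * (V * N + W * N)) * N + L * a * (M / c * W\<^sup>2)) * norm ?D"
        by (simp add: algebra_simps)
      show "0 \<le> 3/2 * (K2 * a * (V * N)\<^sup>2 + K1 * b * (V * N + W * N)) * N + L * a * (M / c * W\<^sup>2)"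
        using K0 ab VW N L0 M0 c(1) by (intro add_nonneg_nonneg mult_nonneg_nonneg) auto
    qed
    also have "\<dots> \<le> K * (a * (V\<^sup>2 + W\<^sup>2) + b * (V + W))"
    proof -
      define k1 k2 k3 where "k1 = 3/2 * K2 * N ^ 3" and "k2 = 3/2 * K1 * N\<^sup>2" and "k3 = L * (M / c)"
      have k: "0 \<le> k1" "0 \<le> k2" "0 \<le> k3" using K0 N L0 M0 c(1) by (auto simp: k1_def k2_def k3_def)
      have "3/2 * (K2 * a * (V * N)\<^sup>2 + K1 * b * (V * N + W * N)) * N + L * a * (M / c * W\<^sup>2)
          = k1 * (a * V\<^sup>2) + k2 * (b * (V + W)) + k3 * (a * W\<^sup>2)"
        by (simp add: k1_def k2_def k3_def power2_eq_square power3_eq_cube field_simps)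
      also have "\<dots> \<le> (k1 + k2 + k3 + M) * (a * (V\<^sup>2 + W\<^sup>2) + b * (V + W))"
      proof -
        have "0 \<le> a * V\<^sup>2" "0 \<le> a * W\<^sup>2" "0 \<le> b * (V + W)" using ab VW by auto
        moreover have "(k1 + k2 + k3 + M) * (a * (V\<^sup>2 + W\<^sup>2) + b * (V + W)) =
           k1 * (a * V\<^sup>2) + k2 * (b * (V + W)) + k3 * (a * W\<^sup>2) +
           (k1 * (a * W\<^sup>2) + k1 * (b * (V + W)) + k2 * (a * V\<^sup>2) + k2 * (a * W\<^sup>2) + k3 * (a * V\<^sup>2)
             + k3 * (b * (V + W)) + M * (a * V\<^sup>2) + M * (a * W\<^sup>2) + M * (b * (V + W)))"
          by (simp add: algebra_simps)
        ultimately show ?thesis using k M0 by (simp add: add_nonneg_nonneg mult_nonneg_nonneg)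
      qed
      finally show ?thesis using c(1) unfolding K_def k1_def[symmetric] k2_def[symmetric] k3_def[symmetric]
        by (simp add: divide_right_mono)
    qed
    finally show ?thesis unfolding a_def b_def V_def W_def .
  qed
  have K_ge: "M / c \<le> K" "0 \<le> K"
    using K0 N L0 M0 c(1) by (auto simp: K_def intro!: divide_right_mono add_nonneg_nonneg mult_nonneg_nonneg divide_nonneg_pos)
  have "spline_metric \<iota> g G c (2 * C) L K"
  proof
    show "norm (G p v) \<le> K * (norm v)\<^sup>2" for p v
      by (rule order_trans[OF G_bound mult_right_mono[OF K_ge(1)]]) simp
    show "0 \<le> 2 * C" by (simp add: C_def)
  qed (rule \<iota> gbil g_sym c(1) L0 K_ge(2) low up lip G_lip)+
  then have "spline_metric \<iota> g (\<lambda>p v. christoffel g p v v) c (2 * C) L K"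
    by (simp add: G_def[abs_def])
  then show ?thesis by (rule that)
qed

section \<open>Hermite interpolation\<close>

text \<open>A new node \<open>s\<close> is handled by adding \<open>P\<^sup>2\<close> times a linear
  polynomial, where \<open>P\<close> vanishes at the old nodes; the square keeps values and
  derivatives there.\<close>

lemma Hermite_interpolation_polynomial:
  fixes f d :: "real \<Rightarrow> real"
  assumes "finite N"
  shows "\<exists>p. \<forall>n\<in>N. poly p n = f n \<and> poly (pderiv p) n = d n"
  using assms
proof (induction N)
  case (insert s N)
  then obtain p where p: "\<And>n. n \<in> N \<Longrightarrow> poly p n = f n \<and> poly (pderiv p) n = d n" by blast
  define P where "P = (\<Prod>n\<in>N. [:- n, 1:])"
  have P0: "poly P n = 0" if "n \<in> N" for n
    unfolding P_def poly_prod using that insert(1) by (intro prod_zero) auto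
  have Ps: "poly P s \<noteq> 0"
    unfolding P_def poly_prod using insert(1,2) by auto
  define \<alpha> where "\<alpha> = (f s - poly p s) / (poly P s)\<^sup>2"
  define \<beta> where "\<beta> = (d s - poly (pderiv p) s - 2 * poly P s * poly (pderiv P) s * \<alpha>) / (poly P s)\<^sup>2"
  define r where "r = p + P * P * [:\<alpha> - s * \<beta>, \<beta>:]"
  have r: "poly r x = poly p x + (poly P x)\<^sup>2 * (\<alpha> + (x - s) * \<beta>)" for x
    by (simp add: r_def power2_eq_square algebra_simps)
  have r': "poly (pderiv r) x = poly (pderiv p) x + 2 * poly P x * poly (pderiv P) x * (\<alpha> + (x - s) * \<beta>) + (poly P x)\<^sup>2 * \<beta>" for x
    by (simp add: r_def pderiv_add pderiv_mult pderiv_pCons pderiv_smult power2_eq_square algebra_simps)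
  have "poly r n = f n \<and> poly (pderiv r) n = d n" if "n \<in> insert s N" for n
  proof (cases "n = s")
    case True
    have "(poly P s)\<^sup>2 * \<alpha> = f s - poly p s" using Ps by (simp add: \<alpha>_def)
    moreover have "(poly P s)\<^sup>2 * \<beta> = d s - poly (pderiv p) s - 2 * poly P s * poly (pderiv P) s * \<alpha>"
      using Ps by (simp add: \<beta>_def)
    ultimately show ?thesis unfolding True r r' by simp
  next
    case False
    with that have "n \<in> N" by simp
    then show ?thesis using p P0 unfolding r r' by simp
  qed
  then show ?case by blast
qed simp

lemma cardinal_Hermite_polynomials:
  assumes "finite N"
  obtains \<zeta> \<xi> :: "real \<Rightarrow> real poly" where
    "\<And>k n. n \<in> N \<Longrightarrow> poly (\<zeta> k) n = (if n = k then 1 else 0)"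
    "\<And>k n. n \<in> N \<Longrightarrow> poly (pderiv (\<zeta> k)) n = 0"
    "\<And>k n. n \<in> N \<Longrightarrow> poly (\<xi> k) n = 0"
    "\<And>k n. n \<in> N \<Longrightarrow> poly (pderiv (\<xi> k)) n = (if n = k then 1 else 0)"
proof -
  note H = Hermite_interpolation_polynomial[OF assms]
  have "\<forall>k. \<exists>p. \<forall>n\<in>N. poly p n = (if n = k then 1 else 0) \<and> poly (pderiv p) n = 0"
    by (rule allI) (rule H)
  from choice[OF this] obtain \<zeta> where
    \<zeta>: "\<forall>k. \<forall>n\<in>N. poly (\<zeta> k) n = (if n = k then 1 else 0) \<and> poly (pderiv (\<zeta> k)) n = 0" ..
  have "\<forall>k. \<exists>p. \<forall>n\<in>N. poly p n = 0 \<and> poly (pderiv p) n = (if n = k then 1 else 0)"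
    by (rule allI) (rule H)
  from choice[OF this] obtain \<xi> where
    \<xi>: "\<forall>k. \<forall>n\<in>N. poly (\<xi> k) n = 0 \<and> poly (pderiv (\<xi> k)) n = (if n = k then 1 else 0)" ..
  show ?thesis by (rule that[of \<zeta> \<xi>]) (use \<zeta> \<xi> in auto)
qed

lemma C2_eq_primitive_curve:
  fixes y :: "real \<Rightarrow> 'v::{banach, second_countable_topology}"
  assumes y1: "\<And>t. (y has_vector_derivative y1 t) (at t)"
    and y2: "\<And>t. (y1 has_vector_derivative y2 t) (at t)" and cont: "continuous_on {0..1} y2"
  shows "t \<in> {0..1} \<Longrightarrow> y t = primitive_curve (y 0) (y1 0) y2 t"
    and "t \<in> {0..1} \<Longrightarrow> y1 t = primitive_velocity (y1 0) y2 t"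
    and "square_integrable y2"
proof -
  have c: "continuous_on {0..1} y" "continuous_on {0..1} y1"
    by (rule continuous_at_imp_continuous_on, rule ballI, rule has_vector_derivative_continuous, rule y1 y2)+
  show v: "y1 t = primitive_velocity (y1 0) y2 t" if "t \<in> {0..1}" for t
    unfolding primitive_velocity_def by (rule primitive_of_derivative[OF y2 c(2) cont that])
  show "y t = primitive_curve (y 0) (y1 0) y2 t" if "t \<in> {0..1}" for t
  proof -
    have "y t = y 0 + primitive y1 t"
      by (rule primitive_of_derivative[OF y1 c(1) c(2) that])
    also have "primitive y1 t = primitive (primitive_velocity (y1 0) y2) t"
      by (rule primitive_cong, rule v) auto
    finally show ?thesis by (simp add: primitive_curve_def)
  qed
  show "square_integrable y2" by (rule continuous_square_integrable[OF cont])
qed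

lemma poly_has_vector_derivative:
  "((\<lambda>t. poly p t *\<^sub>R x) has_vector_derivative poly (pderiv p) t *\<^sub>R x) (at t)"
  using has_vector_derivative_scaleR[OF poly_DERIV has_vector_derivative_const] by simp

text \<open>This provides competitors for every boundary condition, so the class of admissible
  curves is not empty.\<close>

proposition Hermite_interpolation_curve:
  fixes f d :: "real \<Rightarrow> 'v::{banach, second_countable_topology}"
  assumes "finite N" "N \<subseteq> {0..1}"
  obtains a b w where "square_integrable w"
    "\<And>n. n \<in> N \<Longrightarrow> primitive_curve a b w n = f n"
    "\<And>n. n \<in> N \<Longrightarrow> primitive_velocity b w n = d n"
proof -
  obtain \<zeta> \<xi> :: "real \<Rightarrow> real poly" where
    \<zeta>: "\<And>k n. n \<in> N \<Longrightarrow> poly (\<zeta> k) n = (if n = k then 1 else 0)" "\<And>k n. n \<in> N \<Longrightarrow> poly (pderiv (\<zeta> k)) n = 0"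
    and \<xi>: "\<And>k n. n \<in> N \<Longrightarrow> poly (\<xi> k) n = 0" "\<And>k n. n \<in> N \<Longrightarrow> poly (pderiv (\<xi> k)) n = (if n = k then 1 else 0)"
    by (rule cardinal_Hermite_polynomials[OF assms(1)]) blast
  define y where "y t = (\<Sum>k\<in>N. poly (\<zeta> k) t *\<^sub>R f k + poly (\<xi> k) t *\<^sub>R d k)" for t
  define y1 where "y1 t = (\<Sum>k\<in>N. poly (pderiv (\<zeta> k)) t *\<^sub>R f k + poly (pderiv (\<xi> k)) t *\<^sub>R d k)" for t
  define y2 where "y2 t = (\<Sum>k\<in>N. poly (pderiv (pderiv (\<zeta> k))) t *\<^sub>R f k + poly (pderiv (pderiv (\<xi> k))) t *\<^sub>R d k)" for t
  have d1: "(y has_vector_derivative y1 t) (at t)" for t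
    unfolding y_def[abs_def] y1_def
    by (intro has_vector_derivative_sum has_vector_derivative_add poly_has_vector_derivative)
  have d2: "(y1 has_vector_derivative y2 t) (at t)" for t
    unfolding y1_def[abs_def] y2_def
    by (intro has_vector_derivative_sum has_vector_derivative_add poly_has_vector_derivative)
  have c: "continuous_on {0..1} y2" unfolding y2_def[abs_def] by (intro continuous_intros)
  note C2 = C2_eq_primitive_curve[OF d1 d2 c]
  have delta: "(if n = k then 1 else 0) *\<^sub>R x = (if k = n then x else 0)" for n k :: real and x :: 'v
    by simp
  show ?thesis
  proof (rule that[of y2 "y 0" "y1 0"])
    show "square_integrable y2" by (rule C2(3))
    fix n assume n: "n \<in> N"
    then have n01: "n \<in> {0..1}" using assms(2) by auto
    have "y n = f n" unfolding y_def using n assms(1) by (simp add: \<zeta> \<xi> delta)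
    then show "primitive_curve (y 0) (y1 0) y2 n = f n" using C2(1)[OF n01] by simp
    have "y1 n = d n" unfolding y1_def using n assms(1) by (simp add: \<zeta> \<xi> delta)
    then show "primitive_velocity (y1 0) y2 n = d n" using C2(2)[OF n01] by simp
  qed
qed

section \<open>Compactness of equicontinuous curves\<close>

lemma convergent_subsequence_on_finite_set:
  fixes Y :: "nat \<Rightarrow> 'a \<Rightarrow> 'z::metric_space"
  assumes "finite F" "compact K" "\<And>k t. t \<in> F \<Longrightarrow> Y k t \<in> K"
  shows "\<exists>r::nat \<Rightarrow> nat. strict_mono r \<and> (\<forall>t\<in>F. convergent (\<lambda>k. Y (r k) t))"
  using assms(1,3)
proof (induction F)
  case empty
  then show ?case by (intro exI[of _ id]) (auto simp: strict_mono_def)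
next
  case (insert x F)
  then obtain r :: "nat \<Rightarrow> nat" where r: "strict_mono r" "\<And>t. t \<in> F \<Longrightarrow> convergent (\<lambda>k. Y (r k) t)" by blast
  have "\<forall>k. Y (r k) x \<in> K" using insert(4) by auto
  with assms(2) obtain l and s :: "nat \<Rightarrow> nat" where s: "strict_mono s" "((\<lambda>k. Y (r k) x) \<circ> s) \<longlonglongrightarrow> l"
    unfolding compact_eq_seq_compact_metric by (rule seq_compactE)
  have "convergent (\<lambda>k. Y ((r \<circ> s) k) t)" if "t \<in> insert x F" for t
  proof (cases "t = x")
    case True
    then show ?thesis using s(2) by (auto simp: convergent_def o_def)
  next
    case False
    with that have "convergent (\<lambda>k. Y (r k) t)" using r(2) by auto
    from convergent_subseq_convergent[OF this s(1)] show ?thesis by (simp add: o_def)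
  qed
  moreover have "strict_mono (r \<circ> s)" using r(1) s(1) by (rule strict_mono_o)
  ultimately show ?case by blast
qed

text \<open>The theorem of Arzela and Ascoli, without a limit curve. For each accuracy a finite grid
  suffices by equicontinuity, and on a finite grid compactness of \<open>K\<close> gives a
  convergent subsequence; a diagonal sequence serves all accuracies.\<close>

proposition uniformly_Cauchy_subsequence:
  fixes X :: "nat \<Rightarrow> real \<Rightarrow> 'z::metric_space"
  assumes K: "compact K" "\<And>k t. t \<in> {0..1} \<Longrightarrow> X k t \<in> K"
    and H: "\<And>k s t. s \<in> {0..1} \<Longrightarrow> t \<in> {0..1} \<Longrightarrow> dist (X k s) (X k t) \<le> H * sqrt \<bar>s - t\<bar>"
  obtains r :: "nat \<Rightarrow> nat" where "strict_mono r"
    "\<And>j k t. j \<le> k \<Longrightarrow> t \<in> {0..1} \<Longrightarrow> dist (X (r k) t) (X (r j) t) \<le> 1 / real (Suc j)"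
proof -
  have "\<exists>r::nat \<Rightarrow> nat. strict_mono r \<and>
      (\<forall>j k. \<forall>t\<in>{0..1}. dist (X ((s \<circ> r) k) t) (X ((s \<circ> r) j) t) \<le> 1 / real (Suc n))"
    for n and s :: "nat \<Rightarrow> nat"
  proof -
    define e where "e = 1 / real (Suc n)"
    have e: "0 < e" by (simp add: e_def)
    have "0 \<le> H" using order_trans[OF zero_le_dist H[of 0 1 0]] by simp
    obtain m :: nat where m: "(4 * H / e)\<^sup>2 < real m" using reals_Archimedean2 by blast
    then have m0: "0 < real m" by (smt (verit) zero_le_power2)
    have mH: "H * sqrt (1 / real m) \<le> e / 4"
    proof -
      have "4 * H / e \<le> sqrt (real m)" using m by (intro real_le_rsqrt) simp
      then have "4 * H \<le> e * sqrt (real m)" using e by (simp add: field_simps)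
      then show ?thesis using m0 by (simp add: real_sqrt_divide field_simps)
    qed
    define F where "F = (\<lambda>i. real i / real m) ` {..m}"
    have F01: "F \<subseteq> {0..1}" using m0 by (auto simp: F_def field_simps)
    have finF: "finite F" by (simp add: F_def)
    have inK: "X (s k) t \<in> K" if "t \<in> F" for k t using K(2) F01 that by auto
    obtain r :: "nat \<Rightarrow> nat" where r: "strict_mono r" "\<And>t. t \<in> F \<Longrightarrow> convergent (\<lambda>k. X (s (r k)) t)"
      using convergent_subsequence_on_finite_set[OF finF K(1), of "\<lambda>k. X (s k)"] inK by blast
    have "\<exists>N. \<forall>j\<ge>N. \<forall>k\<ge>N. dist (X (s (r k)) t) (X (s (r j)) t) < e / 2" if "t \<in> F" for t
      using metric_CauchyD[OF convergent_Cauchy[OF r(2)[OF that]], of "e / 2"] e by auto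
    then obtain N where N: "\<And>t j k. t \<in> F \<Longrightarrow> j \<ge> N t \<Longrightarrow> k \<ge> N t \<Longrightarrow> dist (X (s (r k)) t) (X (s (r j)) t) < e / 2"
      by metis
    define M where "M = Max (N ` F)"
    have NM: "N t \<le> M" if "t \<in> F" for t unfolding M_def using finF that by auto
    show ?thesis
    proof (intro exI[of _ "\<lambda>k. r (k + M)"] conjI allI ballI)
      show "strict_mono (\<lambda>k. r (k + M))" using r(1) by (auto simp: strict_mono_def)
      fix j k and t :: real assume t: "t \<in> {0..1}"
      define i where "i = nat \<lfloor>t * real m\<rfloor>"
      have i: "real i \<le> t * real m" "t * real m < real i + 1" using t m0 by (auto simp: i_def)
      have "real i \<le> real m" using i(1) t m0 by (smt (verit) atLeastAtMost_iff mult_left_le_one_le)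
      then have "i \<le> m" by simp
      define q where "q = real i / real m"
      have qF: "q \<in> F" using \<open>i \<le> m\<close> by (auto simp: q_def F_def)
      have "\<bar>t - q\<bar> \<le> 1 / real m" 
      proof -
        have tq: "t - q = (t * real m - real i) / real m" using m0 by (simp add: q_def field_simps)
        have "0 \<le> t - q" unfolding tq using i m0 by (intro divide_nonneg_pos) auto
        moreover have "t - q \<le> 1 / real m" unfolding tq using i m0 by (intro divide_right_mono) auto
        ultimately show ?thesis by simp
      qed
      then have "H * sqrt \<bar>t - q\<bar> \<le> H * sqrt (1 / real m)" using \<open>0 \<le> H\<close>
        by (intro mult_left_mono real_sqrt_le_mono) auto
      with mH have He: "H * sqrt \<bar>t - q\<bar> \<le> e / 4" by linarith
      have q01: "q \<in> {0..1}" using qF F01 by auto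
      have near: "dist (X l t) (X l q) \<le> e / 4" for l using H[OF t q01, of l] He by linarith
      have "dist (X (s (r (k + M))) q) (X (s (r (j + M))) q) < e / 2"
        by (rule N[OF qF]) (use NM[OF qF] in auto)
      then have "dist (X (s (r (k + M))) t) (X (s (r (j + M))) t) \<le> e"
        using near[of "s (r (k + M))"] near[of "s (r (j + M))"]
          dist_triangle[of "X (s (r (k + M))) t" "X (s (r (j + M))) t" "X (s (r (k + M))) q"]
          dist_triangle2[of "X (s (r (k + M))) q" "X (s (r (j + M))) t" "X (s (r (j + M))) q"]
        by linarith
      then show "dist (X ((s \<circ> (\<lambda>k. r (k + M))) k) t) (X ((s \<circ> (\<lambda>k. r (k + M))) j) t) \<le> 1 / real (Suc n)"
        by (simp add: e_def)
    qed
  qed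
  note stage = this
  interpret subseqs "\<lambda>n s. \<forall>j k. \<forall>t\<in>{0..1}. dist (X (s k) t) (X (s j) t) \<le> 1 / real (Suc n)"
    by unfold_locales (use stage in auto)
  have tail: "\<forall>i k. \<forall>t\<in>{0..1}. dist (X ((diagseq \<circ> (+) (Suc j)) k) t) (X ((diagseq \<circ> (+) (Suc j)) i) t) \<le> 1 / real (Suc j)" for j
    by (rule diagseq_holds) auto
  show ?thesis
  proof (rule that[of "\<lambda>j. diagseq (Suc j)"])
    show "strict_mono (\<lambda>j. diagseq (Suc j))" using subseq_diagseq by (auto simp: strict_mono_def)
    fix j k :: nat and t :: real assume jk: "j \<le> k" and t: "t \<in> {0..1}"
    have "dist (X ((diagseq \<circ> (+) (Suc j)) (k - j)) t) (X ((diagseq \<circ> (+) (Suc j)) 0) t) \<le> 1 / real (Suc j)"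
      using tail[of j] t by blast
    moreover have "Suc j + (k - j) = Suc k" using jk by simp
    ultimately show "dist (X (diagseq (Suc k)) t) (X (diagseq (Suc j)) t) \<le> 1 / real (Suc j)"
      by (simp only: o_apply add_0_right)
  qed
qed

section \<open>Uniform bounds for curves\<close>

lemma integral_norm_le_integral_sq:
  assumes "square_integrable w"
  shows "(LINT t|unit_measure. norm (w t)) \<le> 1 + (LINT t|unit_measure. (norm (w t))\<^sup>2)"
proof -
  have "(LINT t|unit_measure. norm (w t)) \<le> (LINT t|unit_measure. 1 + (norm (w t))\<^sup>2)"
    using square_integrable_norm_sq[OF assms] integrable_norm[OF square_integrable_imp_integrable[OF assms]]
    by (intro integral_mono le_one_plus_square) auto
  also have "\<dots> = 1 + (LINT t|unit_measure. (norm (w t))\<^sup>2)"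
    using square_integrable_norm_sq[OF assms] by simp
  finally show ?thesis .
qed

lemma norm_primitive_velocity_le:
  assumes "square_integrable w"
  shows "norm (primitive_velocity b w t) \<le> norm b + (LINT t|unit_measure. norm (w t))"
  unfolding primitive_velocity_def
  by (rule order_trans[OF norm_triangle_ineq])
    (intro add_left_mono norm_primitive_le square_integrable_imp_integrable assms)

lemma norm_primitive_le_bound:
  assumes "integrable unit_measure u" and u: "\<And>t. 0 < t \<Longrightarrow> t < 1 \<Longrightarrow> norm (u t) \<le> V"
  shows "norm (primitive u t) \<le> V"
proof -
  have "norm (primitive u t) \<le> (LINT x|unit_measure. norm (u x))"
    by (rule norm_primitive_le[OF assms(1)])
  also have "\<dots> \<le> (LINT x|unit_measure. V)"
    by (intro integral_mono integrable_norm assms(1)) (use u in auto)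
  finally show ?thesis unfolding integral_unit_const .
qed

lemma curve_bounds:
  fixes a b :: "'v::{banach, second_countable_topology}"
  assumes w: "square_integrable w" and R: "pair_norm_sq (a, b) w \<le> R"
  shows "norm (primitive_velocity b w t) \<le> 2 * R + 2"
    and "norm (primitive_curve a b w t) \<le> 3 * R + 3"
    and "(LINT t|unit_measure. (norm (w t))\<^sup>2) \<le> R"
    and "s \<in> {0..1} \<Longrightarrow> t \<in> {0..1} \<Longrightarrow>
      norm (primitive_velocity b w s - primitive_velocity b w t) \<le> (2 * R + 2) * sqrt \<bar>s - t\<bar>"
    and "s \<in> {0..1} \<Longrightarrow> t \<in> {0..1} \<Longrightarrow>
      norm (primitive_curve a b w s - primitive_curve a b w t) \<le> (2 * R + 2) * sqrt \<bar>s - t\<bar>"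
proof -
  have I0: "0 \<le> (LINT t|unit_measure. (norm (w t))\<^sup>2)" by (rule integral_nonneg_AE) simp
  have R': "(norm a)\<^sup>2 + (norm b)\<^sup>2 + (LINT t|unit_measure. (norm (w t))\<^sup>2) \<le> R"
    using R by (simp add: pair_norm_sq_def norm_Pair)
  show I: "(LINT t|unit_measure. (norm (w t))\<^sup>2) \<le> R"
    using R' zero_le_power2[of "norm a"] zero_le_power2[of "norm b"] by linarith
  have R0: "0 \<le> R" using I I0 by linarith
  have ab: "norm a \<le> 1 + R" "norm b \<le> 1 + R"
    using R' le_one_plus_square[of "norm a"] le_one_plus_square[of "norm b"] I0 zero_le_power2[of "norm a"] zero_le_power2[of "norm b"] by linarith+
  have vel: "norm (primitive_velocity b w t) \<le> 2 * R + 2" for t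
    using norm_primitive_velocity_le[OF w, of b t] integral_norm_le_integral_sq[OF w] ab(2) I by linarith
  show "norm (primitive_velocity b w t) \<le> 2 * R + 2" by (rule vel)
  note vsq = square_integrable_primitive_velocity[OF w, of b]
  have "norm (primitive (primitive_velocity b w) t) \<le> 2 * R + 2"
    by (rule norm_primitive_le_bound[OF square_integrable_imp_integrable[OF vsq] vel])
  then show "norm (primitive_curve a b w t) \<le> 3 * R + 3"
    unfolding primitive_curve_def using norm_triangle_ineq[of a "primitive (primitive_velocity b w) t"] ab(1) by linarith
  have prim: "norm (primitive u t - primitive u s) \<le> (2 * R + 2) * sqrt \<bar>s - t\<bar>"
    if u: "square_integrable u" "(LINT t|unit_measure. (norm (u t))\<^sup>2) \<le> (2 * R + 2)\<^sup>2" and st: "s \<in> {0..1}" "t \<in> {0..1}"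
    for u :: "real \<Rightarrow> 'v" and s t
  proof -
    have *: "norm (primitive u t - primitive u s) \<le> (2 * R + 2) * sqrt (t - s)" if "s \<le> t" "s \<in> {0..1}" "t \<in> {0..1}" for s t
    proof -
      have "norm (primitive u t - primitive u s) \<le> sqrt (t - s) * sqrt (LINT x|unit_measure. (norm (u x))\<^sup>2)"
        by (rule norm_primitive_diff_le_sqrt[OF u(1)]) (use that in auto)
      also have "\<dots> \<le> sqrt (t - s) * (2 * R + 2)"
        using u(2) R0 that by (intro mult_left_mono real_le_lsqrt) auto
      finally show ?thesis by (simp add: mult.commute)
    qed
    show ?thesis
      using *[of s t] *[of t s] st by (cases "s \<le> t") (simp_all add: norm_minus_commute)
  qed
  have "R \<le> (2 * R + 2)\<^sup>2"
    using R0 by (simp add: power2_eq_square algebra_simps)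
  with I have wI: "(LINT t|unit_measure. (norm (w t))\<^sup>2) \<le> (2 * R + 2)\<^sup>2" by linarith
  have "(LINT t|unit_measure. (norm (primitive_velocity b w t))\<^sup>2) \<le> (LINT t|unit_measure. (2 * R + 2)\<^sup>2)"
    by (intro integral_mono square_integrable_norm_sq vsq power_mono vel) auto
  then have vI: "(LINT t|unit_measure. (norm (primitive_velocity b w t))\<^sup>2) \<le> (2 * R + 2)\<^sup>2" by simp
  show "norm (primitive_velocity b w s - primitive_velocity b w t) \<le> (2 * R + 2) * sqrt \<bar>s - t\<bar>"
    if "s \<in> {0..1}" "t \<in> {0..1}"
    using prim[OF w wI that] by (simp add: primitive_velocity_def norm_minus_commute)
  show "norm (primitive_curve a b w s - primitive_curve a b w t) \<le> (2 * R + 2) * sqrt \<bar>s - t\<bar>"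
    if "s \<in> {0..1}" "t \<in> {0..1}"
    using prim[OF vsq vI that] by (simp add: primitive_curve_def norm_minus_commute)
qed

lemma primitive_tendsto:
  assumes z: "\<And>k. z k \<in> borel_measurable unit_measure" and w: "w \<in> borel_measurable unit_measure"
    and S: "integrable unit_measure S"
    and AE: "AE t in unit_measure. (\<forall>k. norm (z k t) \<le> S t) \<and> (\<lambda>k. z k t) \<longlonglongrightarrow> w t"
  shows "(\<lambda>k. primitive (z k) t) \<longlonglongrightarrow> primitive w t"
  unfolding primitive_def
proof (rule integral_dominated_convergence[OF _ _ S])
  note [measurable] = z w
  have [measurable]: "indicat_real {..t} \<in> borel_measurable unit_measure" by (rule borel_measurable_unit) simp
  show "(\<lambda>s. indicat_real {..t} s *\<^sub>R w s) \<in> borel_measurable unit_measure" by measurable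
  show "(\<lambda>s. indicat_real {..t} s *\<^sub>R z k s) \<in> borel_measurable unit_measure" for k by measurable
  show "AE s in unit_measure. (\<lambda>k. indicat_real {..t} s *\<^sub>R z k s) \<longlonglongrightarrow> indicat_real {..t} s *\<^sub>R w s"
    using AE by eventually_elim (intro tendsto_intros, auto)
  show "AE s in unit_measure. norm (indicat_real {..t} s *\<^sub>R z k s) \<le> S s" for k
    using AE by eventually_elim (auto simp: indicator_def intro: order_trans[OF norm_ge_zero])
qed

text \<open>The mode of convergence that \<open>square_integrable_fast_Cauchy\<close> delivers
  passes to velocities and curves at every time.\<close>

lemma curve_tendsto:
  fixes a0 b0 :: "'v::{banach, second_countable_topology}"
  assumes z: "\<And>k. square_integrable (z k)" and w: "square_integrable w"
    and S: "integrable unit_measure S"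
    and AE: "AE t in unit_measure. (\<forall>k. (norm (z k t))\<^sup>2 \<le> S t) \<and> (\<lambda>k. z k t) \<longlonglongrightarrow> w t"
    and ab: "a \<longlonglongrightarrow> a0" "b \<longlonglongrightarrow> b0"
  shows "(\<lambda>k. primitive_velocity (b k) (z k) t) \<longlonglongrightarrow> primitive_velocity b0 w t"
    and "(\<lambda>k. primitive_curve (a k) (b k) (z k) t) \<longlonglongrightarrow> primitive_curve a0 b0 w t"
    and "\<exists>B. \<forall>k t. norm (primitive_velocity (b k) (z k) t) \<le> B"
proof -
  have S1: "integrable unit_measure (\<lambda>t. 1 + S t)" using S by simp
  have AE1: "AE t in unit_measure. (\<forall>k. norm (z k t) \<le> 1 + S t) \<and> (\<lambda>k. z k t) \<longlonglongrightarrow> w t"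
    using AE by eventually_elim (use le_one_plus_square in \<open>meson add_left_mono order_trans\<close>)
  show vel: "(\<lambda>k. primitive_velocity (b k) (z k) t) \<longlonglongrightarrow> primitive_velocity b0 w t" for t
    unfolding primitive_velocity_def
    by (intro tendsto_add ab primitive_tendsto[OF _ _ S1 AE1] square_integrable_measurable z w)
  obtain B0 where B0: "\<And>k. norm (b k) \<le> B0"
    using convergent_imp_Bseq[of b] ab(2) by (auto simp: convergent_def Bseq_def)
  have B: "norm (primitive_velocity (b k) (z k) t) \<le> B0 + (LINT t|unit_measure. 1 + S t)" for k t
  proof -
    have "(LINT t|unit_measure. norm (z k t)) \<le> (LINT t|unit_measure. 1 + S t)"
      by (intro integral_mono_AE integrable_norm square_integrable_imp_integrable z S1)
        (use AE1 in \<open>auto elim: eventually_mono\<close>)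
    then show ?thesis using norm_primitive_velocity_le[OF z, of "b k" k t] B0[of k] by linarith
  qed
  then show "\<exists>B. \<forall>k t. norm (primitive_velocity (b k) (z k) t) \<le> B" by blast
  show "(\<lambda>k. primitive_curve (a k) (b k) (z k) t) \<longlonglongrightarrow> primitive_curve a0 b0 w t"
    unfolding primitive_curve_def
  proof (intro tendsto_add ab primitive_tendsto)
    show "AE t in unit_measure. (\<forall>k. norm (primitive_velocity (b k) (z k) t) \<le> B0 + (LINT t|unit_measure. 1 + S t)) \<and>
        (\<lambda>k. primitive_velocity (b k) (z k) t) \<longlonglongrightarrow> primitive_velocity b0 w t"
      using B vel by (intro AE_I2) auto
  qed (auto intro!: square_integrable_measurable square_integrable_primitive_velocity z w)
qed

lemma curve_midpoint:
  assumes w: "square_integrable w" "square_integrable w'"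
  shows "primitive_velocity ((1/2) *\<^sub>R (b + b')) (\<lambda>t. (1/2) *\<^sub>R (w t + w' t)) t =
      (1/2) *\<^sub>R (primitive_velocity b w t + primitive_velocity b' w' t)"
    and "primitive_curve ((1/2) *\<^sub>R (a + a')) ((1/2) *\<^sub>R (b + b')) (\<lambda>t. (1/2) *\<^sub>R (w t + w' t)) t =
      (1/2) *\<^sub>R (primitive_curve a b w t + primitive_curve a' b' w' t)"
proof -
  note i = square_integrable_imp_integrable
  show v: "primitive_velocity ((1/2) *\<^sub>R (b + b')) (\<lambda>t. (1/2) *\<^sub>R (w t + w' t)) t =
      (1/2) *\<^sub>R (primitive_velocity b w t + primitive_velocity b' w' t)" for t
    unfolding primitive_velocity_def primitive_scaleR primitive_add[OF i[OF w(1)] i[OF w(2)]]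
    by (simp add: scaleR_add_right)
  show "primitive_curve ((1/2) *\<^sub>R (a + a')) ((1/2) *\<^sub>R (b + b')) (\<lambda>t. (1/2) *\<^sub>R (w t + w' t)) t =
      (1/2) *\<^sub>R (primitive_curve a b w t + primitive_curve a' b' w' t)"
    unfolding primitive_curve_def v primitive_scaleR
      primitive_add[OF i[OF square_integrable_primitive_velocity[OF w(1)]] i[OF square_integrable_primitive_velocity[OF w(2)]]]
    by (simp add: scaleR_add_right)
qed

section \<open>The energy density\<close>

context spline_metric
begin

lemma g_nonneg: "0 \<le> g p v v"
  using lower[of v p] c_pos by (smt (verit) mult_nonneg_nonneg zero_le_power2)

lemma tendsto_g:
  assumes p: "(p \<longlongrightarrow> p0) F" and v: "(v \<longlongrightarrow> v0) F" and w: "(w \<longlongrightarrow> w0) F"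
  shows "((\<lambda>x. g (p x) (v x) (w x)) \<longlongrightarrow> g p0 v0 w0) F"
proof -
  interpret \<iota>: bounded_linear \<iota> by (rule \<iota>)
  have "((\<lambda>x. g (p x) (v x) (w x) - g p0 v0 w0) \<longlongrightarrow> 0) F"
  proof (rule Lim_null_comparison)
    show "\<forall>\<^sub>F x in F. norm (g (p x) (v x) (w x) - g p0 v0 w0) \<le>
      L * norm (\<iota> (p x) - \<iota> p0) * norm (v x) * norm (w x) + C * norm (v x - v0) * norm (w x) + C * norm v0 * norm (w x - w0)"
    proof (intro always_eventually allI)
      fix x
      have "g (p x) (v x) (w x) - g p0 v0 w0 = (g (p x) (v x) (w x) - g p0 (v x) (w x)) + g p0 (v x - v0) (w x) + g p0 v0 (w x - w0)"
        by (simp add: bilinear_expand[OF bil])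
      then show "norm (g (p x) (v x) (w x) - g p0 v0 w0) \<le>
        L * norm (\<iota> (p x) - \<iota> p0) * norm (v x) * norm (w x) + C * norm (v x - v0) * norm (w x) + C * norm v0 * norm (w x - w0)"
        using lipschitz[of "p x" "v x" "w x" p0] upper[of p0 "v x - v0" "w x"] upper[of p0 v0 "w x - w0"]
        by simp
    qed
    have "((\<lambda>x. L * norm (\<iota> (p x) - \<iota> p0) * norm (v x) * norm (w x) + C * norm (v x - v0) * norm (w x) + C * norm v0 * norm (w x - w0))
      \<longlongrightarrow> L * norm (\<iota> p0 - \<iota> p0) * norm v0 * norm w0 + C * norm (v0 - v0) * norm w0 + C * norm v0 * norm (w0 - w0)) F"
      by (intro tendsto_intros \<iota>.tendsto p v w)
    then show "((\<lambda>x. L * norm (\<iota> (p x) - \<iota> p0) * norm (v x) * norm (w x) + C * norm (v x - v0) * norm (w x) + C * norm v0 * norm (w x - w0)) \<longlongrightarrow> 0) F"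
      by simp
  qed
  then show ?thesis by (simp add: LIM_zero_iff)
qed

lemma tendsto_\<Gamma>:
  assumes p: "(p \<longlongrightarrow> p0) F" and v: "(v \<longlongrightarrow> v0) F"
  shows "((\<lambda>x. \<Gamma> (p x) (v x)) \<longlongrightarrow> \<Gamma> p0 v0) F"
proof -
  interpret \<iota>: bounded_linear \<iota> by (rule \<iota>)
  have "((\<lambda>x. \<Gamma> (p x) (v x) - \<Gamma> p0 v0) \<longlongrightarrow> 0) F"
  proof (rule Lim_null_comparison)
    show "\<forall>\<^sub>F x in F. norm (\<Gamma> (p x) (v x) - \<Gamma> p0 v0) \<le>
      K * (norm (\<iota> (p x) - \<iota> p0) * ((norm (v x))\<^sup>2 + (norm v0)\<^sup>2) + norm (\<iota> (v x) - \<iota> v0) * (norm (v x) + norm v0))"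
      by (intro always_eventually allI \<Gamma>_lipschitz)
    have "((\<lambda>x. K * (norm (\<iota> (p x) - \<iota> p0) * ((norm (v x))\<^sup>2 + (norm v0)\<^sup>2) + norm (\<iota> (v x) - \<iota> v0) * (norm (v x) + norm v0)))
      \<longlongrightarrow> K * (norm (\<iota> p0 - \<iota> p0) * ((norm v0)\<^sup>2 + (norm v0)\<^sup>2) + norm (\<iota> v0 - \<iota> v0) * (norm v0 + norm v0))) F"
      by (intro tendsto_intros \<iota>.tendsto p v)
    then show "((\<lambda>x. K * (norm (\<iota> (p x) - \<iota> p0) * ((norm (v x))\<^sup>2 + (norm v0)\<^sup>2) + norm (\<iota> (v x) - \<iota> v0) * (norm (v x) + norm v0))) \<longlongrightarrow> 0) F"
      by simp
  qed
  then show ?thesis by (simp add: LIM_zero_iff)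
qed

text \<open>The position \<open>p\<close> and the velocity \<open>u\<close> in the coefficients are
  separated from the velocity \<open>v\<close> and the acceleration \<open>w\<close>, in which the
  density is a convex quadratic function.\<close>

definition density :: "real \<Rightarrow> 'v \<Rightarrow> 'v \<Rightarrow> 'v \<Rightarrow> 'v \<Rightarrow> real"
  where "density \<sigma> p u v w = g p (w + \<Gamma> p u) (w + \<Gamma> p u) + \<sigma> * g p v v"

lemma tendsto_density:
  assumes "(p \<longlongrightarrow> p0) F" "(u \<longlongrightarrow> u0) F" "(v \<longlongrightarrow> v0) F" "(w \<longlongrightarrow> w0) F"
  shows "((\<lambda>x. density \<sigma> (p x) (u x) (v x) (w x)) \<longlongrightarrow> density \<sigma> p0 u0 v0 w0) F"
  unfolding density_def by (intro tendsto_intros tendsto_g tendsto_\<Gamma> assms)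

lemma measurable_g:
  assumes [measurable]: "p \<in> borel_measurable M" "v \<in> borel_measurable M" "w \<in> borel_measurable M"
  shows "(\<lambda>x. g (p x) (v x) (w x)) \<in> borel_measurable M"
proof -
  have "continuous_on UNIV (\<lambda>z. g (fst z) (fst (snd z)) (snd (snd z)))"
    unfolding continuous_on_def by (intro ballI tendsto_g tendsto_intros)
  then have "(\<lambda>z. g (fst z) (fst (snd z)) (snd (snd z))) \<in> borel_measurable borel"
    by (rule borel_measurable_continuous_onI)
  moreover have "(\<lambda>x. (p x, (v x, w x))) \<in> borel_measurable M" by measurable
  ultimately have "(\<lambda>x. g (fst (p x, (v x, w x))) (fst (snd (p x, (v x, w x)))) (snd (snd (p x, (v x, w x))))) \<in> borel_measurable M"
    by (rule measurable_compose[rotated])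
  then show ?thesis by simp
qed

lemma measurable_\<Gamma>:
  assumes [measurable]: "p \<in> borel_measurable M" "v \<in> borel_measurable M"
  shows "(\<lambda>x. \<Gamma> (p x) (v x)) \<in> borel_measurable M"
proof (rule borel_measurable_continuous_Pair[where H="\<Gamma>"])
  show "continuous_on UNIV (\<lambda>z. \<Gamma> (fst z) (snd z))"
    unfolding continuous_on_def by (intro ballI tendsto_\<Gamma> tendsto_intros)
qed measurable

lemma measurable_density:
  assumes "p \<in> borel_measurable M" "u \<in> borel_measurable M" "v \<in> borel_measurable M" "w \<in> borel_measurable M"
  shows "(\<lambda>x. density \<sigma> (p x) (u x) (v x) (w x)) \<in> borel_measurable M"
  unfolding density_def
  by (intro borel_measurable_add borel_measurable_times measurable_g measurable_\<Gamma> assms borel_measurable_const)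

lemma density_nonneg: "0 \<le> \<sigma> \<Longrightarrow> 0 \<le> density \<sigma> p u v w"
  unfolding density_def by (intro add_nonneg_nonneg mult_nonneg_nonneg g_nonneg)

lemma density_lower:
  assumes "0 \<le> \<sigma>"
  shows "c * (norm (w + \<Gamma> p u))\<^sup>2 + \<sigma> * c * (norm v)\<^sup>2 \<le> density \<sigma> p u v w"
  using lower[of "w + \<Gamma> p u" p] mult_left_mono[OF lower[of v p] assms] unfolding density_def
  by (simp add: ac_simps)

lemma g_le: "g p v v \<le> C * (norm v)\<^sup>2"
  using upper[of p v v] by (simp add: power2_eq_square)

lemma norm_acceleration_le:
  assumes "norm u \<le> R"
  shows "norm (w + \<Gamma> p u) \<le> (1 + K * R\<^sup>2) * (1 + norm w)"
proof -
  have "norm (\<Gamma> p u) \<le> K * R\<^sup>2"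
    using \<Gamma>_bound[of p u] assms nonneg(3) by (smt (verit) mult_left_mono norm_ge_zero power_mono)
  moreover have "0 \<le> K * R\<^sup>2" using nonneg(3) by simp
  moreover have "(1 + K * R\<^sup>2) * (1 + norm w) = 1 + norm w + K * R\<^sup>2 + K * R\<^sup>2 * norm w"
    by (simp add: algebra_simps)
  moreover have "0 \<le> K * R\<^sup>2 * norm w" using nonneg(3) by simp
  ultimately show ?thesis using norm_triangle_ineq[of w "\<Gamma> p u"] by linarith
qed

lemma density_upper:
  assumes "0 \<le> \<sigma>" "norm u \<le> R" "norm v \<le> R"
  shows "density \<sigma> p u v w \<le> (C * (1 + K * R\<^sup>2)\<^sup>2 + \<sigma> * C * R\<^sup>2) * (1 + norm w)\<^sup>2"
proof -
  have "g p (w + \<Gamma> p u) (w + \<Gamma> p u) \<le> C * ((1 + K * R\<^sup>2) * (1 + norm w))\<^sup>2"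
    by (rule order_trans[OF g_le]) (intro mult_left_mono power_mono norm_acceleration_le assms nonneg; simp)
  moreover have "\<sigma> * g p v v \<le> \<sigma> * (C * R\<^sup>2) * (1 + norm w)\<^sup>2"
  proof -
    have "\<sigma> * g p v v \<le> \<sigma> * (C * R\<^sup>2)"
      by (intro mult_left_mono order_trans[OF g_le] power_mono assms nonneg; simp)
    also have "\<dots> * 1 \<le> \<sigma> * (C * R\<^sup>2) * (1 + norm w)\<^sup>2"
      using assms(1) nonneg by (intro mult_left_mono mult_nonneg_nonneg one_le_power) auto
    finally show ?thesis by simp
  qed
  ultimately have "density \<sigma> p u v w \<le> C * ((1 + K * R\<^sup>2) * (1 + norm w))\<^sup>2 + \<sigma> * (C * R\<^sup>2) * (1 + norm w)\<^sup>2"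
    unfolding density_def by linarith
  then show ?thesis unfolding power_mult_distrib by (simp only: distrib_right mult.assoc)
qed

lemma integrable_density:
  assumes \<sigma>: "0 \<le> \<sigma>"
    and m: "p \<in> borel_measurable unit_measure" "u \<in> borel_measurable unit_measure" "v \<in> borel_measurable unit_measure"
    and w: "square_integrable w"
    and R: "\<And>t. 0 < t \<Longrightarrow> t < 1 \<Longrightarrow> norm (u t) \<le> R" "\<And>t. 0 < t \<Longrightarrow> t < 1 \<Longrightarrow> norm (v t) \<le> R"
  shows "integrable unit_measure (\<lambda>t. density \<sigma> (p t) (u t) (v t) (w t))"
proof (rule Bochner_Integration.integrable_bound)
  let ?B = "C * (1 + K * R\<^sup>2)\<^sup>2 + \<sigma> * C * R\<^sup>2"
  from square_integrable_norm_sq[OF square_integrable_one_plus_norm[OF w]]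
  show "integrable unit_measure (\<lambda>t. ?B * (1 + norm (w t))\<^sup>2)" by simp
  show "(\<lambda>t. density \<sigma> (p t) (u t) (v t) (w t)) \<in> borel_measurable unit_measure"
    by (intro measurable_density m square_integrable_measurable w)
  show "AE t in unit_measure. norm (density \<sigma> (p t) (u t) (v t) (w t)) \<le> norm (?B * (1 + norm (w t))\<^sup>2)"
    using AE_unit_mem
  proof eventually_elim
    case (elim t)
    then have "density \<sigma> (p t) (u t) (v t) (w t) \<le> ?B * (1 + norm (w t))\<^sup>2"
      by (intro density_upper \<sigma> R) auto
    then show ?case using density_nonneg[OF \<sigma>, of "p t" "u t" "v t" "w t"] by simp
  qed
qed

text \<open>A change of the velocity costs only one power of the acceleration. The first variation
  relies on this: there the perturbation of the velocity is controlled in \<open>L\<^sup>2\<close>,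
  and so is the acceleration.\<close>

lemma density_lipschitz:
  assumes \<sigma>: "0 \<le> \<sigma>"
  obtains B where "0 \<le> B"
    "\<And>p u p' u' v w. norm u \<le> R \<Longrightarrow> norm u' \<le> R \<Longrightarrow> norm v \<le> R \<Longrightarrow>
      \<bar>density \<sigma> p u v w - density \<sigma> p' u' v w\<bar> \<le>
        B * (norm (\<iota> p - \<iota> p') * (1 + norm w)\<^sup>2 + norm (\<iota> u - \<iota> u') * (1 + norm w))"
proof -
  define k where "k = 1 + K * R\<^sup>2"
  define B where "B = L * k\<^sup>2 + C * (2 * K * R\<^sup>2) * (2 * k) + \<sigma> * L * R\<^sup>2 + C * (2 * K * \<bar>R\<bar>) * (2 * k)"
  have k: "1 \<le> k" using nonneg by (simp add: k_def)
  have parts: "0 \<le> L * k\<^sup>2" "0 \<le> C * (2 * K * R\<^sup>2) * (2 * k)" "0 \<le> \<sigma> * L * R\<^sup>2" "0 \<le> C * (2 * K * \<bar>R\<bar>) * (2 * k)"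
    using nonneg k \<sigma> by (auto intro!: mult_nonneg_nonneg)
  show ?thesis
  proof (rule that[of B])
    show "0 \<le> B" using parts by (simp add: B_def)
    fix p u p' u' v w :: 'v
    assume u: "norm u \<le> R" and u': "norm u' \<le> R" and v: "norm v \<le> R"
    then have R: "0 \<le> R" by (smt (verit) norm_ge_zero)
    define S where "S = 1 + norm w"
    define d e where "d = norm (\<iota> p - \<iota> p')" and "e = norm (\<iota> u - \<iota> u')"
    have S: "1 \<le> S" and de: "0 \<le> d" "0 \<le> e" by (auto simp: S_def d_def e_def)
    let ?a = "w + \<Gamma> p u" and ?a' = "w + \<Gamma> p' u'"
    have a: "norm ?a \<le> k * S" "norm ?a' \<le> k * S"
      using norm_acceleration_le[OF u] norm_acceleration_le[OF u'] by (simp_all add: k_def S_def)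
    have diff: "norm (?a - ?a') \<le> K * (d * (2 * R\<^sup>2) + e * (2 * R))"
    proof -
      have "norm (?a - ?a') \<le> K * (d * ((norm u)\<^sup>2 + (norm u')\<^sup>2) + e * (norm u + norm u'))"
        using \<Gamma>_lipschitz[of p u p' u'] by (simp add: d_def e_def)
      also have "\<dots> \<le> K * (d * (R\<^sup>2 + R\<^sup>2) + e * (R + R))"
        by (intro mult_left_mono add_mono power_mono u u' nonneg de) auto
      finally show ?thesis by simp
    qed
    have 1: "\<bar>g p ?a ?a - g p' ?a ?a\<bar> \<le> L * d * (k * S) * (k * S)"
      by (rule order_trans[OF lipschitz], fold d_def)
        (use a nonneg de k S in \<open>intro mult_mono, auto intro!: mult_nonneg_nonneg\<close>)
    have 2: "\<bar>g p' (?a - ?a') ?a\<bar> \<le> C * (K * (d * (2 * R\<^sup>2) + e * (2 * R))) * (k * S)"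
      by (rule order_trans[OF upper])
        (use a diff nonneg de k S R in \<open>intro mult_mono, auto intro!: mult_nonneg_nonneg\<close>)
    have 3: "\<bar>g p' ?a' (?a - ?a')\<bar> \<le> C * (k * S) * (K * (d * (2 * R\<^sup>2) + e * (2 * R)))"
      by (rule order_trans[OF upper])
        (use a diff nonneg de k S R in \<open>intro mult_mono, auto intro!: mult_nonneg_nonneg\<close>)
    have 4: "\<bar>\<sigma> * g p v v - \<sigma> * g p' v v\<bar> \<le> \<sigma> * (L * d * R * R)"
    proof -
      have "\<bar>\<sigma> * g p v v - \<sigma> * g p' v v\<bar> = \<sigma> * \<bar>g p v v - g p' v v\<bar>"
        using \<sigma> by (simp add: abs_mult flip: right_diff_distrib)
      also have "\<dots> \<le> \<sigma> * (L * d * R * R)"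
        by (rule mult_left_mono[OF order_trans[OF lipschitz] \<sigma>], fold d_def)
          (use v R nonneg de in \<open>intro mult_mono, auto intro!: mult_nonneg_nonneg\<close>)
      finally show ?thesis .
    qed
    have "density \<sigma> p u v w - density \<sigma> p' u' v w =
        (g p ?a ?a - g p' ?a ?a) + g p' (?a - ?a') ?a + g p' ?a' (?a - ?a') + (\<sigma> * g p v v - \<sigma> * g p' v v)"
      unfolding density_def by (simp only: bilinear_diff_left[OF bil] bilinear_diff_right[OF bil])
    then have "\<bar>density \<sigma> p u v w - density \<sigma> p' u' v w\<bar> \<le> L * d * (k * S) * (k * S) +
        C * (K * (d * (2 * R\<^sup>2) + e * (2 * R))) * (k * S) + C * (k * S) * (K * (d * (2 * R\<^sup>2) + e * (2 * R))) + \<sigma> * (L * d * R * R)"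
      using 1 2 3 4 by linarith
    also have "\<dots> = (L * k\<^sup>2) * (d * S\<^sup>2) + (C * (2 * K * R\<^sup>2) * (2 * k)) * (d * S) + (\<sigma> * L * R\<^sup>2) * d
        + (C * (2 * K * R) * (2 * k)) * (e * S)"
      by (simp add: power2_eq_square algebra_simps)
    also have "\<dots> \<le> (L * k\<^sup>2) * (d * S\<^sup>2) + (C * (2 * K * R\<^sup>2) * (2 * k)) * (d * S\<^sup>2) + (\<sigma> * L * R\<^sup>2) * (d * S\<^sup>2)
        + (C * (2 * K * R) * (2 * k)) * (e * S)"
    proof -
      have "S \<le> S\<^sup>2" "1 \<le> S\<^sup>2" using S by (auto intro: self_le_power one_le_power)
      then have "d * S \<le> d * S\<^sup>2" "d * 1 \<le> d * S\<^sup>2" using de(1) by (blast intro: mult_left_mono)+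
      then have "(C * (2 * K * R\<^sup>2) * (2 * k)) * (d * S) \<le> (C * (2 * K * R\<^sup>2) * (2 * k)) * (d * S\<^sup>2)"
        and "(\<sigma> * L * R\<^sup>2) * d \<le> (\<sigma> * L * R\<^sup>2) * (d * S\<^sup>2)"
        using mult_left_mono[OF _ parts(2)] mult_left_mono[OF _ parts(3)] by simp_all
      then show ?thesis by linarith
    qed
    also have "\<dots> \<le> B * (d * S\<^sup>2 + e * S)"
    proof -
      define b1 b2 b3 b4 where "b1 = L * k\<^sup>2" and "b2 = C * (2 * K * R\<^sup>2) * (2 * k)" and "b3 = \<sigma> * L * R\<^sup>2"
        and "b4 = C * (2 * K * R) * (2 * k)"
      have b: "0 \<le> b1" "0 \<le> b2" "0 \<le> b3" "0 \<le> b4" "B = b1 + b2 + b3 + b4"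
        using parts R by (auto simp: b1_def b2_def b3_def b4_def B_def)
      have n: "0 \<le> d * S\<^sup>2" "0 \<le> e * S" using de S by auto
      have "B * (d * S\<^sup>2 + e * S) = b1 * (d * S\<^sup>2) + b2 * (d * S\<^sup>2) + b3 * (d * S\<^sup>2) + b4 * (e * S)
         + (b4 * (d * S\<^sup>2) + b1 * (e * S) + b2 * (e * S) + b3 * (e * S))"
        unfolding b(5) by (simp add: algebra_simps)
      moreover have "0 \<le> b4 * (d * S\<^sup>2) + b1 * (e * S) + b2 * (e * S) + b3 * (e * S)"
        using b n de S by (intro add_nonneg_nonneg mult_nonneg_nonneg) auto
      ultimately show ?thesis unfolding b1_def b2_def b3_def b4_def by linarith
    qed
    finally show "\<bar>density \<sigma> p u v w - density \<sigma> p' u' v w\<bar> \<le>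
        B * (norm (\<iota> p - \<iota> p') * (1 + norm w)\<^sup>2 + norm (\<iota> u - \<iota> u') * (1 + norm w))"
      by (simp add: d_def e_def S_def)
  qed
qed

lemma g_midpoint: "g p ((1/2) *\<^sub>R (x + y)) ((1/2) *\<^sub>R (x + y)) \<le> (g p x x + g p y y) / 2"
proof -
  have "0 \<le> g p (x - y) (x - y)" by (rule g_nonneg)
  then show ?thesis using sym[of p x y] by (simp add: bilinear_expand[OF bil] field_simps)
qed

lemma density_midpoint:
  assumes "0 \<le> \<sigma>"
  shows "density \<sigma> p u ((1/2) *\<^sub>R (v + v')) ((1/2) *\<^sub>R (w + w')) \<le>
    (density \<sigma> p u v w + density \<sigma> p u v' w') / 2"
proof -
  have "(1/2) *\<^sub>R (w + w') + \<Gamma> p u = (1/2) *\<^sub>R ((w + \<Gamma> p u) + (w' + \<Gamma> p u))"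
    by (simp add: scaleR_add_right flip: scaleR_add_left)
  then show ?thesis
    unfolding density_def using g_midpoint[of p "w + \<Gamma> p u" "w' + \<Gamma> p u"]
      mult_left_mono[OF g_midpoint[of p v v'] assms]
    by (simp add: field_simps)
qed


text \<open>The energy with coefficients evaluated along the curve \<open>p\<close> with velocity
  \<open>u\<close>, a convex functional of the velocity \<open>v\<close> and the acceleration
  \<open>w\<close>.\<close>

definition frozen_energy :: "real \<Rightarrow> (real \<Rightarrow> 'v) \<Rightarrow> (real \<Rightarrow> 'v) \<Rightarrow> (real \<Rightarrow> 'v) \<Rightarrow> (real \<Rightarrow> 'v) \<Rightarrow> real"
  where "frozen_energy \<sigma> p u v w = (LINT t|unit_measure. density \<sigma> (p t) (u t) (v t) (w t))"

definition curve_energy :: "real \<Rightarrow> ('v \<times> 'v) \<Rightarrow> (real \<Rightarrow> 'v) \<Rightarrow> real"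
  where "curve_energy \<sigma> x w = frozen_energy \<sigma> (primitive_curve (fst x) (snd x) w)
    (primitive_velocity (snd x) w) (primitive_velocity (snd x) w) w"

lemma curve_measurable:
  assumes "square_integrable w"
  shows "primitive_curve a b w \<in> borel_measurable unit_measure"
    and "primitive_velocity b w \<in> borel_measurable unit_measure"
  using assms by (auto intro: borel_measurable_integrable continuous_integrable_unit
      continuous_primitive_curve continuous_primitive_velocity)

lemma curve_energy_nonneg: "0 \<le> \<sigma> \<Longrightarrow> 0 \<le> curve_energy \<sigma> x w"
  unfolding curve_energy_def frozen_energy_def by (rule integral_nonneg_AE) (simp add: density_nonneg)

lemma velocity_bounded:
  assumes "square_integrable w"
  obtains V where "\<And>t. norm (primitive_velocity b w t) \<le> V"
  using norm_primitive_velocity_le[OF assms, of b] by blast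

text \<open>This is where the regularization \<open>\<sigma> > 0\<close> enters. It bounds the
  velocity in \<open>L\<^sup>2\<close> by \<open>M1\<close>; then the Christoffel term and the
  acceleration are bounded in \<open>L\<^sup>1\<close>, the latter by \<open>W1\<close>; so the
  velocity is bounded uniformly by \<open>V\<close>, and the acceleration in
  \<open>L\<^sup>2\<close>. The position is bounded once it is at one time.\<close>

proposition curve_energy_coercive:
  assumes \<sigma>: "0 < \<sigma>" and "0 \<le> M" "0 \<le> m"
  obtains R where "\<And>x w t. square_integrable w \<Longrightarrow> curve_energy \<sigma> x w \<le> M \<Longrightarrow> 0 \<le> t \<Longrightarrow>
    norm (primitive_curve (fst x) (snd x) w t) \<le> m \<Longrightarrow> pair_norm_sq x w \<le> R"
proof -
  define M1 where "M1 = M / (\<sigma> * c)"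
  define W1 where "W1 = (1 + M / c) + K * M1"
  define B1 where "B1 = 1 + M1 + W1"
  define V where "V = B1 + W1"
  define R where "R = (m + V)\<^sup>2 + B1\<^sup>2 + (2 * (M / c) + 2 * (K * V\<^sup>2)\<^sup>2)"
  show ?thesis
  proof (rule that[of R])
    fix x :: "'v \<times> 'v" and w t
    assume w: "square_integrable w" and E: "curve_energy \<sigma> x w \<le> M"
      and pos: "norm (primitive_curve (fst x) (snd x) w t) \<le> m"
    obtain a b where x: "x = (a, b)" by (cases x)
    let ?p = "primitive_curve a b w" and ?v = "primitive_velocity b w"
    let ?A = "\<lambda>t. w t + \<Gamma> (?p t) (?v t)"
    note pm = curve_measurable(1)[OF w, of a b] and vm = curve_measurable(2)[OF w, of b]
    note wm = square_integrable_measurable[OF w]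
    note wi = square_integrable_imp_integrable[OF w]
    obtain V0 where V0: "\<And>t. norm (?v t) \<le> V0" by (rule velocity_bounded[OF w, of b]) blast
    have dens: "integrable unit_measure (\<lambda>t. density \<sigma> (?p t) (?v t) (?v t) (w t))"
      by (rule integrable_density[OF _ pm vm vm w V0 V0]) (use \<sigma> in auto)
    have EM: "(LINT t|unit_measure. density \<sigma> (?p t) (?v t) (?v t) (w t)) \<le> M"
      using E by (simp add: curve_energy_def frozen_energy_def x)
    have Am: "?A \<in> borel_measurable unit_measure"
      by (intro borel_measurable_add wm measurable_\<Gamma> pm vm)
    have A: "(norm (?A t))\<^sup>2 \<le> density \<sigma> (?p t) (?v t) (?v t) (w t) / c" for t
    proof -
      have "c * (norm (?A t))\<^sup>2 \<le> density \<sigma> (?p t) (?v t) (?v t) (w t)"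
        using density_lower[of \<sigma> "w t" "?p t" "?v t" "?v t"] \<sigma> c_pos
        by (smt (verit) mult_nonneg_nonneg zero_le_power2)
      then show ?thesis using c_pos by (simp add: pos_le_divide_eq mult.commute)
    qed
    have v: "(norm (?v t))\<^sup>2 \<le> density \<sigma> (?p t) (?v t) (?v t) (w t) / (\<sigma> * c)" for t
    proof -
      have "\<sigma> * c * (norm (?v t))\<^sup>2 \<le> density \<sigma> (?p t) (?v t) (?v t) (w t)"
        using density_lower[of \<sigma> "w t" "?p t" "?v t" "?v t"] \<sigma> c_pos
        by (smt (verit) mult_nonneg_nonneg zero_le_power2)
      then show ?thesis using c_pos \<sigma> by (simp add: pos_le_divide_eq mult.commute)
    qed
    have Asq: "square_integrable ?A"
      by (rule square_integrable_bound[OF Am integrable_divide[OF dens] AE_I2[OF A]])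
    have vsq: "square_integrable ?v" by (rule square_integrable_primitive_velocity[OF w])
    have IA: "(LINT t|unit_measure. (norm (?A t))\<^sup>2) \<le> M / c"
    proof -
      have "(LINT t|unit_measure. (norm (?A t))\<^sup>2) \<le> (LINT t|unit_measure. density \<sigma> (?p t) (?v t) (?v t) (w t) / c)"
        by (intro integral_mono square_integrable_norm_sq[OF Asq] integrable_divide dens A)
      also have "\<dots> = (LINT t|unit_measure. density \<sigma> (?p t) (?v t) (?v t) (w t)) / c" by simp
      also have "\<dots> \<le> M / c" using EM c_pos by (intro divide_right_mono) auto
      finally show ?thesis .
    qed
    have Iv: "(LINT t|unit_measure. (norm (?v t))\<^sup>2) \<le> M1"
    proof -
      have "(LINT t|unit_measure. (norm (?v t))\<^sup>2) \<le> (LINT t|unit_measure. density \<sigma> (?p t) (?v t) (?v t) (w t) / (\<sigma> * c))"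
        by (intro integral_mono square_integrable_norm_sq[OF vsq] integrable_divide dens v)
      also have "\<dots> = (LINT t|unit_measure. density \<sigma> (?p t) (?v t) (?v t) (w t)) / (\<sigma> * c)" by simp
      also have "\<dots> \<le> M1" unfolding M1_def using EM c_pos \<sigma> by (intro divide_right_mono) auto
      finally show ?thesis .
    qed
    have \<Gamma>le: "norm (w t) \<le> norm (?A t) + K * (norm (?v t))\<^sup>2" for t
      using norm_triangle_ineq4[of "?A t" "\<Gamma> (?p t) (?v t)"] \<Gamma>_bound[of "?p t" "?v t"] by simp
    have Iw: "(LINT t|unit_measure. norm (w t)) \<le> W1"
    proof -
      have "(LINT t|unit_measure. norm (w t)) \<le> (LINT t|unit_measure. norm (?A t) + K * (norm (?v t))\<^sup>2)"
        by (intro integral_mono integrable_norm wi Bochner_Integration.integrable_add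
            square_integrable_imp_integrable[OF Asq] integrable_mult_right square_integrable_norm_sq[OF vsq] \<Gamma>le)
      also have "\<dots> = (LINT t|unit_measure. norm (?A t)) + (LINT t|unit_measure. K * (norm (?v t))\<^sup>2)"
        by (intro Bochner_Integration.integral_add integrable_norm
            square_integrable_imp_integrable[OF Asq] integrable_mult_right square_integrable_norm_sq[OF vsq])
      also have "(LINT t|unit_measure. K * (norm (?v t))\<^sup>2) = K * (LINT t|unit_measure. (norm (?v t))\<^sup>2)" by simp
      also have "\<dots> \<le> K * M1" by (intro mult_left_mono Iv nonneg)
      finally show ?thesis using integral_norm_le_integral_sq[OF Asq] IA unfolding W1_def by linarith
    qed
    \<comment> \<open>The initial velocity is compared with the velocity at every time, and the
      result is averaged.\<close>
    have b: "norm b \<le> B1"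
    proof -
      have "norm b \<le> norm (?v t) + W1" for t
        using norm_triangle_ineq4[of "?v t" "primitive w t"] norm_primitive_le[OF wi, of t] Iw
        by (simp add: primitive_velocity_def)
      then have "(LINT t|unit_measure. norm b) \<le> (LINT t|unit_measure. norm (?v t) + W1)"
        by (intro integral_mono Bochner_Integration.integrable_add integrable_norm
            square_integrable_imp_integrable[OF vsq]) auto
      also have "\<dots> = (LINT t|unit_measure. norm (?v t)) + W1"
        using integrable_norm[OF square_integrable_imp_integrable[OF vsq]] by simp
      finally have "norm b \<le> (LINT t|unit_measure. norm (?v t)) + W1" unfolding integral_unit_const .
      then show ?thesis using integral_norm_le_integral_sq[OF vsq] Iv unfolding B1_def by linarith
    qed
    have vV: "norm (?v t) \<le> V" for t
      using norm_primitive_velocity_le[OF w, of b t] b Iw unfolding V_def by linarith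
    have Iw2: "(LINT t|unit_measure. (norm (w t))\<^sup>2) \<le> 2 * (M / c) + 2 * (K * V\<^sup>2)\<^sup>2"
    proof -
      have "(norm (w t))\<^sup>2 \<le> 2 * (norm (?A t))\<^sup>2 + 2 * (K * V\<^sup>2)\<^sup>2" for t
      proof -
        have "(norm (w t))\<^sup>2 \<le> 2 * (norm (?A t))\<^sup>2 + 2 * (norm (- \<Gamma> (?p t) (?v t)))\<^sup>2"
          using norm_add_sq_le[of "?A t" "- \<Gamma> (?p t) (?v t)"] by simp
        moreover have "norm (\<Gamma> (?p t) (?v t)) \<le> K * V\<^sup>2"
          by (rule order_trans[OF \<Gamma>_bound]) (intro mult_left_mono power_mono vV nonneg norm_ge_zero)
        then have "(norm (- \<Gamma> (?p t) (?v t)))\<^sup>2 \<le> (K * V\<^sup>2)\<^sup>2" by (simp add: power_mono)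
        ultimately show ?thesis by linarith
      qed
      then have "(LINT t|unit_measure. (norm (w t))\<^sup>2) \<le> (LINT t|unit_measure. 2 * (norm (?A t))\<^sup>2 + 2 * (K * V\<^sup>2)\<^sup>2)"
        by (intro integral_mono square_integrable_norm_sq w Bochner_Integration.integrable_add integrable_mult_right
            square_integrable_norm_sq[OF Asq]) auto
      also have "\<dots> = 2 * (LINT t|unit_measure. (norm (?A t))\<^sup>2) + 2 * (K * V\<^sup>2)\<^sup>2"
        using square_integrable_norm_sq[OF Asq] by simp
      finally show ?thesis using IA by linarith
    qed
    have "norm (primitive ?v t) \<le> V"
      by (rule norm_primitive_le_bound[OF square_integrable_imp_integrable[OF vsq] vV])
    then have a: "norm a \<le> m + V"
      using pos norm_triangle_ineq4[of "?p t" "primitive ?v t"] by (simp add: primitive_curve_def x)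
    show "pair_norm_sq x w \<le> R"
      unfolding pair_norm_sq_def x R_def using power_mono[OF a norm_ge_zero, of 2] power_mono[OF b norm_ge_zero, of 2] Iw2
      by (simp add: norm_Pair)
  qed
qed

text \<open>On bounded sets of \<open>W\<^sup>2\<^sup>,\<^sup>2\<close> the coefficients may be
  evaluated along any other curve of the set at a cost proportional to the uniform distance in
  \<open>Y\<close>.\<close>

proposition frozen_energy_close:
  assumes \<sigma>: "0 \<le> \<sigma>"
  obtains B where "0 \<le> B"
    "\<And>x w x' w' \<epsilon>. square_integrable w \<Longrightarrow> square_integrable w' \<Longrightarrow>
      pair_norm_sq x w \<le> R \<Longrightarrow> pair_norm_sq x' w' \<le> R \<Longrightarrow>
      (\<And>t. 0 < t \<Longrightarrow> t < 1 \<Longrightarrow> norm (\<iota> (primitive_curve (fst x) (snd x) w t) - \<iota> (primitive_curve (fst x') (snd x') w' t)) \<le> \<epsilon>) \<Longrightarrow>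
      (\<And>t. 0 < t \<Longrightarrow> t < 1 \<Longrightarrow> norm (\<iota> (primitive_velocity (snd x) w t) - \<iota> (primitive_velocity (snd x') w' t)) \<le> \<epsilon>) \<Longrightarrow>
      \<bar>curve_energy \<sigma> x w - frozen_energy \<sigma> (primitive_curve (fst x') (snd x') w') (primitive_velocity (snd x') w')
         (primitive_velocity (snd x) w) w\<bar> \<le> B * \<epsilon>"
proof -
  obtain B where B: "0 \<le> B"
    "\<And>p u p' u' v w. norm u \<le> 2 * R + 2 \<Longrightarrow> norm u' \<le> 2 * R + 2 \<Longrightarrow> norm v \<le> 2 * R + 2 \<Longrightarrow>
      \<bar>density \<sigma> p u v w - density \<sigma> p' u' v w\<bar> \<le>
        B * (norm (\<iota> p - \<iota> p') * (1 + norm w)\<^sup>2 + norm (\<iota> u - \<iota> u') * (1 + norm w))"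
    by (rule density_lipschitz[OF \<sigma>, of "2 * R + 2"]) blast
  show ?thesis
  proof (rule that[of "B * (2 * (2 + 2 * \<bar>R\<bar>))"])
    show "0 \<le> B * (2 * (2 + 2 * \<bar>R\<bar>))" using B(1) by simp
    fix x x' :: "'v \<times> 'v" and w w' :: "real \<Rightarrow> 'v" and \<epsilon> :: real
    assume w: "square_integrable w" and w': "square_integrable w'"
      and R: "pair_norm_sq x w \<le> R" "pair_norm_sq x' w' \<le> R"
      and p: "\<And>t. 0 < t \<Longrightarrow> t < 1 \<Longrightarrow> norm (\<iota> (primitive_curve (fst x) (snd x) w t) - \<iota> (primitive_curve (fst x') (snd x') w' t)) \<le> \<epsilon>"
      and v: "\<And>t. 0 < t \<Longrightarrow> t < 1 \<Longrightarrow> norm (\<iota> (primitive_velocity (snd x) w t) - \<iota> (primitive_velocity (snd x') w' t)) \<le> \<epsilon>"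
    obtain a b a' b' where x: "x = (a, b)" "x' = (a', b')" by (cases x, cases x')
    let ?p = "primitive_curve a b w" and ?v = "primitive_velocity b w"
    let ?p' = "primitive_curve a' b' w'" and ?v' = "primitive_velocity b' w'"
    note R' = R[unfolded x]
    note vb = curve_bounds(1)[OF w R'(1)] and vb' = curve_bounds(1)[OF w' R'(2)]
    note m = curve_measurable[OF w] curve_measurable[OF w']
    have e0: "0 \<le> \<epsilon>" using order_trans[OF norm_ge_zero p[of "1/2"]] by simp
    have i1: "integrable unit_measure (\<lambda>t. density \<sigma> (?p t) (?v t) (?v t) (w t))"
      by (rule integrable_density[OF \<sigma> _ _ _ w vb vb]) (intro m)+
    have i2: "integrable unit_measure (\<lambda>t. density \<sigma> (?p' t) (?v' t) (?v t) (w t))"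
      by (rule integrable_density[OF \<sigma> _ _ _ w vb' vb]) (intro m)+
    note wn = square_integrable_one_plus_norm[OF w]
    have i3: "integrable unit_measure (\<lambda>t. (1 + norm (w t))\<^sup>2)"
      using square_integrable_norm_sq[OF wn] by simp
    have I3: "(LINT t|unit_measure. (1 + norm (w t))\<^sup>2) \<le> 2 + 2 * \<bar>R\<bar>"
    proof -
      have "(LINT t|unit_measure. (1 + norm (w t))\<^sup>2) \<le> (LINT t|unit_measure. 2 + 2 * (norm (w t))\<^sup>2)"
        using square_integrable_norm_sq[OF w] norm_add_sq_le[of "1::real" "norm (w _)"]
        by (intro integral_mono i3) (auto simp: abs_of_nonneg)
      also have "\<dots> = 2 + 2 * (LINT t|unit_measure. (norm (w t))\<^sup>2)"
        using square_integrable_norm_sq[OF w] by simp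
      also have "\<dots> \<le> 2 + 2 * \<bar>R\<bar>" using curve_bounds(3)[OF w R'(1)] by simp
      finally show ?thesis .
    qed
    have "\<bar>curve_energy \<sigma> x w - frozen_energy \<sigma> ?p' ?v' ?v w\<bar> =
        \<bar>LINT t|unit_measure. density \<sigma> (?p t) (?v t) (?v t) (w t) - density \<sigma> (?p' t) (?v' t) (?v t) (w t)\<bar>"
      unfolding curve_energy_def frozen_energy_def x using i1 i2 by simp
    also have "\<dots> \<le> (LINT t|unit_measure. \<bar>density \<sigma> (?p t) (?v t) (?v t) (w t) - density \<sigma> (?p' t) (?v' t) (?v t) (w t)\<bar>)"
      by (rule integral_abs_bound)
    also have "\<dots> \<le> (LINT t|unit_measure. B * (2 * \<epsilon>) * (1 + norm (w t))\<^sup>2)"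
    proof (rule integral_mono_AE)
      show "integrable unit_measure (\<lambda>t. \<bar>density \<sigma> (?p t) (?v t) (?v t) (w t) - density \<sigma> (?p' t) (?v' t) (?v t) (w t)\<bar>)"
        using i1 i2 by simp
      show "integrable unit_measure (\<lambda>t. B * (2 * \<epsilon>) * (1 + norm (w t))\<^sup>2)" using i3 by simp
      show "AE t in unit_measure. \<bar>density \<sigma> (?p t) (?v t) (?v t) (w t) - density \<sigma> (?p' t) (?v' t) (?v t) (w t)\<bar>
          \<le> B * (2 * \<epsilon>) * (1 + norm (w t))\<^sup>2"
        using AE_unit_mem
      proof eventually_elim
        case (elim t)
        have "\<bar>density \<sigma> (?p t) (?v t) (?v t) (w t) - density \<sigma> (?p' t) (?v' t) (?v t) (w t)\<bar>
          \<le> B * (norm (\<iota> (?p t) - \<iota> (?p' t)) * (1 + norm (w t))\<^sup>2 + norm (\<iota> (?v t) - \<iota> (?v' t)) * (1 + norm (w t)))"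
          by (rule B(2)[OF vb vb' vb])
        also have "\<dots> \<le> B * (\<epsilon> * (1 + norm (w t))\<^sup>2 + \<epsilon> * (1 + norm (w t))\<^sup>2)"
          using p[of t] v[of t] elim B(1) e0 self_le_power[of "1 + norm (w t)" 2]
          by (intro mult_left_mono add_mono mult_mono) (auto simp: x)
        finally show ?case by (simp add: algebra_simps)
      qed
    qed
    also have "\<dots> = B * (2 * \<epsilon>) * (LINT t|unit_measure. (1 + norm (w t))\<^sup>2)" by simp
    also have "\<dots> \<le> B * (2 * \<epsilon>) * (2 + 2 * \<bar>R\<bar>)" using B(1) e0 I3 by (intro mult_left_mono) auto
    finally show "\<bar>curve_energy \<sigma> x w - frozen_energy \<sigma> (primitive_curve (fst x') (snd x') w') (primitive_velocity (snd x') w')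
         (primitive_velocity (snd x) w) w\<bar> \<le> B * (2 * (2 + 2 * \<bar>R\<bar>)) * \<epsilon>"
      by (simp add: x ac_simps)
  qed
qed

lemma frozen_energy_midpoint:
  assumes \<sigma>: "0 \<le> \<sigma>" and x0: "square_integrable w0" and w: "square_integrable w" "square_integrable w'"
  shows "frozen_energy \<sigma> (primitive_curve a0 b0 w0) (primitive_velocity b0 w0)
      (primitive_velocity ((1/2) *\<^sub>R (b + b')) (\<lambda>t. (1/2) *\<^sub>R (w t + w' t))) (\<lambda>t. (1/2) *\<^sub>R (w t + w' t)) \<le>
    (frozen_energy \<sigma> (primitive_curve a0 b0 w0) (primitive_velocity b0 w0) (primitive_velocity b w) w +
     frozen_energy \<sigma> (primitive_curve a0 b0 w0) (primitive_velocity b0 w0) (primitive_velocity b' w') w') / 2"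
proof -
  have mid: "square_integrable (\<lambda>t. (1/2) *\<^sub>R (w t + w' t))"
    by (intro square_integrable_scaleR square_integrable_add w)
  have int: "integrable unit_measure (\<lambda>t. density \<sigma> (primitive_curve a0 b0 w0 t) (primitive_velocity b0 w0 t) (primitive_velocity b w t) (w t))"
    if w: "square_integrable w" for b w
  proof -
    obtain V0 V where "\<And>t. norm (primitive_velocity b0 w0 t) \<le> V0" "\<And>t. norm (primitive_velocity b w t) \<le> V"
      using velocity_bounded[OF x0] velocity_bounded[OF w] by metis
    then show ?thesis
      by (intro integrable_density[OF \<sigma> _ _ _ w, where R="max V0 V"] curve_measurable x0 w)
        (auto simp: le_max_iff_disj)
  qed
  show ?thesis
    unfolding frozen_energy_def
    using int[OF w(1), of b] int[OF w(2), of b'] int[OF mid, of "(1/2) *\<^sub>R (b + b')"]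
    by (subst Bochner_Integration.integral_add[symmetric], simp, simp, subst integral_divide_zero[symmetric])
      (intro integral_mono, simp, simp, simp only: curve_midpoint(1)[OF w], rule density_midpoint[OF \<sigma>])
qed

lemma frozen_energy_tendsto:
  assumes \<sigma>: "0 \<le> \<sigma>" and x0: "square_integrable w0"
    and z: "\<And>k. square_integrable (z k)" and w: "square_integrable w"
    and S: "integrable unit_measure S"
    and AE: "AE t in unit_measure. (\<forall>k. (norm (z k t))\<^sup>2 \<le> S t) \<and> (\<lambda>k. z k t) \<longlonglongrightarrow> w t"
    and b: "b \<longlonglongrightarrow> b'"
  shows "(\<lambda>k. frozen_energy \<sigma> (primitive_curve a0 b0 w0) (primitive_velocity b0 w0) (primitive_velocity (b k) (z k)) (z k))
    \<longlonglongrightarrow> frozen_energy \<sigma> (primitive_curve a0 b0 w0) (primitive_velocity b0 w0) (primitive_velocity b' w) w"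
proof -
  have vel: "(\<lambda>k. primitive_velocity (b k) (z k) t) \<longlonglongrightarrow> primitive_velocity b' w t" for t
    by (rule curve_tendsto(1)[where a="\<lambda>_. 0", OF z w S AE tendsto_const b])
  obtain V where V: "\<And>k t. norm (primitive_velocity (b k) (z k) t) \<le> V"
    using curve_tendsto(3)[where a="\<lambda>_. 0", OF z w S AE tendsto_const b] by blast
  obtain V0 where V0: "\<And>t. norm (primitive_velocity b0 w0 t) \<le> V0" by (rule velocity_bounded[OF x0, of b0]) blast
  define R where "R = max V V0"
  let ?B = "C * (1 + K * R\<^sup>2)\<^sup>2 + \<sigma> * C * R\<^sup>2"
  have B: "0 \<le> ?B" using nonneg \<sigma> by (intro add_nonneg_nonneg mult_nonneg_nonneg) auto
  show ?thesis
    unfolding frozen_energy_def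
  proof (rule integral_dominated_convergence[where w="\<lambda>t. ?B * (2 + 2 * S t)"])
    show "(\<lambda>t. density \<sigma> (primitive_curve a0 b0 w0 t) (primitive_velocity b0 w0 t) (primitive_velocity b' w t) (w t)) \<in> borel_measurable unit_measure"
      by (intro measurable_density curve_measurable x0 w square_integrable_measurable)
    show "(\<lambda>t. density \<sigma> (primitive_curve a0 b0 w0 t) (primitive_velocity b0 w0 t) (primitive_velocity (b k) (z k) t) (z k t)) \<in> borel_measurable unit_measure" for k
      by (intro measurable_density curve_measurable x0 z square_integrable_measurable)
    show "integrable unit_measure (\<lambda>t. ?B * (2 + 2 * S t))" using S by simp
    show "AE t in unit_measure. (\<lambda>k. density \<sigma> (primitive_curve a0 b0 w0 t) (primitive_velocity b0 w0 t) (primitive_velocity (b k) (z k) t) (z k t))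
        \<longlonglongrightarrow> density \<sigma> (primitive_curve a0 b0 w0 t) (primitive_velocity b0 w0 t) (primitive_velocity b' w t) (w t)"
      using AE by eventually_elim (intro tendsto_density tendsto_const vel, auto)
    show "AE t in unit_measure. norm (density \<sigma> (primitive_curve a0 b0 w0 t) (primitive_velocity b0 w0 t) (primitive_velocity (b k) (z k) t) (z k t))
        \<le> ?B * (2 + 2 * S t)" for k
      using AE
    proof eventually_elim
      case (elim t)
      have "density \<sigma> (primitive_curve a0 b0 w0 t) (primitive_velocity b0 w0 t) (primitive_velocity (b k) (z k) t) (z k t)
          \<le> ?B * (1 + norm (z k t))\<^sup>2"
        by (rule density_upper[OF \<sigma>]) (use V V0 in \<open>auto simp: R_def le_max_iff_disj\<close>)
      also have "\<dots> \<le> ?B * (2 + 2 * S t)"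
      proof (rule mult_left_mono[OF _ B])
        have "(1 + norm (z k t))\<^sup>2 \<le> 2 + 2 * (norm (z k t))\<^sup>2"
          using norm_add_sq_le[of "1::real" "norm (z k t)"] by (simp add: abs_of_nonneg)
        then show "(1 + norm (z k t))\<^sup>2 \<le> 2 + 2 * S t" using elim by (smt (verit))
      qed
      finally show ?case using density_nonneg[OF \<sigma>] by simp
    qed
  qed
qed

end

section \<open>Existence of minimizers\<close>

lemma pair_norm_sq_tendsto:
  assumes z: "\<And>k. square_integrable (z k)" and w: "square_integrable w"
    and S: "integrable unit_measure S"
    and AE: "AE t in unit_measure. (\<forall>k. (norm (z k t))\<^sup>2 \<le> S t) \<and> (\<lambda>k. z k t) \<longlonglongrightarrow> w t"
    and c: "c \<longlonglongrightarrow> c0"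
  shows "(\<lambda>k. pair_norm_sq (c k) (z k)) \<longlonglongrightarrow> pair_norm_sq c0 w"
  unfolding pair_norm_sq_def
proof (intro tendsto_intros c integral_dominated_convergence[OF _ _ S])
  note [measurable] = square_integrable_measurable[OF w] square_integrable_measurable[OF z]
  show "(\<lambda>t. (norm (w t))\<^sup>2) \<in> borel_measurable unit_measure" by measurable
  show "(\<lambda>t. (norm (z k t))\<^sup>2) \<in> borel_measurable unit_measure" for k by measurable
  show "AE t in unit_measure. (\<lambda>k. (norm (z k t))\<^sup>2) \<longlonglongrightarrow> (norm (w t))\<^sup>2"
    using AE by eventually_elim (intro tendsto_intros, auto)
  show "AE t in unit_measure. norm ((norm (z k t))\<^sup>2) \<le> S t" for k
    using AE by eventually_elim simp
qed

lemma norm_midpoint_le: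
  assumes "norm (x - p) \<le> e" "norm (y - p) \<le> e"
  shows "norm ((1/2) *\<^sub>R (x + y) - p) \<le> e"
proof -
  have "(1/2) *\<^sub>R ((x - p) + (y - p)) = (1/2) *\<^sub>R (x + y) - (1/2) *\<^sub>R (p + p)"
    by (simp add: scaleR_add_right scaleR_diff_right)
  then have "(1/2) *\<^sub>R (x + y) - p = (1/2) *\<^sub>R ((x - p) + (y - p))"
    by (simp only: scaleR_half_double)
  then have "norm ((1/2) *\<^sub>R (x + y) - p) = (1/2) * norm ((x - p) + (y - p))" by simp
  also have "\<dots> \<le> (1/2) * (norm (x - p) + norm (y - p))"
    by (intro mult_left_mono norm_triangle_ineq) auto
  finally show ?thesis using assms by simp
qed

context spline_metric
begin

text \<open>The direct method for an arbitrary closed convex class \<open>A\<close> of curves whose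
  position at one time is bounded. The sets \<open>D n\<close> collect the curves that are close to
  the first members of the Cauchy subsequence in \<open>Y\<close> and whose energy with coefficients
  along these members is almost minimal. They are convex although the energy is not, and a common
  point of all of them has minimal energy.\<close>

theorem curve_energy_minimizer:
  fixes A :: "(('v \<times> 'v) \<times> (real \<Rightarrow> 'v)) set"
  assumes comp: "compact_operator \<iota>" and \<sigma>: "0 < \<sigma>" and ne: "A \<noteq> {}"
    and sq: "\<And>x w. (x, w) \<in> A \<Longrightarrow> square_integrable w"
    and midpoint: "\<And>x w x' w'. (x, w) \<in> A \<Longrightarrow> (x', w') \<in> A \<Longrightarrow>
      ((1/2) *\<^sub>R (x + x'), \<lambda>t. (1/2) *\<^sub>R (w t + w' t)) \<in> A"
    and closed: "\<And>x z x0 w S. (\<And>k. (x k, z k) \<in> A) \<Longrightarrow> x \<longlonglongrightarrow> x0 \<Longrightarrow> square_integrable w \<Longrightarrow>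
      integrable unit_measure S \<Longrightarrow>
      AE t in unit_measure. (\<forall>k. (norm (z k t))\<^sup>2 \<le> S t) \<and> (\<lambda>k. z k t) \<longlonglongrightarrow> w t \<Longrightarrow> (x0, w) \<in> A"
    and anchor: "0 \<le> t0" "0 \<le> m" "\<And>x w. (x, w) \<in> A \<Longrightarrow> norm (primitive_curve (fst x) (snd x) w t0) \<le> m"
  obtains x w where "(x, w) \<in> A" "\<And>x' w'. (x', w') \<in> A \<Longrightarrow> curve_energy \<sigma> x w \<le> curve_energy \<sigma> x' w'"
proof -
  interpret \<iota>: bounded_linear \<iota> by (rule \<iota>)
  define J where "J z = curve_energy \<sigma> (fst z) (snd z)" for z :: "('v \<times> 'v) \<times> (real \<Rightarrow> 'v)"
  have bdd: "bdd_below (J ` A)"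
    by (rule bdd_belowI2[where m=0]) (use \<sigma> in \<open>simp add: J_def curve_energy_nonneg\<close>)
  define m0 where "m0 = (INF z\<in>A. J z)"
  have m0: "m0 \<le> curve_energy \<sigma> x w" if "(x, w) \<in> A" for x w
    using cINF_lower[OF bdd that] by (simp add: m0_def J_def)
  have m0_nonneg: "0 \<le> m0" unfolding m0_def
    by (rule cINF_greatest[OF ne]) (use \<sigma> in \<open>simp add: J_def curve_energy_nonneg\<close>)
  have "\<exists>z. z \<in> A \<and> J z < m0 + 1 / real (Suc k)" for k
    using cINF_less_iff[OF ne bdd, of "m0 + 1 / real (Suc k)"] unfolding m0_def by auto
  then obtain Z where Z: "\<And>k. Z k \<in> A" "\<And>k. J (Z k) < m0 + 1 / real (Suc k)" by metis
  obtain R where R: "\<And>x w t. square_integrable w \<Longrightarrow> curve_energy \<sigma> x w \<le> m0 + 1 \<Longrightarrow> 0 \<le> t \<Longrightarrow>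
    norm (primitive_curve (fst x) (snd x) w t) \<le> m \<Longrightarrow> pair_norm_sq x w \<le> R"
    by (rule curve_energy_coercive[OF \<sigma> _ anchor(2), of "m0 + 1"]) (use m0_nonneg in auto)
  define x w where "x k = fst (Z k)" and "w k = snd (Z k)" for k
  have xA: "(x k, w k) \<in> A" for k using Z(1)[of k] by (simp add: x_def w_def)
  have wsq: "square_integrable (w k)" for k by (rule sq[OF xA])
  have xE: "curve_energy \<sigma> (x k) (w k) < m0 + 1 / real (Suc k)" for k
    using Z(2)[of k] by (simp add: J_def x_def w_def)
  have xR: "pair_norm_sq (x k) (w k) \<le> R" for k
  proof (rule R[OF wsq _ anchor(1) anchor(3)[OF xA]])
    have "1 / real (Suc k) \<le> 1" by simp
    then show "curve_energy \<sigma> (x k) (w k) \<le> m0 + 1" using xE[of k] by linarith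
  qed
  have xR': "pair_norm_sq (fst (x k), snd (x k)) (w k) \<le> R" for k using xR by simp
  have R0: "0 \<le> R" using order_trans[OF pair_norm_sq_nonneg xR] .
  define P V where "P k = primitive_curve (fst (x k)) (snd (x k)) (w k)" and "V k = primitive_velocity (snd (x k)) (w k)" for k
  obtain N where N: "0 < N" "\<And>v. norm (\<iota> v) \<le> norm v * N" using \<iota>.pos_bounded by blast
  define Q where "Q = closure (\<iota> ` cball 0 (3 * R + 3))"
  have Q: "compact Q" using comp unfolding compact_operator_def Q_def by blast
  define X where "X k t = (\<iota> (P k t), \<iota> (V k t))" for k t
  have XQ: "X k t \<in> Q \<times> Q" for k t
  proof -
    have "P k t \<in> cball 0 (3 * R + 3)"
      using curve_bounds(2)[OF wsq xR'] by (simp add: P_def)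
    moreover have "V k t \<in> cball 0 (3 * R + 3)"
      using order_trans[OF curve_bounds(1)[OF wsq xR', where t=t], of "3 * R + 3"] R0 by (simp add: V_def)
    ultimately show ?thesis unfolding X_def Q_def
      by (intro SigmaI subsetD[OF closure_subset] imageI)
  qed
  have XH: "dist (X k s) (X k t) \<le> (2 * N * (2 * R + 2)) * sqrt \<bar>s - t\<bar>" if "s \<in> {0..1}" "t \<in> {0..1}" for k s t
  proof -
    have d: "dist (\<iota> u) (\<iota> v) \<le> N * (2 * R + 2) * sqrt \<bar>s - t\<bar>" if "norm (u - v) \<le> (2 * R + 2) * sqrt \<bar>s - t\<bar>" for u v
    proof -
      have "dist (\<iota> u) (\<iota> v) \<le> norm (u - v) * N" using N(2)[of "u - v"] by (simp add: dist_norm \<iota>.diff)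
      also have "\<dots> \<le> (2 * R + 2) * sqrt \<bar>s - t\<bar> * N" using that N(1) by (intro mult_right_mono) auto
      finally show ?thesis by (simp add: ac_simps)
    qed
    have "dist (X k s) (X k t) \<le> dist (\<iota> (P k s)) (\<iota> (P k t)) + dist (\<iota> (V k s)) (\<iota> (V k t))"
      unfolding X_def dist_Pair_Pair by (rule sqrt_sum_squares_le_sum) auto
    also have "\<dots> \<le> N * (2 * R + 2) * sqrt \<bar>s - t\<bar> + N * (2 * R + 2) * sqrt \<bar>s - t\<bar>"
      by (intro add_mono d) (use curve_bounds(4,5)[OF wsq xR' that] in \<open>auto simp: P_def V_def\<close>)
    finally show ?thesis by (simp add: algebra_simps)
  qed
  obtain r :: "nat \<Rightarrow> nat" where r: "strict_mono r"
    "\<And>j k t. j \<le> k \<Longrightarrow> t \<in> {0..1} \<Longrightarrow> dist (X (r k) t) (X (r j) t) \<le> 1 / real (Suc j)"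
    by (rule uniformly_Cauchy_subsequence[of "Q \<times> Q" X, OF compact_Times[OF Q Q] XQ XH]) auto
  have Pr: "norm (\<iota> (P (r k) t) - \<iota> (P (r j) t)) \<le> 1 / real (Suc j)"
    and Vr: "norm (\<iota> (V (r k) t) - \<iota> (V (r j) t)) \<le> 1 / real (Suc j)" if "j \<le> k" "0 < t" "t < 1" for j k t
    using r(2)[of j k t] that dist_fst_le[of "X (r k) t" "X (r j) t"] dist_snd_le[of "X (r k) t" "X (r j) t"]
    by (auto simp: X_def dist_norm)
  obtain B where B: "0 \<le> B"
    "\<And>x w x' w' \<epsilon>. square_integrable w \<Longrightarrow> square_integrable w' \<Longrightarrow>
      pair_norm_sq x w \<le> R \<Longrightarrow> pair_norm_sq x' w' \<le> R \<Longrightarrow>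
      (\<And>t. 0 < t \<Longrightarrow> t < 1 \<Longrightarrow> norm (\<iota> (primitive_curve (fst x) (snd x) w t) - \<iota> (primitive_curve (fst x') (snd x') w' t)) \<le> \<epsilon>) \<Longrightarrow>
      (\<And>t. 0 < t \<Longrightarrow> t < 1 \<Longrightarrow> norm (\<iota> (primitive_velocity (snd x) w t) - \<iota> (primitive_velocity (snd x') w' t)) \<le> \<epsilon>) \<Longrightarrow>
      \<bar>curve_energy \<sigma> x w - frozen_energy \<sigma> (primitive_curve (fst x') (snd x') w') (primitive_velocity (snd x') w')
         (primitive_velocity (snd x) w) w\<bar> \<le> B * \<epsilon>"
    by (rule frozen_energy_close[OF less_imp_le[OF \<sigma>], of R]) blast
  define G where "G j y u = frozen_energy \<sigma> (P (r j)) (V (r j)) (primitive_velocity (snd y) u) u" for j and y :: "'v \<times> 'v" and u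
  \<comment> \<open>The bound on \<open>G\<close> allows for the defect of the minimizing sequence
    and for the error of changing the coefficients.\<close>
  define near where "near j y u \<longleftrightarrow>
      (\<forall>t. 0 < t \<longrightarrow> t < 1 \<longrightarrow> norm (\<iota> (primitive_curve (fst y) (snd y) u t) - \<iota> (P (r j) t)) \<le> 1 / real (Suc j)) \<and>
      (\<forall>t. 0 < t \<longrightarrow> t < 1 \<longrightarrow> norm (\<iota> (primitive_velocity (snd y) u t) - \<iota> (V (r j) t)) \<le> 1 / real (Suc j)) \<and>
      G j y u \<le> m0 + (1 + B) / real (Suc j)" for j y u
  have close: "\<bar>curve_energy \<sigma> y u - G j y u\<bar> \<le> B / real (Suc j)"
    if "square_integrable u" "pair_norm_sq y u \<le> R"
      "\<And>t. 0 < t \<Longrightarrow> t < 1 \<Longrightarrow> norm (\<iota> (primitive_curve (fst y) (snd y) u t) - \<iota> (P (r j) t)) \<le> 1 / real (Suc j)"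
      "\<And>t. 0 < t \<Longrightarrow> t < 1 \<Longrightarrow> norm (\<iota> (primitive_velocity (snd y) u t) - \<iota> (V (r j) t)) \<le> 1 / real (Suc j)" for j y u
    using B(2)[OF that(1) wsq that(2) xR that(3)[unfolded P_def] that(4)[unfolded V_def]]
    unfolding G_def P_def V_def by simp
  define D where "D n = {(y, u). (y, u) \<in> A \<and> pair_norm_sq y u \<le> R \<and> (\<forall>j\<le>n. near j y u)}" for n
  have DA: "(y, u) \<in> A" "pair_norm_sq y u \<le> R" "\<And>j. j \<le> n \<Longrightarrow> near j y u" if "(y, u) \<in> D n" for y u n
    using that by (auto simp: D_def)
  have near_mid: "near j ((1/2) *\<^sub>R (y + y')) (\<lambda>t. (1/2) *\<^sub>R (u t + u' t))"
    if u: "square_integrable u" "square_integrable u'" and n: "near j y u" "near j y' u'" for j y y' u u'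
  proof -
    obtain a b a' b' where y: "y = (a, b)" "y' = (a', b')" by (cases y, cases y')
    have mid: "\<iota> ((1/2) *\<^sub>R (p + q)) = (1/2) *\<^sub>R (\<iota> p + \<iota> q)" for p q by (simp add: \<iota>.add \<iota>.scaleR)
    show ?thesis
      unfolding near_def
    proof (intro conjI allI impI)
      fix t :: real assume t: "0 < t" "t < 1"
      show "norm (\<iota> (primitive_curve (fst ((1/2) *\<^sub>R (y + y'))) (snd ((1/2) *\<^sub>R (y + y'))) (\<lambda>t. (1/2) *\<^sub>R (u t + u' t)) t)
          - \<iota> (P (r j) t)) \<le> 1 / real (Suc j)"
        unfolding y fst_scaleR snd_scaleR fst_add snd_add fst_conv snd_conv curve_midpoint(2)[OF u] mid
        by (rule norm_midpoint_le) (use n t in \<open>auto simp: near_def y\<close>)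
      show "norm (\<iota> (primitive_velocity (snd ((1/2) *\<^sub>R (y + y'))) (\<lambda>t. (1/2) *\<^sub>R (u t + u' t)) t)
          - \<iota> (V (r j) t)) \<le> 1 / real (Suc j)"
        unfolding y fst_scaleR snd_scaleR fst_add snd_add fst_conv snd_conv curve_midpoint(1)[OF u] mid
        by (rule norm_midpoint_le) (use n t in \<open>auto simp: near_def y\<close>)
    next
      have "G j ((1/2) *\<^sub>R (y + y')) (\<lambda>t. (1/2) *\<^sub>R (u t + u' t)) \<le> (G j y u + G j y' u') / 2"
        unfolding G_def P_def V_def snd_scaleR snd_add
        by (rule frozen_energy_midpoint[OF less_imp_le[OF \<sigma>] wsq u])
      then show "G j ((1/2) *\<^sub>R (y + y')) (\<lambda>t. (1/2) *\<^sub>R (u t + u' t)) \<le> m0 + (1 + B) / real (Suc j)"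
      proof -
        have "G j y u \<le> m0 + (1 + B) / real (Suc j)" "G j y' u' \<le> m0 + (1 + B) / real (Suc j)"
          using n unfolding near_def by blast+
        then show ?thesis
          using \<open>G j ((1/2) *\<^sub>R (y + y')) (\<lambda>t. (1/2) *\<^sub>R (u t + u' t)) \<le> (G j y u + G j y' u') / 2\<close>
          by argo
      qed
    qed
  qed
  obtain y u where yu: "\<And>n. (y, u) \<in> D n"
  proof (rule decreasing_convex_sets_intersect[of D R])
    show "square_integrable u" if "(y, u) \<in> D n" for n y u by (rule sq[OF DA(1)[OF that]])
    show "D n \<subseteq> D k" if "k \<le> n" for k n using that by (auto simp: D_def)
    show "\<exists>y u. (y, u) \<in> D n \<and> pair_norm_sq y u \<le> R" for n
    proof (intro exI conjI)
      show "pair_norm_sq (x (r n)) (w (r n)) \<le> R" by (rule xR)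
      have "near j (x (r n)) (w (r n))" if j: "j \<le> n" for j
      proof -
        have "\<bar>curve_energy \<sigma> (x (r n)) (w (r n)) - G j (x (r n)) (w (r n))\<bar> \<le> B / real (Suc j)"
          by (rule close[OF wsq xR]) (use Pr[OF j] Vr[OF j] in \<open>auto simp: P_def V_def\<close>)
        moreover have "1 / real (Suc (r n)) \<le> 1 / real (Suc j)"
          using strict_mono_imp_increasing[OF r(1), of n] j by (intro divide_left_mono) auto
        ultimately have "G j (x (r n)) (w (r n)) \<le> m0 + 1 / real (Suc j) + B / real (Suc j)"
          using xE[of "r n"] by linarith
        then have "G j (x (r n)) (w (r n)) \<le> m0 + (1 + B) / real (Suc j)"
          by (simp add: add_divide_distrib)
        with Pr[OF j] Vr[OF j] show ?thesis unfolding near_def by (auto simp: P_def V_def)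
      qed
      then show "(x (r n), w (r n)) \<in> D n" using xA xR by (auto simp: D_def)
    qed
    show "((1/2) *\<^sub>R (y + y'), \<lambda>t. (1/2) *\<^sub>R (u t + u' t)) \<in> D n"
      if d: "(y, u) \<in> D n" "(y', u') \<in> D n" for n y u y' u'
    proof -
      note us = sq[OF DA(1)[OF d(1)]] sq[OF DA(1)[OF d(2)]]
      have "pair_norm_sq ((1/2) *\<^sub>R (y + y')) (\<lambda>t. (1/2) *\<^sub>R (u t + u' t)) \<le> R"
        using pair_norm_sq_parallelogram[OF us, of y y'] DA(2)[OF d(1)] DA(2)[OF d(2)]
          pair_norm_sq_nonneg[of "y - y'" "\<lambda>t. u t - u' t"] by linarith
      moreover have "near j ((1/2) *\<^sub>R (y + y')) (\<lambda>t. (1/2) *\<^sub>R (u t + u' t))" if "j \<le> n" for j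
        by (rule near_mid[OF us DA(3)[OF d(1) that] DA(3)[OF d(2) that]])
      ultimately show ?thesis using midpoint[OF DA(1)[OF d(1)] DA(1)[OF d(2)]] by (auto simp: D_def)
    qed
    show "(y0, u0) \<in> D n" if d: "\<And>k. (y k, u k) \<in> D n" and y: "y \<longlonglongrightarrow> y0" and u0: "square_integrable u0"
      and S: "integrable unit_measure S"
      and AE: "AE t in unit_measure. (\<forall>k. (norm (u k t))\<^sup>2 \<le> S t) \<and> (\<lambda>k. u k t) \<longlonglongrightarrow> u0 t" for n y u y0 u0 S
    proof -
      note us = sq[OF DA(1)[OF d]]
      have fs: "(\<lambda>k. fst (y k)) \<longlonglongrightarrow> fst y0" "(\<lambda>k. snd (y k)) \<longlonglongrightarrow> snd y0"
        using y by (auto intro: tendsto_fst tendsto_snd)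
      have "(y0, u0) \<in> A" by (rule closed[OF DA(1)[OF d] y u0 S AE])
      moreover have "pair_norm_sq y0 u0 \<le> R"
        by (rule LIMSEQ_le_const2[OF pair_norm_sq_tendsto[OF us u0 S AE y]]) (use DA(2)[OF d] in blast)
      moreover have "near j y0 u0" if j: "j \<le> n" for j
        unfolding near_def
      proof (intro conjI allI impI)
        note nk = DA(3)[OF d j, unfolded near_def]
        fix t :: real assume t: "0 < t" "t < 1"
        have "(\<lambda>k. norm (\<iota> (primitive_curve (fst (y k)) (snd (y k)) (u k) t) - \<iota> (P (r j) t)))
           \<longlonglongrightarrow> norm (\<iota> (primitive_curve (fst y0) (snd y0) u0 t) - \<iota> (P (r j) t))"
          by (intro tendsto_intros \<iota>.tendsto curve_tendsto(2)[OF us u0 S AE fs])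
        then show "norm (\<iota> (primitive_curve (fst y0) (snd y0) u0 t) - \<iota> (P (r j) t)) \<le> 1 / real (Suc j)"
          by (rule LIMSEQ_le_const2) (use nk t in blast)
        have "(\<lambda>k. norm (\<iota> (primitive_velocity (snd (y k)) (u k) t) - \<iota> (V (r j) t)))
           \<longlonglongrightarrow> norm (\<iota> (primitive_velocity (snd y0) u0 t) - \<iota> (V (r j) t))"
          by (intro tendsto_intros \<iota>.tendsto curve_tendsto(1)[OF us u0 S AE fs])
        then show "norm (\<iota> (primitive_velocity (snd y0) u0 t) - \<iota> (V (r j) t)) \<le> 1 / real (Suc j)"
          by (rule LIMSEQ_le_const2) (use nk t in blast)
      next
        note nk = DA(3)[OF d j, unfolded near_def]
        have "(\<lambda>k. G j (y k) (u k)) \<longlonglongrightarrow> G j y0 u0"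
          unfolding G_def P_def V_def
          by (rule frozen_energy_tendsto[OF less_imp_le[OF \<sigma>] wsq us u0 S AE fs(2)])
        then show "G j y0 u0 \<le> m0 + (1 + B) / real (Suc j)"
          by (rule LIMSEQ_le_const2) (use nk in blast)
      qed
      ultimately show ?thesis by (auto simp: D_def)
    qed
  qed blast
  have yA: "(y, u) \<in> A" by (rule DA(1)[OF yu[of 0]])
  have "curve_energy \<sigma> y u \<le> m0"
  proof (rule LIMSEQ_le_const)
    have "(\<lambda>j. m0 + (1 + 2 * B) * (1 / real (Suc j))) \<longlonglongrightarrow> m0 + (1 + 2 * B) * 0"
      by (intro tendsto_intros LIMSEQ_Suc[OF lim_1_over_n])
    then show "(\<lambda>j. m0 + (1 + 2 * B) * (1 / real (Suc j))) \<longlonglongrightarrow> m0" by simp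
    have "curve_energy \<sigma> y u \<le> m0 + (1 + 2 * B) * (1 / real (Suc j))" for j
    proof -
      have n: "near j y u" by (rule DA(3)[OF yu[of j] order_refl])
      have "\<bar>curve_energy \<sigma> y u - G j y u\<bar> \<le> B / real (Suc j)"
        by (rule close[OF sq[OF yA] DA(2)[OF yu[of 0]]]) (use n in \<open>auto simp: near_def\<close>)
      moreover have "G j y u \<le> m0 + (1 + B) / real (Suc j)" using n by (simp add: near_def)
      moreover have "(1 + 2 * B) * (1 / real (Suc j)) = (1 + B) / real (Suc j) + B / real (Suc j)"
        by (simp add: add_divide_distrib)
      ultimately show ?thesis by linarith
    qed
    then show "\<exists>N. \<forall>j\<ge>N. curve_energy \<sigma> y u \<le> m0 + (1 + 2 * B) * (1 / real (Suc j))" by blast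
  qed
  then have "curve_energy \<sigma> y u \<le> curve_energy \<sigma> x' w'" if "(x', w') \<in> A" for x' w'
    using m0[OF that] by linarith
  with yA show ?thesis by (rule that)
qed

end

section \<open>Hoelder continuity from averages\<close>

lemma primitive_indicator:
  assumes "0 \<le> s" "s \<le> u" "u \<le> 1" "r \<in> {0..1}"
  shows "primitive (indicat_real {s<..u}) r = max 0 (min r u - s)"
proof -
  have "primitive (indicat_real {s<..u}) r = (LINT x|unit_measure. indicat_real {s<..max s (min r u)} x)"
    unfolding primitive_def by (rule Bochner_Integration.integral_cong) (auto simp: indicator_def)
  also have "\<dots> = max s (min r u) - s" by (rule measure_unit_Ioc) (use assms in auto)
  finally show ?thesis by auto
qed

text \<open>If the averages of a function over intervals depend Hoelder continuously on the
  intervals, then the function has a Hoelder representative, to which the averages converge. Here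
  \<open>P\<close> plays the part of a primitive of the function, and its difference quotients that
  of the averages.\<close>

proposition derivative_from_averages:
  fixes P :: "real \<Rightarrow> 'v::banach"
  assumes bound: "\<And>s t d e. 0 \<le> s \<Longrightarrow> 0 < d \<Longrightarrow> s + d \<le> 1 \<Longrightarrow> 0 \<le> t \<Longrightarrow> 0 < e \<Longrightarrow> t + e \<le> 1 \<Longrightarrow>
      norm ((1 / d) *\<^sub>R (P (s + d) - P s) - (1 / e) *\<^sub>R (P (t + e) - P t)) \<le> H * sqrt (\<bar>s - t\<bar> + d + e)"
  obtains p where "\<And>s t. s \<in> {0..1} \<Longrightarrow> t \<in> {0..1} \<Longrightarrow> norm (p s - p t) \<le> H * sqrt \<bar>s - t\<bar>"
    "\<And>t. 0 < t \<Longrightarrow> t < 1 \<Longrightarrow> (P has_vector_derivative p t) (at t)"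
proof -
  define A where "A d s = (1 / d) *\<^sub>R (P (s + d) - P s)" for d s
  define e where "e n = 1 / real (n + 2)" for n :: nat
  \<comment> \<open>The interval from \<open>\<tau> n t\<close> to \<open>\<tau> n t + e n\<close>
    contains \<open>t\<close> and stays inside the unit interval, also for end points
    \<open>t\<close>.\<close>
  define \<tau> where "\<tau> n t = t * (1 - e n)" for n t
  have e: "0 < e n" "e n \<le> 1" for n by (auto simp: e_def)
  have e0: "e \<longlonglongrightarrow> 0" unfolding e_def by (rule LIMSEQ_ignore_initial_segment[OF lim_1_over_n])
  have \<tau>: "0 \<le> \<tau> n t" "\<tau> n t + e n \<le> 1" "\<bar>\<tau> n t - t\<bar> \<le> e n" if "t \<in> {0..1}" for n t
  proof -
    show "0 \<le> \<tau> n t" using that e[of n] by (simp add: \<tau>_def)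
    have "t * (1 - e n) \<le> 1 * (1 - e n)" using that e[of n] by (intro mult_right_mono) auto
    then show "\<tau> n t + e n \<le> 1" by (simp add: \<tau>_def)
    have "t * e n \<le> 1 * e n" using that e[of n] by (intro mult_right_mono) auto
    moreover have "0 \<le> t * e n" using that e[of n] by auto
    ultimately show "\<bar>\<tau> n t - t\<bar> \<le> e n" by (simp add: \<tau>_def algebra_simps)
  qed
  have \<tau>0: "(\<lambda>n. \<tau> n t) \<longlonglongrightarrow> t" for t
    using tendsto_mult[OF tendsto_const[of t] tendsto_diff[OF tendsto_const[of 1] e0]] by (simp add: \<tau>_def)
  have H: "0 \<le> H"
  proof -
    have "0 \<le> H * sqrt (\<bar>0 - 0\<bar> + 1 + 1)" by (rule order_trans[OF norm_ge_zero bound]) auto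
    then show ?thesis by (simp add: zero_le_mult_iff)
  qed
  have bd: "norm (A d s - A (e n) (\<tau> n t)) \<le> H * sqrt (\<bar>s - \<tau> n t\<bar> + d + e n)"
    if "0 \<le> s" "0 < d" "s + d \<le> 1" "t \<in> {0..1}" for s d t n
    unfolding A_def by (rule bound) (use that \<tau> e in auto)
  have "convergent (\<lambda>n. A (e n) (\<tau> n t))" if t: "t \<in> {0..1}" for t
  proof -
    have "Cauchy (\<lambda>n. A (e n) (\<tau> n t))"
    proof (rule CauchyI)
      fix \<epsilon> :: real assume \<epsilon>: "0 < \<epsilon>"
      have "(\<lambda>n. H * sqrt (4 * e n)) \<longlonglongrightarrow> H * sqrt (4 * 0)" by (intro tendsto_intros e0)
      then have "\<forall>\<^sub>F n in sequentially. H * sqrt (4 * e n) < \<epsilon>"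
        using \<epsilon> by (intro order_tendstoD(2)) auto
      then obtain N where N: "H * sqrt (4 * e N) < \<epsilon>" by (auto simp: eventually_sequentially)
      have en: "e n \<le> e N" if "N \<le> n" for n using that by (auto simp: e_def intro!: divide_left_mono)
      show "\<exists>M. \<forall>m\<ge>M. \<forall>n\<ge>M. norm (A (e m) (\<tau> m t) - A (e n) (\<tau> n t)) < \<epsilon>"
      proof (intro exI[of _ N] allI impI)
        fix m n assume mn: "N \<le> m" "N \<le> n"
        have "norm (A (e m) (\<tau> m t) - A (e n) (\<tau> n t)) \<le> H * sqrt (\<bar>\<tau> m t - \<tau> n t\<bar> + e m + e n)"
          by (rule bd) (use \<tau> t e in auto)
        also have "\<dots> \<le> H * sqrt (4 * e N)"
          using \<tau>(3)[OF t, of m] \<tau>(3)[OF t, of n] en[OF mn(1)] en[OF mn(2)]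
          by (intro mult_left_mono real_sqrt_le_mono H) linarith
        finally show "norm (A (e m) (\<tau> m t) - A (e n) (\<tau> n t)) < \<epsilon>" using N by linarith
      qed
    qed
    then show ?thesis by (rule Cauchy_convergent)
  qed
  then obtain p where p: "\<And>t. t \<in> {0..1} \<Longrightarrow> (\<lambda>n. A (e n) (\<tau> n t)) \<longlonglongrightarrow> p t"
    unfolding convergent_def by metis
  have near: "norm (A d s - p t) \<le> H * sqrt (\<bar>s - t\<bar> + d)"
    if s: "0 \<le> s" "0 < d" "s + d \<le> 1" and t: "t \<in> {0..1}" for s d t
  proof (rule LIMSEQ_le)
    show "(\<lambda>n. norm (A d s - A (e n) (\<tau> n t))) \<longlonglongrightarrow> norm (A d s - p t)"
      by (intro tendsto_intros p t)
    have "(\<lambda>n. H * sqrt (\<bar>s - \<tau> n t\<bar> + d + e n)) \<longlonglongrightarrow> H * sqrt (\<bar>s - t\<bar> + d + 0)"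
      by (intro tendsto_intros e0 \<tau>0)
    then show "(\<lambda>n. H * sqrt (\<bar>s - \<tau> n t\<bar> + d + e n)) \<longlonglongrightarrow> H * sqrt (\<bar>s - t\<bar> + d)" by simp
    show "\<exists>N. \<forall>n\<ge>N. norm (A d s - A (e n) (\<tau> n t)) \<le> H * sqrt (\<bar>s - \<tau> n t\<bar> + d + e n)"
      using bd[OF s t] by blast
  qed
  show ?thesis
  proof (rule that[of p])
    fix s t :: real assume s: "s \<in> {0..1}" and t: "t \<in> {0..1}"
    show "norm (p s - p t) \<le> H * sqrt \<bar>s - t\<bar>"
    proof (rule LIMSEQ_le)
      show "(\<lambda>n. norm (A (e n) (\<tau> n s) - p t)) \<longlonglongrightarrow> norm (p s - p t)"
        by (intro tendsto_intros p s)
      have "(\<lambda>n. H * sqrt (\<bar>\<tau> n s - t\<bar> + e n)) \<longlonglongrightarrow> H * sqrt (\<bar>s - t\<bar> + 0)"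
        by (intro tendsto_intros e0 \<tau>0)
      then show "(\<lambda>n. H * sqrt (\<bar>\<tau> n s - t\<bar> + e n)) \<longlonglongrightarrow> H * sqrt \<bar>s - t\<bar>" by simp
      show "\<exists>N. \<forall>n\<ge>N. norm (A (e n) (\<tau> n s) - p t) \<le> H * sqrt (\<bar>\<tau> n s - t\<bar> + e n)"
        using near[OF \<tau>(1)[OF s] e(1) \<tau>(2)[OF s] t] by blast
    qed
  next
    fix t :: real assume t: "0 < t" "t < 1"
    show "(P has_vector_derivative p t) (at t)"
      unfolding has_vector_derivative_def has_derivative_at_alt
    proof (intro conjI allI impI)
      show "bounded_linear (\<lambda>h. h *\<^sub>R p t)" by (rule bounded_linear_scaleR_left)
      fix \<epsilon> :: real assume \<epsilon>: "0 < \<epsilon>"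
      define d where "d = min (min t (1 - t)) ((\<epsilon> / (H + 1))\<^sup>2 / 2)"
      have d: "0 < d" using t \<epsilon> H by (auto simp: d_def)
      have small: "H * sqrt (2 * h) \<le> \<epsilon>" if "0 \<le> h" "h < d" for h
      proof -
        have "2 * h \<le> (\<epsilon> / (H + 1))\<^sup>2" using that by (simp add: d_def)
        then have "sqrt (2 * h) \<le> \<epsilon> / (H + 1)" using \<epsilon> H by (intro real_le_lsqrt) auto
        then have "H * sqrt (2 * h) \<le> H * (\<epsilon> / (H + 1))" using H by (intro mult_left_mono)
        also have "\<dots> \<le> \<epsilon>" using H \<epsilon> by (simp add: field_simps)
        finally show ?thesis .
      qed
      have est: "norm (P (s + h) - P s - h *\<^sub>R p t) \<le> \<epsilon> * h"
        if s: "0 \<le> s" "0 < h" "s + h \<le> 1" "h < d" "\<bar>s - t\<bar> \<le> h" for s h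
      proof -
        have "norm (A h s - p t) \<le> H * sqrt (\<bar>s - t\<bar> + h)" by (rule near) (use s t in auto)
        also have "\<dots> \<le> H * sqrt (2 * h)" using s H by (intro mult_left_mono real_sqrt_le_mono) auto
        also have "\<dots> \<le> \<epsilon>" by (rule small) (use s in auto)
        finally have "h * norm (A h s - p t) \<le> h * \<epsilon>" using s by (intro mult_left_mono) auto
        moreover have "P (s + h) - P s - h *\<^sub>R p t = h *\<^sub>R (A h s - p t)"
          using s by (simp add: A_def scaleR_diff_right)
        ultimately show ?thesis using s by (simp add: mult.commute)
      qed
      show "\<exists>d>0. \<forall>y. norm (y - t) < d \<longrightarrow> norm (P y - P t - (y - t) *\<^sub>R p t) \<le> \<epsilon> * norm (y - t)"
      proof (intro exI[of _ d] conjI allI impI d)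
        fix y :: real assume y: "norm (y - t) < d"
        then have y01: "0 \<le> y" "y \<le> 1" by (auto simp: d_def abs_if split: if_splits)
        consider "y = t" | "t < y" | "y < t" by linarith
        then show "norm (P y - P t - (y - t) *\<^sub>R p t) \<le> \<epsilon> * norm (y - t)"
        proof cases
          case 1
          then show ?thesis by simp
        next
          case 2
          then show ?thesis using est[of t "y - t"] y y01 t by simp
        next
          case 3
          have "norm (P t - P y - (t - y) *\<^sub>R p t) \<le> \<epsilon> * (t - y)"
            using est[of y "t - y"] y y01 t 3 by simp
          moreover have "norm (P y - P t - (y - t) *\<^sub>R p t) = norm (P t - P y - (t - y) *\<^sub>R p t)"
            by (subst norm_minus_cancel[symmetric]) (simp add: algebra_simps)
          ultimately show ?thesis using 3 by simp
        qed
      qed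
    qed
  qed
qed

lemma Hoelder_imp_continuous_on:
  fixes p :: "real \<Rightarrow> 'v::real_normed_vector"
  assumes p: "\<And>s t. s \<in> {0..1} \<Longrightarrow> t \<in> {0..1} \<Longrightarrow> norm (p s - p t) \<le> H * sqrt \<bar>s - t\<bar>"
  shows "continuous_on {0..1} p"
  unfolding continuous_on_def
proof
  fix t :: real assume t: "t \<in> {0..1}"
  have "((\<lambda>s. p s - p t) \<longlongrightarrow> 0) (at t within {0..1})"
  proof (rule Lim_null_comparison)
    show "\<forall>\<^sub>F s in at t within {0..1}. norm (p s - p t) \<le> H * sqrt \<bar>s - t\<bar>"
      using p t by (auto simp: eventually_at_filter)
    have "((\<lambda>s. H * sqrt \<bar>s - t\<bar>) \<longlongrightarrow> H * sqrt \<bar>t - t\<bar>) (at t within {0..1})"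
      by (intro tendsto_intros)
    then show "((\<lambda>s. H * sqrt \<bar>s - t\<bar>) \<longlongrightarrow> 0) (at t within {0..1})" by simp
  qed
  then show "(p \<longlongrightarrow> p t) (at t within {0..1})" by (simp add: LIM_zero_iff)
qed

lemma primitive_eq_imp_AE_eq:
  fixes u w :: "real \<Rightarrow> 'v::{banach, second_countable_topology}"
  assumes u: "integrable unit_measure u" and w: "integrable unit_measure w"
    and eq: "\<And>t. t \<in> {0..1} \<Longrightarrow> primitive u t = primitive w t"
  shows "AE t in unit_measure. u t = w t"
proof -
  have "AE t in unit_measure. u t - w t = 0"
  proof (rule AE_zero_if_interval_integrals_zero)
    show uw: "integrable unit_measure (\<lambda>t. u t - w t)" using u w by simp
    fix a b :: real assume ab: "0 < a" "a < b" "b < 1"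
    have "(LINT t|unit_measure. indicat_real {a<..<b} t *\<^sub>R (u t - w t)) = (LINT t|unit_measure. indicat_real {a<..b} t *\<^sub>R (u t - w t))"
    proof (rule integral_cong_AE)
      show "AE t in unit_measure. indicat_real {a<..<b} t *\<^sub>R (u t - w t) = indicat_real {a<..b} t *\<^sub>R (u t - w t)"
        using AE_unit_neq[of b] by eventually_elim (auto simp: indicator_def)
    qed (intro borel_measurable_integrable integrable_unit_indicator uw; simp)+
    also have "\<dots> = (LINT t|unit_measure. indicat_real {a<..b} t *\<^sub>R u t) - (LINT t|unit_measure. indicat_real {a<..b} t *\<^sub>R w t)"
      unfolding scaleR_diff_right
      by (rule Bochner_Integration.integral_diff) (intro integrable_unit_indicator u w; simp)+
    also have "\<dots> = (primitive u b - primitive u a) - (primitive w b - primitive w a)"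
      using ab by (simp add: primitive_diff u w)
    also have "\<dots> = 0" using eq[of a] eq[of b] ab by simp
    finally show "(LINT t|unit_measure. indicat_real {a<..<b} t *\<^sub>R (u t - w t)) = 0" .
  qed
  then show ?thesis by eventually_elim simp
qed

text \<open>The hypothesis says that \<open>m\<close> has a square integrable weak derivative. It is
  tested with the difference \<open>h\<close> of two averaging kernels, whose primitive has absolute
  value at most one and vanishes outside the smallest interval that contains both supports. So
  \<open>derivative_from_averages\<close> applies to the primitive of \<open>m\<close>.\<close>

proposition Hoelder_representative:
  fixes m :: "real \<Rightarrow> 'v::{banach, second_countable_topology}"
  assumes m: "square_integrable m"
    and weak: "\<And>h. square_integrable h \<Longrightarrow> bounded (range h) \<Longrightarrow> primitive h 1 = 0 \<Longrightarrow>
      norm (LINT t|unit_measure. h t *\<^sub>R m t) \<le> H * sqrt (LINT t|unit_measure. (primitive h t)\<^sup>2)"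
    and H: "0 \<le> H"
  obtains p where "\<And>s t. s \<in> {0..1} \<Longrightarrow> t \<in> {0..1} \<Longrightarrow> norm (p s - p t) \<le> H * sqrt \<bar>s - t\<bar>"
    "AE t in unit_measure. m t = p t"
proof -
  note mi = square_integrable_imp_integrable[OF m]
  have "norm ((1 / d) *\<^sub>R (primitive m (s + d) - primitive m s) - (1 / e) *\<^sub>R (primitive m (t + e) - primitive m t))
      \<le> H * sqrt (\<bar>s - t\<bar> + d + e)"
    if st: "0 \<le> s" "0 < d" "s + d \<le> 1" "0 \<le> t" "0 < e" "t + e \<le> 1" for s t d e
  proof -
    define k where "k = (\<lambda>s d r. (1 / d) * indicat_real {s<..s + d} r)"
    define h where "h r = k s d r - k t e r" for r
    have km [measurable]: "k s d \<in> borel_measurable borel" for s d unfolding k_def by measurable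
    have kb: "\<bar>k s d r\<bar> \<le> 1 / d" if "0 < d" for s d r using that by (simp add: k_def indicator_def)
    have ksq: "square_integrable (k s d)" if "0 < d" for s d
      by (rule square_integrable_bounded[where C="1 / d"]) (use kb that in auto)
    note ki = square_integrable_imp_integrable[OF ksq]
    have kp: "primitive (k s d) r = max 0 (min 1 ((r - s) / d))"
      if "0 \<le> s" "0 < d" "s + d \<le> 1" "r \<in> {0..1}" for s d r
    proof -
      have "primitive (k s d) r = (1 / d) *\<^sub>R primitive (indicat_real {s<..s + d}) r"
        unfolding k_def using primitive_scaleR[of "1 / d" "indicat_real {s<..s + d}" r] by simp
      also have "\<dots> = (1 / d) * max 0 (min r (s + d) - s)"
        using that by (simp add: primitive_indicator)
      also have "\<dots> = max 0 (min 1 ((r - s) / d))"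
        using that by (auto simp: max_def min_def field_simps)
      finally show ?thesis .
    qed
    have hsq: "square_integrable h" unfolding h_def[abs_def] by (rule square_integrable_diff) (intro ksq st)+
    have hp: "primitive h r = primitive (k s d) r - primitive (k t e) r" for r
      unfolding h_def[abs_def] by (rule primitive_minus[OF ki[OF st(2)] ki[OF st(5)]])
    have "bounded (range h)"
      unfolding bounded_iff
    proof (intro exI ballI)
      fix x assume "x \<in> range h"
      then obtain r where "x = h r" by blast
      then show "norm x \<le> 1 / d + 1 / e" using kb[OF st(2), of s r] kb[OF st(5), of t r] by (simp add: h_def)
    qed
    moreover have "primitive h 1 = 0"
      unfolding hp using st by (simp add: kp field_simps max_def min_def)
    ultimately have w: "norm (LINT r|unit_measure. h r *\<^sub>R m r) \<le> H * sqrt (LINT r|unit_measure. (primitive h r)\<^sup>2)"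
      by (intro weak hsq)
    have km_int: "(LINT r|unit_measure. k s d r *\<^sub>R m r) = (1 / d) *\<^sub>R (primitive m (s + d) - primitive m s)" if "0 < d" for s d
    proof -
      have "(LINT r|unit_measure. k s d r *\<^sub>R m r) = (LINT r|unit_measure. (1 / d) *\<^sub>R (indicat_real {s<..s + d} r *\<^sub>R m r))"
        by (simp add: k_def)
      also have "\<dots> = (1 / d) *\<^sub>R (LINT r|unit_measure. indicat_real {s<..s + d} r *\<^sub>R m r)" by (rule integral_scaleR_right)
      finally show ?thesis using that by (simp add: primitive_diff[OF mi])
    qed
    have kmi: "integrable unit_measure (\<lambda>r. k s d r *\<^sub>R m r)" for s d
    proof -
      have "integrable unit_measure (\<lambda>r. (1 / d) *\<^sub>R (indicat_real {s<..s + d} r *\<^sub>R m r))"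
        by (intro integrable_scaleR_right integrable_unit_indicator mi) simp
      then show ?thesis by (simp add: k_def)
    qed
    have "(LINT r|unit_measure. h r *\<^sub>R m r) = (1 / d) *\<^sub>R (primitive m (s + d) - primitive m s) - (1 / e) *\<^sub>R (primitive m (t + e) - primitive m t)"
      unfolding h_def scaleR_diff_left Bochner_Integration.integral_diff[OF kmi kmi] km_int[OF st(2)] km_int[OF st(5)] ..
    moreover have "(LINT r|unit_measure. (primitive h r)\<^sup>2) \<le> \<bar>s - t\<bar> + d + e"
    proof -
      let ?a = "min s t" and ?b = "max (s + d) (t + e)"
      have "(LINT r|unit_measure. (primitive h r)\<^sup>2) \<le> (LINT r|unit_measure. indicat_real {?a<..?b} r)"
      proof (rule integral_mono_AE)
        show "integrable unit_measure (\<lambda>r. (primitive h r)\<^sup>2)"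
          using square_integrable_norm_sq[OF continuous_square_integrable[OF continuous_on_primitive[OF hsq]]] by simp
        show "integrable unit_measure (indicat_real {?a<..?b})"
          by (rule integrable_unit_bounded[where C=1]) (auto simp: indicator_def)
        show "AE r in unit_measure. (primitive h r)\<^sup>2 \<le> indicat_real {?a<..?b} r"
          using AE_unit_mem
        proof eventually_elim
          case (elim r)
          then have r: "r \<in> {0..1}" by auto
          define x y where "x = max 0 (min 1 ((r - s) / d))" and "y = max 0 (min 1 ((r - t) / e))"
          have hr: "primitive h r = x - y" unfolding hp using st r by (simp add: kp x_def y_def)
          have "\<bar>x - y\<bar> \<le> 1" by (auto simp: x_def y_def)
          then have le1: "(x - y)\<^sup>2 \<le> 1" by (simp add: abs_square_le_1)
          show ?case
          proof (cases "r \<in> {?a<..?b}")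
            case True
            then show ?thesis using le1 by (simp add: hr)
          next
            case False
            then consider "r \<le> s" "r \<le> t" | "s + d < r" "t + e < r" by fastforce
            then have "x = y"
            proof cases
              case 1
              then have "(r - s) / d \<le> 0" "(r - t) / e \<le> 0" using st by (auto simp: divide_le_0_iff)
              then show ?thesis by (simp add: x_def y_def)
            next
              case 2
              then have "1 \<le> (r - s) / d" "1 \<le> (r - t) / e" using st by (auto simp: field_simps)
              then show ?thesis by (simp add: x_def y_def)
            qed
            then show ?thesis by (simp add: hr)
          qed
        qed
      qed
      also have "\<dots> = ?b - ?a" by (rule measure_unit_Ioc) (use st in auto)
      also have "\<dots> \<le> \<bar>s - t\<bar> + d + e" using st by linarith
      finally show ?thesis .
    qed
    then have "H * sqrt (LINT r|unit_measure. (primitive h r)\<^sup>2) \<le> H * sqrt (\<bar>s - t\<bar> + d + e)"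
      using H by (intro mult_left_mono real_sqrt_le_mono)
    ultimately show ?thesis using w by simp
  qed
  then obtain p where p: "\<And>s t. s \<in> {0..1} \<Longrightarrow> t \<in> {0..1} \<Longrightarrow> norm (p s - p t) \<le> H * sqrt \<bar>s - t\<bar>"
    "\<And>t. 0 < t \<Longrightarrow> t < 1 \<Longrightarrow> (primitive m has_vector_derivative p t) (at t)"
    by (rule derivative_from_averages) blast+
  note pc = Hoelder_imp_continuous_on[OF p(1)]
  have eq: "primitive m t = primitive p t" if "t \<in> {0..1}" for t
    using primitive_of_derivative[OF p(2) continuous_on_primitive[OF m] pc that] by simp
  have "AE t in unit_measure. m t = p t"
    by (rule primitive_eq_imp_AE_eq[OF mi continuous_integrable_unit[OF pc] eq])
  with p(1) show ?thesis by (rule that)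
qed

text \<open>Let \<open>\<eta>\<close> be the second primitive of \<open>h\<close>. Subtracting the
  polynomials \<open>\<eta>(k) \<zeta>\<^sub>k\<close>, where \<open>\<zeta>\<^sub>k\<close> is one
  at the node \<open>k\<close>, zero at the other nodes and stationary at all of them, makes
  \<open>\<eta>\<close> vanish at the nodes and does not change its derivative there. The
  coefficients \<open>\<eta>(k)\<close> are bounded by the \<open>L\<^sup>2\<close> norm of the
  primitive of \<open>h\<close>, so the correction changes only the constant.\<close>

proposition remove_interpolation_constraints:
  fixes m :: "real \<Rightarrow> 'v::{banach, second_countable_topology}"
  assumes m: "square_integrable m" and N: "finite N" "N \<subseteq> {0..1}" "0 \<in> N" "1 \<in> N" and E: "0 \<le> E"
    and weak: "\<And>h. square_integrable h \<Longrightarrow> bounded (h ` {0..1}) \<Longrightarrow> primitive h 1 = 0 \<Longrightarrow>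
      (\<And>n. n \<in> N \<Longrightarrow> primitive (primitive h) n = 0) \<Longrightarrow>
      norm (LINT t|unit_measure. h t *\<^sub>R m t) \<le> E * sqrt (LINT t|unit_measure. (primitive h t)\<^sup>2)"
  obtains H where "0 \<le> H" "\<And>h. square_integrable h \<Longrightarrow> bounded (range h) \<Longrightarrow> primitive h 1 = 0 \<Longrightarrow>
      norm (LINT t|unit_measure. h t *\<^sub>R m t) \<le> H * sqrt (LINT t|unit_measure. (primitive h t)\<^sup>2)"
proof -
  obtain \<zeta> :: "real \<Rightarrow> real poly" where
    \<zeta>: "\<And>k n. n \<in> N \<Longrightarrow> poly (\<zeta> k) n = (if n = k then 1 else 0)" "\<And>k n. n \<in> N \<Longrightarrow> poly (pderiv (\<zeta> k)) n = 0"
    by (rule cardinal_Hermite_polynomials[OF N(1)]) blast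
  define D where "D k t = poly (pderiv (pderiv (\<zeta> k))) t" for k t
  have Dc: "continuous_on S (D k)" for k S unfolding D_def[abs_def] by (intro continuous_intros)
  have Dprim: "primitive (D k) t = poly (pderiv (\<zeta> k)) t - poly (pderiv (\<zeta> k)) 0"
    and Dprim2: "primitive (poly (pderiv (\<zeta> k))) t = poly (\<zeta> k) t - poly (\<zeta> k) 0" if "t \<in> {0..1}" for k t
  proof -
    have d: "(poly p has_vector_derivative poly (pderiv p) t) (at t)" for p and t :: real
      using poly_DERIV[of p t] by (simp add: has_real_derivative_iff_has_vector_derivative)
    have c: "continuous_on {0..1} (poly p)" for p :: "real poly" by (intro continuous_intros)
    show "primitive (D k) t = poly (pderiv (\<zeta> k)) t - poly (pderiv (\<zeta> k)) 0"
      using primitive_of_derivative[of "poly (pderiv (\<zeta> k))", OF d c c that] by (simp add: D_def[abs_def])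
    show "primitive (poly (pderiv (\<zeta> k))) t = poly (\<zeta> k) t - poly (\<zeta> k) 0"
      using primitive_of_derivative[of "poly (\<zeta> k)", OF d c c that] by simp
  qed
  have "\<exists>B. \<forall>t\<in>{0..1}. norm (poly (pderiv (\<zeta> k)) t) \<le> B" for k
    by (rule continuous_bounded_unit[of "poly (pderiv (\<zeta> k))"]) (intro continuous_intros, blast)
  then obtain Z where Z: "\<And>k t. t \<in> {0..1} \<Longrightarrow> \<bar>poly (pderiv (\<zeta> k)) t\<bar> \<le> Z k" unfolding real_norm_def by metis
  define ZZ where "ZZ = (\<Sum>k\<in>N. Z k)"
  define DD where "DD = (\<Sum>k\<in>N. norm (LINT t|unit_measure. D k t *\<^sub>R m t))"
  define H where "H = E * sqrt (2 + 2 * ZZ\<^sup>2) + DD"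
  have DD0: "0 \<le> DD" unfolding DD_def by (intro sum_nonneg norm_ge_zero)
  show ?thesis
  proof (rule that[of H])
    show "0 \<le> H" using E DD0 by (simp add: H_def)
    fix h :: "real \<Rightarrow> real"
    assume h: "square_integrable h" and hb: "bounded (range h)" and h1: "primitive h 1 = 0"
    define \<eta> where "\<eta> = primitive (primitive h)"
    define S where "S = sqrt (LINT t|unit_measure. (primitive h t)\<^sup>2)"
    have S0: "0 \<le> S" unfolding S_def by (intro real_sqrt_ge_zero integral_nonneg_AE) auto
    have p1: "square_integrable (primitive h)"
      by (rule continuous_square_integrable[OF continuous_on_primitive[OF h]])
    have \<eta>S: "\<bar>\<eta> t\<bar> \<le> S" if "t \<in> {0..1}" for t
      using norm_primitive_le_sqrt[OF p1 that] by (simp add: \<eta>_def S_def)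
    have \<eta>0: "\<eta> 0 = 0" by (simp add: \<eta>_def)
    define c where "c t = (\<Sum>k\<in>N. \<eta> k * D k t)" for t
    define h' where "h' t = h t - c t" for t
    have cc: "continuous_on {0..1} c" unfolding c_def[abs_def] by (intro continuous_intros Dc)
    have csq: "square_integrable c" by (rule continuous_square_integrable[OF cc])
    note ci = square_integrable_imp_integrable[OF csq] and hi = square_integrable_imp_integrable[OF h]
    have Di: "integrable unit_measure (D k)" for k by (intro continuous_integrable_unit Dc)
    have prim_sum: "primitive (\<lambda>t. \<Sum>k\<in>N. \<eta> k * f k t) r = (\<Sum>k\<in>N. \<eta> k * primitive (f k) r)"
      if "\<And>k. integrable unit_measure (f k)" for f :: "real \<Rightarrow> real \<Rightarrow> real" and r
    proof -
      have "primitive (\<lambda>t. \<Sum>k\<in>N. \<eta> k * f k t) r = (LINT s|unit_measure. (\<Sum>k\<in>N. \<eta> k *\<^sub>R (indicat_real {..r} s *\<^sub>R f k s)))"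
        unfolding primitive_def by (simp add: sum_distrib_left ac_simps)
      also have "\<dots> = (\<Sum>k\<in>N. LINT s|unit_measure. \<eta> k *\<^sub>R (indicat_real {..r} s *\<^sub>R f k s))"
        by (intro Bochner_Integration.integral_sum integrable_scaleR_right integrable_unit_indicator that) simp
      also have "\<dots> = (\<Sum>k\<in>N. \<eta> k * primitive (f k) r)"
        unfolding primitive_def integral_scaleR_right by simp
      finally show ?thesis .
    qed
    have c1: "primitive c t = (\<Sum>k\<in>N. \<eta> k * poly (pderiv (\<zeta> k)) t)" if "t \<in> {0..1}" for t
      unfolding c_def[abs_def] prim_sum[OF Di] using that N \<zeta>(2) by (simp add: Dprim)
    have c2: "primitive (primitive c) t = (\<Sum>k\<in>N. \<eta> k * poly (\<zeta> k) t)" if "t \<in> {0..1}" for t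
    proof -
      have "primitive (primitive c) t = primitive (\<lambda>t. \<Sum>k\<in>N. \<eta> k * poly (pderiv (\<zeta> k)) t) t"
        by (rule primitive_cong) (use c1 in auto)
      also have "\<dots> = (\<Sum>k\<in>N. \<eta> k * primitive (poly (pderiv (\<zeta> k))) t)"
        by (intro prim_sum continuous_integrable_unit continuous_intros)
      also have "\<dots> = (\<Sum>k\<in>N. \<eta> k * poly (\<zeta> k) t) - (\<Sum>k\<in>N. \<eta> k * poly (\<zeta> k) 0)"
        using that by (simp add: Dprim2 right_diff_distrib sum_subtractf)
      also have "(\<Sum>k\<in>N. \<eta> k * poly (\<zeta> k) 0) = 0"
        using \<zeta>(1)[OF N(3)] \<eta>0 by (intro sum.neutral) auto
      finally show ?thesis by simp
    qed
    have h'1: "primitive h' = (\<lambda>t. primitive h t - primitive c t)"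
      unfolding h'_def[abs_def] by (rule ext) (rule primitive_minus[OF hi ci])
    have pc: "square_integrable (primitive c)"
      by (rule continuous_square_integrable[OF continuous_on_primitive[OF csq]])
    have h'2: "primitive (primitive h') n = 0" if "n \<in> N" for n
    proof -
      have n: "n \<in> {0..1}" using that N(2) by auto
      have "primitive (primitive h') n = \<eta> n - primitive (primitive c) n"
        unfolding h'1 \<eta>_def by (rule primitive_minus[OF square_integrable_imp_integrable[OF p1] square_integrable_imp_integrable[OF pc]])
      also have "primitive (primitive c) n = (\<Sum>k\<in>N. if k = n then \<eta> k else 0)"
        unfolding c2[OF n] by (intro sum.cong) (auto simp: \<zeta>(1)[OF that])
      also have "\<dots> = \<eta> n" using N(1) that by simp
      finally show ?thesis by simp
    qed
    have h'11: "primitive h' 1 = 0" unfolding h'1 using h1 c1[of 1] \<zeta>(2)[OF N(4)] by simp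
    have h'sq: "square_integrable h'" unfolding h'_def[abs_def] by (rule square_integrable_diff[OF h csq])
    have cb: "bounded (c ` {0..1})" by (intro compact_imp_bounded compact_continuous_image cc) auto
    have h'b: "bounded (h' ` {0..1})"
      unfolding h'_def[abs_def] by (rule bounded_minus_comp[OF bounded_subset[OF hb] cb]) auto
    have main: "norm (LINT t|unit_measure. h' t *\<^sub>R m t) \<le> E * sqrt (LINT t|unit_measure. (primitive h' t)\<^sup>2)"
      by (rule weak[OF h'sq h'b h'11 h'2])
    have "(LINT t|unit_measure. (primitive h' t)\<^sup>2) \<le> (LINT t|unit_measure. 2 * (primitive h t)\<^sup>2 + 2 * (ZZ * S)\<^sup>2)"
    proof (rule integral_mono_AE)
      show "integrable unit_measure (\<lambda>t. (primitive h' t)\<^sup>2)"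
        using square_integrable_norm_sq[OF continuous_square_integrable[OF continuous_on_primitive[OF h'sq]]] by simp
      show "integrable unit_measure (\<lambda>t. 2 * (primitive h t)\<^sup>2 + 2 * (ZZ * S)\<^sup>2)"
        using square_integrable_norm_sq[OF p1] by simp
      show "AE t in unit_measure. (primitive h' t)\<^sup>2 \<le> 2 * (primitive h t)\<^sup>2 + 2 * (ZZ * S)\<^sup>2"
        using AE_unit_mem
      proof eventually_elim
        case (elim t)
        then have t: "t \<in> {0..1}" by auto
        have "\<bar>primitive c t\<bar> \<le> (\<Sum>k\<in>N. \<bar>\<eta> k * poly (pderiv (\<zeta> k)) t\<bar>)" unfolding c1[OF t] by (rule sum_abs)
        also have "\<dots> \<le> (\<Sum>k\<in>N. S * Z k)"
          using N(2) S0 by (intro sum_mono) (auto simp: abs_mult intro!: mult_mono \<eta>S Z[OF t])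
        also have "\<dots> = ZZ * S" by (simp add: ZZ_def sum_distrib_left[symmetric] mult.commute)
        finally have "\<bar>primitive c t\<bar>\<^sup>2 \<le> (ZZ * S)\<^sup>2" by (rule power_mono) simp
        then have "(primitive c t)\<^sup>2 \<le> (ZZ * S)\<^sup>2" by simp
        moreover have "(primitive h' t)\<^sup>2 \<le> 2 * (primitive h t)\<^sup>2 + 2 * (primitive c t)\<^sup>2"
          using norm_add_sq_le[of "primitive h t" "- primitive c t"] by (simp add: h'1)
        ultimately show ?case by linarith
      qed
    qed
    also have "\<dots> = 2 * (LINT t|unit_measure. (primitive h t)\<^sup>2) + 2 * (ZZ * S)\<^sup>2"
      using square_integrable_norm_sq[OF p1] by simp
    also have "(LINT t|unit_measure. (primitive h t)\<^sup>2) = S\<^sup>2"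
      unfolding S_def by (simp add: integral_nonneg_AE)
    also have "2 * S\<^sup>2 + 2 * (ZZ * S)\<^sup>2 = (2 + 2 * ZZ\<^sup>2) * S\<^sup>2" by (simp add: power_mult_distrib algebra_simps)
    finally have "sqrt (LINT t|unit_measure. (primitive h' t)\<^sup>2) \<le> sqrt (2 + 2 * ZZ\<^sup>2) * S"
      using S0 by (metis real_sqrt_le_mono real_sqrt_mult real_sqrt_abs abs_of_nonneg)
    with main have main': "norm (LINT t|unit_measure. h' t *\<^sub>R m t) \<le> E * (sqrt (2 + 2 * ZZ\<^sup>2) * S)"
      using E by (meson mult_left_mono order_trans)
    note mult_i = integrable_square_integrable_scaleR[OF _ m]
    have "(LINT t|unit_measure. c t *\<^sub>R m t) = (\<Sum>k\<in>N. \<eta> k *\<^sub>R (LINT t|unit_measure. D k t *\<^sub>R m t))"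
    proof -
      have Dm: "integrable unit_measure (\<lambda>t. D k t *\<^sub>R m t)" for k
        by (intro mult_i continuous_square_integrable Dc)
      have "(LINT t|unit_measure. c t *\<^sub>R m t) = (LINT t|unit_measure. (\<Sum>k\<in>N. \<eta> k *\<^sub>R (D k t *\<^sub>R m t)))"
        by (simp add: c_def scaleR_sum_left)
      also have "\<dots> = (\<Sum>k\<in>N. LINT t|unit_measure. \<eta> k *\<^sub>R (D k t *\<^sub>R m t))"
        by (intro Bochner_Integration.integral_sum integrable_scaleR_right Dm)
      finally show ?thesis unfolding integral_scaleR_right .
    qed
    also have "norm \<dots> \<le> (\<Sum>k\<in>N. norm (\<eta> k *\<^sub>R (LINT t|unit_measure. D k t *\<^sub>R m t)))" by (rule norm_sum)
    also have "\<dots> \<le> (\<Sum>k\<in>N. S * norm (LINT t|unit_measure. D k t *\<^sub>R m t))"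
      using N(2) by (intro sum_mono) (auto intro!: mult_right_mono \<eta>S)
    also have "\<dots> = DD * S" by (simp add: DD_def sum_distrib_left[symmetric] mult.commute)
    finally have cD: "norm (LINT t|unit_measure. c t *\<^sub>R m t) \<le> DD * S" .
    have "(LINT t|unit_measure. h t *\<^sub>R m t) = (LINT t|unit_measure. h' t *\<^sub>R m t + c t *\<^sub>R m t)"
      by (simp add: h'_def flip: scaleR_add_left)
    also have "\<dots> = (LINT t|unit_measure. h' t *\<^sub>R m t) + (LINT t|unit_measure. c t *\<^sub>R m t)"
      by (rule Bochner_Integration.integral_add[OF mult_i[OF h'sq] mult_i[OF csq]])
    finally have "norm (LINT t|unit_measure. h t *\<^sub>R m t) \<le> E * (sqrt (2 + 2 * ZZ\<^sup>2) * S) + DD * S"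
      using norm_triangle_ineq[of "LINT t|unit_measure. h' t *\<^sub>R m t" "LINT t|unit_measure. c t *\<^sub>R m t"] main' cD by simp
    then show "norm (LINT t|unit_measure. h t *\<^sub>R m t) \<le> H * sqrt (LINT t|unit_measure. (primitive h t)\<^sup>2)"
      by (simp add: H_def S_def algebra_simps)
  qed
qed

section \<open>Regularity of minimizers\<close>

lemma first_order_nonneg:
  fixes A E s0 :: real
  assumes "0 < s0" "0 \<le> E" and "\<And>s. 0 < s \<Longrightarrow> s \<le> s0 \<Longrightarrow> 0 \<le> s * A + s\<^sup>2 * E"
  shows "0 \<le> A"
proof (rule ccontr)
  assume "\<not> 0 \<le> A"
  define s where "s = min s0 (- A / (2 * (E + 1)))"
  have "0 < - A / (2 * (E + 1))" using assms(2) \<open>\<not> 0 \<le> A\<close> by (intro divide_pos_pos) auto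
  then have s: "0 < s" "s \<le> s0" using assms(1) by (auto simp: s_def)
  have "s * (2 * (E + 1)) \<le> - A"
    using assms(2) by (simp add: s_def pos_le_divide_eq[symmetric])
  then have "s * E \<le> - A / 2" using s assms(2) by (simp add: algebra_simps)
  moreover have "0 \<le> s * (A + s * E)" using assms(3)[OF s] by (simp add: power2_eq_square algebra_simps)
  then have "0 \<le> A + s * E" using s by (simp add: zero_le_mult_iff)
  ultimately show False using \<open>\<not> 0 \<le> A\<close> by linarith
qed

context spline_metric
begin

lemma bounded_linear_g: "bounded_linear (g p a)"
proof (rule bounded_linear_intro[where K="C * norm a"])
  show "norm (g p a x) \<le> norm x * (C * norm a)" for x using upper[of p a x] by (simp add: ac_simps)
qed (simp_all add: bilinear_expand[OF bil])

text \<open>The Riesz isomorphism that represents the metric at \<open>p\<close> by the fixed inner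
  product of \<open>V\<close>. It allows integrating covectors at different base points as vectors
  of one space.\<close>

definition riesz :: "'v \<Rightarrow> 'v \<Rightarrow> 'v"
  where "riesz p a = (THE u. \<forall>z. inner u z = g p a z)"

lemma inner_riesz: "inner (riesz p a) z = g p a z"
proof -
  have "bilinear (inner :: 'v \<Rightarrow> 'v \<Rightarrow> real)"
    by (simp add: bilinear_def linear_iff inner_add_left inner_add_right)
  then have "\<exists>!u. \<forall>z. inner u z = g p a z"
    by (rule coercive_representation[where c=1 and C=1])
      (use bounded_linear_g Cauchy_Schwarz_ineq2 in \<open>auto simp: inner_commute power2_norm_eq_inner\<close>)
  from theI'[OF this] show ?thesis by (simp add: riesz_def)
qed

lemma riesz_diff: "riesz p a - riesz p b = riesz p (a - b)"
  by (rule vector_eq_rdot[THEN iffD1]) (simp add: inner_diff_left inner_riesz bilinear_expand[OF bil])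

lemma norm_le_if_inner_le:
  fixes u :: 'v
  assumes "inner u u \<le> M * norm u" "0 \<le> M"
  shows "norm u \<le> M"
  using coercive_norm_le[of 1 u inner M] assms by (simp add: power2_norm_eq_inner)

lemma norm_riesz_le: "norm (riesz p a) \<le> C * norm a"
proof (rule norm_le_if_inner_le)
  show "inner (riesz p a) (riesz p a) \<le> C * norm a * norm (riesz p a)"
    using upper[of p a "riesz p a"] by (simp add: inner_riesz)
qed (use nonneg in simp)

lemma riesz_base_diff: "norm (riesz p a - riesz q a) \<le> L * norm (\<iota> p - \<iota> q) * norm a"
proof (rule norm_le_if_inner_le)
  let ?d = "riesz p a - riesz q a"
  show "inner ?d ?d \<le> L * norm (\<iota> p - \<iota> q) * norm a * norm ?d"
    using lipschitz[of p a ?d q] by (simp add: inner_diff_left inner_riesz)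
qed (use nonneg in simp)

lemma tendsto_riesz:
  assumes p: "(p \<longlongrightarrow> p0) F" and a: "(a \<longlongrightarrow> a0) F"
  shows "((\<lambda>x. riesz (p x) (a x)) \<longlongrightarrow> riesz p0 a0) F"
proof -
  interpret \<iota>: bounded_linear \<iota> by (rule \<iota>)
  have "((\<lambda>x. riesz (p x) (a x) - riesz p0 a0) \<longlongrightarrow> 0) F"
  proof (rule Lim_null_comparison)
    show "\<forall>\<^sub>F x in F. norm (riesz (p x) (a x) - riesz p0 a0) \<le>
      C * norm (a x - a0) + L * norm (\<iota> (p x) - \<iota> p0) * norm a0"
    proof (intro always_eventually allI)
      fix x
      have eq: "riesz (p x) (a x) - riesz p0 a0 = riesz (p x) (a x - a0) + (riesz (p x) a0 - riesz p0 a0)"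
        by (simp flip: riesz_diff)
      show "norm (riesz (p x) (a x) - riesz p0 a0) \<le> C * norm (a x - a0) + L * norm (\<iota> (p x) - \<iota> p0) * norm a0"
        using norm_triangle_ineq[of "riesz (p x) (a x - a0)" "riesz (p x) a0 - riesz p0 a0"]
          norm_riesz_le[of "p x" "a x - a0"] riesz_base_diff[of "p x" a0 p0]
        unfolding eq by linarith
    qed
    have "((\<lambda>x. C * norm (a x - a0) + L * norm (\<iota> (p x) - \<iota> p0) * norm a0)
      \<longlongrightarrow> C * norm (a0 - a0) + L * norm (\<iota> p0 - \<iota> p0) * norm a0) F"
      by (intro tendsto_intros \<iota>.tendsto p a)
    then show "((\<lambda>x. C * norm (a x - a0) + L * norm (\<iota> (p x) - \<iota> p0) * norm a0) \<longlongrightarrow> 0) F" by simp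
  qed
  then show ?thesis by (simp add: LIM_zero_iff)
qed

lemma measurable_riesz:
  assumes [measurable]: "p \<in> borel_measurable M" "a \<in> borel_measurable M"
  shows "(\<lambda>x. riesz (p x) (a x)) \<in> borel_measurable M"
proof (rule borel_measurable_continuous_Pair[where H="riesz"])
  show "continuous_on UNIV (\<lambda>z. riesz (fst z) (snd z))"
    unfolding continuous_on_def by (intro ballI tendsto_riesz tendsto_intros)
qed measurable

lemma riesz_inverse:
  obtains a where "riesz p a = m"
proof -
  have "\<exists>!a. \<forall>z. g p a z = inner m z"
    by (rule coercive_representation[OF bil sym c_pos lower upper bounded_linear_inner_right])
  then obtain a where "\<And>z. g p a z = inner m z" by blast
  then have "riesz p a = m" by (intro vector_eq_rdot[THEN iffD1]) (simp add: inner_riesz)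
  then show ?thesis by (rule that)
qed

text \<open>The inverse of the Riesz isomorphism is Lipschitz continuous in both arguments, by
  ellipticity.\<close>

lemma riesz_lower: "norm (a - b) \<le> (norm (riesz p a - riesz q b) + L * norm (\<iota> p - \<iota> q) * norm b) / c"
proof (rule coercive_norm_le[where B="g p", OF c_pos lower])
  let ?d = "a - b"
  have "g p ?d ?d = inner (riesz p a - riesz q b) ?d + (g q b ?d - g p b ?d)"
    by (simp add: inner_diff_left inner_riesz bilinear_diff_left[OF bil])
  also have "\<dots> \<le> norm (riesz p a - riesz q b) * norm ?d + L * norm (\<iota> p - \<iota> q) * norm b * norm ?d"
  proof -
    have "\<bar>g q b ?d - g p b ?d\<bar> \<le> L * norm (\<iota> p - \<iota> q) * norm b * norm ?d"
      using lipschitz[of q b ?d p] by (simp add: norm_minus_commute)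
    then show ?thesis using norm_cauchy_schwarz[of "riesz p a - riesz q b" ?d] by linarith
  qed
  finally show "g p ?d ?d \<le> (norm (riesz p a - riesz q b) + L * norm (\<iota> p - \<iota> q) * norm b) * norm ?d"
    by (simp add: algebra_simps)
qed (use nonneg in simp)

lemma density_perturb:
  "density \<sigma> p u (v + s *\<^sub>R (\<eta> *\<^sub>R z)) (w + s *\<^sub>R (h *\<^sub>R z)) = density \<sigma> p u v w
    + s * (2 * (h * g p (w + \<Gamma> p u) z) + 2 * \<sigma> * (\<eta> * g p v z))
    + s\<^sup>2 * (h\<^sup>2 * g p z z + \<sigma> * (\<eta>\<^sup>2 * g p z z))"
proof -
  have e: "g p (x + s *\<^sub>R (k *\<^sub>R z)) (x + s *\<^sub>R (k *\<^sub>R z)) = g p x x + s * (2 * (k * g p x z)) + s\<^sup>2 * (k\<^sup>2 * g p z z)" for x k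
    using sym[of p z x] by (simp add: bilinear_expand[OF bil] power2_eq_square algebra_simps)
  have "w + s *\<^sub>R (h *\<^sub>R z) + \<Gamma> p u = (w + \<Gamma> p u) + s *\<^sub>R (h *\<^sub>R z)" by simp
  then show ?thesis unfolding density_def by (simp only: e) (simp add: algebra_simps)
qed

lemma curve_perturb:
  assumes w: "square_integrable w" and h: "square_integrable h"
  shows "square_integrable (\<lambda>t. w t + s *\<^sub>R (h t *\<^sub>R z))"
    and "primitive_velocity b (\<lambda>t. w t + s *\<^sub>R (h t *\<^sub>R z)) t = primitive_velocity b w t + s *\<^sub>R (primitive h t *\<^sub>R z)"
    and "primitive_curve a b (\<lambda>t. w t + s *\<^sub>R (h t *\<^sub>R z)) t = primitive_curve a b w t + s *\<^sub>R (primitive (primitive h) t *\<^sub>R z)"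
proof -
  note i = square_integrable_imp_integrable
  have sq: "square_integrable (\<lambda>t. k t *\<^sub>R z)" if "square_integrable k" for k :: "real \<Rightarrow> real"
  proof (rule square_integrable_bound[where S="\<lambda>t. (norm z)\<^sup>2 * (norm (k t))\<^sup>2"])
    note [measurable] = square_integrable_measurable[OF that]
    show "(\<lambda>t. k t *\<^sub>R z) \<in> borel_measurable unit_measure" by measurable
    show "integrable unit_measure (\<lambda>t. (norm z)\<^sup>2 * (norm (k t))\<^sup>2)"
      by (intro integrable_mult_right square_integrable_norm_sq that)
  qed (simp add: power_mult_distrib mult.commute)
  have p1: "square_integrable (primitive h)"
    by (rule continuous_square_integrable[OF continuous_on_primitive[OF h]])
  show "square_integrable (\<lambda>t. w t + s *\<^sub>R (h t *\<^sub>R z))"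
    by (intro square_integrable_add square_integrable_scaleR sq w h)
  show v: "primitive_velocity b (\<lambda>t. w t + s *\<^sub>R (h t *\<^sub>R z)) t = primitive_velocity b w t + s *\<^sub>R (primitive h t *\<^sub>R z)" for t
    unfolding primitive_velocity_def primitive_add[OF i[OF w] i[OF square_integrable_scaleR[OF sq[OF h]]]]
      primitive_scaleR primitive_scaleR_left[OF i[OF h]] by simp
  show "primitive_curve a b (\<lambda>t. w t + s *\<^sub>R (h t *\<^sub>R z)) t = primitive_curve a b w t + s *\<^sub>R (primitive (primitive h) t *\<^sub>R z)"
    unfolding primitive_curve_def v
      primitive_add[OF i[OF square_integrable_primitive_velocity[OF w]] i[OF square_integrable_scaleR[OF sq[OF p1]]]]
      primitive_scaleR primitive_scaleR_left[OF i[OF p1]] by simp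
qed

text \<open>Here \<open>h\<close> is the second derivative of the perturbation in the direction
  \<open>z\<close>. In the energy of the perturbed curve the coefficients are replaced by those of
  the original curve; by \<open>density_lipschitz\<close> this costs at most \<open>s d\<close> to
  first order in \<open>s\<close>, and the integral of \<open>d\<close> is at most a multiple of the
  \<open>L\<^sup>2\<close> norm of the primitive of \<open>h\<close>. What remains is a quadratic
  polynomial in \<open>s\<close>, whose linear coefficient contains the wanted integral. The
  constant \<open>E\<close> depends neither on \<open>h\<close> nor on \<open>z\<close>.\<close>

proposition first_variation_bound:
  assumes \<sigma>: "0 \<le> \<sigma>" and w: "square_integrable w"
  obtains E where "0 \<le> E"
    "\<And>h z. square_integrable h \<Longrightarrow> bounded (h ` {0..1}) \<Longrightarrow> norm z \<le> 1 \<Longrightarrow>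
      (\<And>s. 0 < s \<Longrightarrow> curve_energy \<sigma> (a, b) w \<le> curve_energy \<sigma> (a, b) (\<lambda>t. w t + s *\<^sub>R (h t *\<^sub>R z))) \<Longrightarrow>
      - (LINT t|unit_measure. h t * g (primitive_curve a b w t)
            (w t + \<Gamma> (primitive_curve a b w t) (primitive_velocity b w t)) z)
        \<le> E * sqrt (LINT t|unit_measure. (primitive h t)\<^sup>2)"
proof -
  interpret \<iota>: bounded_linear \<iota> by (rule \<iota>)
  obtain N where N: "0 < N" "\<And>v. norm (\<iota> v) \<le> norm v * N" using \<iota>.pos_bounded by blast
  let ?p = "primitive_curve a b w" and ?v = "primitive_velocity b w"
  obtain V where V: "\<And>t. norm (?v t) \<le> V" by (rule velocity_bounded[OF w, of b]) blast
  have V0: "0 \<le> V" using order_trans[OF norm_ge_zero V] .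
  obtain B where B: "0 \<le> B"
    "\<And>p u p' u' v w. norm u \<le> V + 1 \<Longrightarrow> norm u' \<le> V + 1 \<Longrightarrow> norm v \<le> V + 1 \<Longrightarrow>
      \<bar>density \<sigma> p u v w - density \<sigma> p' u' v w\<bar> \<le>
        B * (norm (\<iota> p - \<iota> p') * (1 + norm w)\<^sup>2 + norm (\<iota> u - \<iota> u') * (1 + norm w))"
    by (rule density_lipschitz[OF \<sigma>, of "V + 1"]) blast
  note wn = square_integrable_one_plus_norm[OF w]
  have wn2: "integrable unit_measure (\<lambda>t. (1 + norm (w t))\<^sup>2)"
    using square_integrable_norm_sq[OF wn] by simp
  define W where "W = (LINT t|unit_measure. (1 + norm (w t))\<^sup>2)"
  have W0: "0 \<le> W" unfolding W_def by (rule integral_nonneg_AE) simp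
  define E where "E = (2 * \<sigma> * C * V + B * N * (2 * W + sqrt W)) / 2"
  show ?thesis
  proof (rule that[of E])
    show "0 \<le> E" using \<sigma> nonneg V0 B(1) N(1) W0 by (simp add: E_def)
    fix h :: "real \<Rightarrow> real" and z :: 'v
    assume h: "square_integrable h" and hb: "bounded (h ` {0..1})" and z: "norm z \<le> 1"
      and min: "\<And>s. 0 < s \<Longrightarrow> curve_energy \<sigma> (a, b) w \<le> curve_energy \<sigma> (a, b) (\<lambda>t. w t + s *\<^sub>R (h t *\<^sub>R z))"
    obtain b0 where "\<And>t. t \<in> {0..1} \<Longrightarrow> \<bar>h t\<bar> \<le> b0"
      using hb unfolding bounded_iff by (auto simp del: atLeastAtMost_iff)
    then have b0: "\<bar>h t\<bar> \<le> b0" if "t \<in> {0..1}" for t using that by blast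
    have b00: "0 \<le> b0" using order_trans[OF abs_ge_zero b0[of 0]] by simp
    let ?h1 = "primitive h" and ?h2 = "primitive (primitive h)"
    have p1: "square_integrable ?h1" by (rule continuous_square_integrable[OF continuous_on_primitive[OF h]])
    have p2: "square_integrable ?h2" by (rule continuous_square_integrable[OF continuous_on_primitive[OF p1]])
    have h1b: "\<bar>?h1 t\<bar> \<le> b0" for t
      using norm_primitive_le_bound[OF square_integrable_imp_integrable[OF h], of b0 t] b0 by simp
    have h2b: "\<bar>?h2 t\<bar> \<le> b0" for t
      using norm_primitive_le_bound[OF square_integrable_imp_integrable[OF p1], of b0 t] h1b by simp
    define S where "S = sqrt (LINT t|unit_measure. (?h1 t)\<^sup>2)"
    have S0: "0 \<le> S" unfolding S_def by (intro real_sqrt_ge_zero integral_nonneg_AE) auto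
    have h2S: "\<bar>?h2 t\<bar> \<le> S" if "t \<in> {0..1}" for t
      using norm_primitive_le_sqrt[OF p1 that] by (simp add: S_def)
    let ?A = "\<lambda>t. w t + \<Gamma> (?p t) (?v t)"
    define f where "f t = 2 * (h t * g (?p t) (?A t) z)" for t
    define d where "d t = 2 * \<sigma> * C * V * \<bar>?h1 t\<bar> + B * N * (2 * (\<bar>?h2 t\<bar> * (1 + norm (w t))\<^sup>2) + \<bar>?h1 t\<bar> * (1 + norm (w t)))" for t
    define e where "e = b0\<^sup>2 * C + \<sigma> * (b0\<^sup>2 * C) + B * N * (2 * b0 * b0\<^sup>2 + b0 * b0)"
    have e0: "0 \<le> e" using b00 nonneg \<sigma> B(1) N(1) by (simp add: e_def)
    have zz: "g p z z \<le> C" for p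
    proof -
      have "(norm z)\<^sup>2 \<le> 1" using z by (simp add: power_le_one)
      then have "C * (norm z)\<^sup>2 \<le> C * 1" using nonneg(1) by (rule mult_left_mono)
      then show ?thesis using g_le[of p z] by simp
    qed
    \<comment> \<open>For \<open>s \<le> s0\<close> the perturbed velocities stay below \<open>V
      + 1\<close>, however large \<open>h\<close> is. So the Lipschitz constant \<open>B\<close>
      can be fixed before \<open>h\<close>.\<close>
    define s0 where "s0 = 1 / (1 + b0)"
    have s0: "0 < s0" "s0 \<le> 1" using b00 by (auto simp: s0_def)
    have pw: "density \<sigma> (?p t + s *\<^sub>R (?h2 t *\<^sub>R z)) (?v t + s *\<^sub>R (?h1 t *\<^sub>R z)) (?v t + s *\<^sub>R (?h1 t *\<^sub>R z)) (w t + s *\<^sub>R (h t *\<^sub>R z))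
        \<le> density \<sigma> (?p t) (?v t) (?v t) (w t) + s * (f t + d t) + s\<^sup>2 * e"
      if s: "0 < s" "s \<le> s0" and t: "0 < t" "t < 1" for s t
    proof -
      have sb: "s * b0 \<le> 1"
      proof -
        have "s * b0 \<le> s0 * b0" using s b00 by (intro mult_right_mono) auto
        also have "\<dots> \<le> 1" using b00 by (simp add: s0_def)
        finally show ?thesis .
      qed
      have s1: "s \<le> 1" using s s0 by simp
      let ?v' = "?v t + s *\<^sub>R (?h1 t *\<^sub>R z)" and ?p' = "?p t + s *\<^sub>R (?h2 t *\<^sub>R z)" and ?w' = "w t + s *\<^sub>R (h t *\<^sub>R z)"
      have kz: "norm (s *\<^sub>R (k *\<^sub>R z)) \<le> s * \<bar>k\<bar>" for k
      proof -
        have "norm (s *\<^sub>R (k *\<^sub>R z)) = (s * \<bar>k\<bar>) * norm z" using s by (simp add: abs_mult)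
        also have "\<dots> \<le> (s * \<bar>k\<bar>) * 1" using z s by (intro mult_left_mono) auto
        finally show ?thesis by simp
      qed
      have v': "norm ?v' \<le> V + 1"
      proof -
        have "norm (s *\<^sub>R (?h1 t *\<^sub>R z)) \<le> s * b0"
          by (rule order_trans[OF kz]) (use s h1b[of t] in \<open>auto intro: mult_left_mono\<close>)
        then show ?thesis using norm_triangle_ineq[of "?v t" "s *\<^sub>R (?h1 t *\<^sub>R z)"] V[of t] sb by linarith
      qed
      have w': "norm ?w' \<le> norm (w t) + s * b0"
      proof -
        have "norm (s *\<^sub>R (h t *\<^sub>R z)) \<le> s * b0"
          by (rule order_trans[OF kz]) (use s b0[of t] t in \<open>auto intro: mult_left_mono\<close>)
        then show ?thesis using norm_triangle_ineq[of "w t" "s *\<^sub>R (h t *\<^sub>R z)"] by linarith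
      qed
      define y where "y = 1 + norm (w t)"
      have y: "1 \<le> y" by (simp add: y_def)
      have w1: "1 + norm ?w' \<le> y + s * b0" using w' by (simp add: y_def)
      have w2: "(1 + norm ?w')\<^sup>2 \<le> 2 * y\<^sup>2 + 2 * (s * b0)\<^sup>2"
      proof -
        have "(1 + norm ?w')\<^sup>2 \<le> (y + s * b0)\<^sup>2" using w1 by (intro power_mono) auto
        also have "\<dots> \<le> 2 * y\<^sup>2 + 2 * (s * b0)\<^sup>2" using norm_add_sq_le[of y "s * b0"] by simp
        finally show ?thesis .
      qed
      have \<iota>k: "norm (\<iota> (x + s *\<^sub>R (k *\<^sub>R z)) - \<iota> x) \<le> s * \<bar>k\<bar> * N" for x k
      proof -
        have "norm (\<iota> (x + s *\<^sub>R (k *\<^sub>R z)) - \<iota> x) = norm (\<iota> (s *\<^sub>R (k *\<^sub>R z)))" by (simp add: \<iota>.add)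
        also have "\<dots> \<le> norm (s *\<^sub>R (k *\<^sub>R z)) * N" by (rule N(2))
        also have "\<dots> \<le> s * \<bar>k\<bar> * N" using N(1) by (intro mult_right_mono kz) auto
        finally show ?thesis .
      qed
      have V1: "norm (?v t) \<le> V + 1" using V[of t] by linarith
      have "density \<sigma> ?p' ?v' ?v' ?w' \<le> density \<sigma> (?p t) (?v t) ?v' ?w' +
          B * (norm (\<iota> ?p' - \<iota> (?p t)) * (1 + norm ?w')\<^sup>2 + norm (\<iota> ?v' - \<iota> (?v t)) * (1 + norm ?w'))"
        using B(2)[OF v' V1 v', where p="?p'" and p'="?p t" and w="?w'"] by linarith
      also have "B * (norm (\<iota> ?p' - \<iota> (?p t)) * (1 + norm ?w')\<^sup>2 + norm (\<iota> ?v' - \<iota> (?v t)) * (1 + norm ?w'))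
          \<le> B * ((s * \<bar>?h2 t\<bar> * N) * (2 * y\<^sup>2 + 2 * (s * b0)\<^sup>2) + (s * \<bar>?h1 t\<bar> * N) * (y + s * b0))"
        using s N(1) by (intro mult_left_mono add_mono mult_mono \<iota>k w1 w2 B(1)) auto
      also have "\<dots> \<le> s * (B * N * (2 * (\<bar>?h2 t\<bar> * y\<^sup>2) + \<bar>?h1 t\<bar> * y)) + s\<^sup>2 * (B * N * (2 * b0 * b0\<^sup>2 + b0 * b0))"
      proof -
        have "B * ((s * \<bar>?h2 t\<bar> * N) * (2 * y\<^sup>2 + 2 * (s * b0)\<^sup>2) + (s * \<bar>?h1 t\<bar> * N) * (y + s * b0)) =
          s * (B * N * (2 * (\<bar>?h2 t\<bar> * y\<^sup>2) + \<bar>?h1 t\<bar> * y)) + s\<^sup>2 * (B * N * (2 * (s * \<bar>?h2 t\<bar>) * b0\<^sup>2 + \<bar>?h1 t\<bar> * b0))"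
          by (simp add: power2_eq_square algebra_simps)
        moreover have "s * \<bar>?h2 t\<bar> \<le> b0"
          using mult_mono[of s 1 "\<bar>?h2 t\<bar>" b0] s1 h2b[of t] by simp
        then have "B * N * (2 * (s * \<bar>?h2 t\<bar>) * b0\<^sup>2 + \<bar>?h1 t\<bar> * b0) \<le> B * N * (2 * b0 * b0\<^sup>2 + b0 * b0)"
          using h1b[of t] b00 B(1) N(1) by (intro mult_left_mono add_mono mult_right_mono) auto
        then have "s\<^sup>2 * (B * N * (2 * (s * \<bar>?h2 t\<bar>) * b0\<^sup>2 + \<bar>?h1 t\<bar> * b0)) \<le> s\<^sup>2 * (B * N * (2 * b0 * b0\<^sup>2 + b0 * b0))"
          by (rule mult_left_mono) simp
        ultimately show ?thesis by linarith
      qed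
      also have "density \<sigma> (?p t) (?v t) ?v' ?w' \<le> density \<sigma> (?p t) (?v t) (?v t) (w t)
          + s * (f t + 2 * \<sigma> * C * V * \<bar>?h1 t\<bar>) + s\<^sup>2 * (b0\<^sup>2 * C + \<sigma> * (b0\<^sup>2 * C))"
      proof -
        have "?h1 t * g (?p t) (?v t) z \<le> C * V * \<bar>?h1 t\<bar>"
        proof -
          have "\<bar>g (?p t) (?v t) z\<bar> \<le> C * V * 1"
            by (rule order_trans[OF upper]) (use V[of t] z nonneg V0 in \<open>intro mult_mono, auto\<close>)
          then have "\<bar>?h1 t\<bar> * \<bar>g (?p t) (?v t) z\<bar> \<le> \<bar>?h1 t\<bar> * (C * V)" by (intro mult_left_mono) auto
          then show ?thesis by (simp add: abs_mult[symmetric] mult.commute)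
        qed
        then have "2 * \<sigma> * (?h1 t * g (?p t) (?v t) z) \<le> 2 * \<sigma> * (C * V * \<bar>?h1 t\<bar>)"
          using \<sigma> by (intro mult_left_mono) auto
        then have 1: "s * (f t + 2 * \<sigma> * (?h1 t * g (?p t) (?v t) z)) \<le> s * (f t + 2 * \<sigma> * C * V * \<bar>?h1 t\<bar>)"
          using s by (intro mult_left_mono) (auto simp: mult.assoc)
        have k2: "k\<^sup>2 * g (?p t) z z \<le> b0\<^sup>2 * C" if "\<bar>k\<bar> \<le> b0" for k
          using power_mono[OF that abs_ge_zero, of 2] by (intro mult_mono zz g_nonneg) auto
        have "h t ^ 2 * g (?p t) z z + \<sigma> * ((?h1 t)\<^sup>2 * g (?p t) z z) \<le> b0\<^sup>2 * C + \<sigma> * (b0\<^sup>2 * C)"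
          using b0[of t] t h1b[of t] \<sigma> by (intro add_mono mult_left_mono k2) auto
        then have "s\<^sup>2 * ((h t)\<^sup>2 * g (?p t) z z + \<sigma> * ((?h1 t)\<^sup>2 * g (?p t) z z)) \<le> s\<^sup>2 * (b0\<^sup>2 * C + \<sigma> * (b0\<^sup>2 * C))"
          by (intro mult_left_mono) auto
        with 1 show ?thesis unfolding density_perturb f_def by linarith
      qed
      finally show ?thesis
        unfolding d_def e_def y_def by (simp add: algebra_simps)
    qed
    note pm = curve_measurable(1)[OF w, of a b] and vm = curve_measurable(2)[OF w, of b]
    note wm = square_integrable_measurable[OF w] and hm = square_integrable_measurable[OF h]
    have Am: "?A \<in> borel_measurable unit_measure"
      by (intro borel_measurable_add wm measurable_\<Gamma> pm vm)
    have gA: "\<bar>g (?p t) (?A t) z\<bar> \<le> C * (1 + K * V\<^sup>2) * (1 + norm (w t))" for t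
    proof -
      have "\<bar>g (?p t) (?A t) z\<bar> \<le> C * ((1 + K * V\<^sup>2) * (1 + norm (w t))) * 1"
        by (rule order_trans[OF upper])
          (use z nonneg norm_acceleration_le[OF V, of "w t" "?p t" t] in \<open>intro mult_mono, auto\<close>)
      then show ?thesis by (simp add: mult.assoc)
    qed
    have fi: "integrable unit_measure f"
    proof (rule Bochner_Integration.integrable_bound)
      show "integrable unit_measure (\<lambda>t. 2 * (b0 * (C * (1 + K * V\<^sup>2) * (1 + norm (w t)))))"
        using square_integrable_imp_integrable[OF wn] by simp
      show "f \<in> borel_measurable unit_measure"
        unfolding f_def[abs_def]
        by (intro borel_measurable_times borel_measurable_const hm measurable_g pm Am)
      show "AE t in unit_measure. norm (f t) \<le> norm (2 * (b0 * (C * (1 + K * V\<^sup>2) * (1 + norm (w t)))))"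
        using AE_unit_mem
      proof eventually_elim
        case (elim t)
        have "norm (f t) = 2 * (\<bar>h t\<bar> * \<bar>g (?p t) (?A t) z\<bar>)" by (simp add: f_def abs_mult)
        also have "\<dots> \<le> 2 * (b0 * (C * (1 + K * V\<^sup>2) * (1 + norm (w t))))"
          using b0[of t] elim gA[of t] b00 by (intro mult_left_mono mult_mono) auto
        finally show ?case by simp
      qed
    qed
    have ai: "integrable unit_measure (\<lambda>t. \<bar>?h1 t\<bar>)"
      using square_integrable_imp_integrable[OF p1] by simp
    have p1a: "square_integrable (\<lambda>t. \<bar>?h1 t\<bar>)" using square_integrable_norm[OF p1] by simp
    have bi: "integrable unit_measure (\<lambda>t. \<bar>?h1 t\<bar> * (1 + norm (w t)))"
      by (rule integrable_square_integrable_mult[OF p1a wn])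
    have ci: "integrable unit_measure (\<lambda>t. \<bar>?h2 t\<bar> * (1 + norm (w t))\<^sup>2)"
    proof (rule Bochner_Integration.integrable_bound)
      show "integrable unit_measure (\<lambda>t. b0 * (1 + norm (w t))\<^sup>2)" using wn2 by simp
      note [measurable] = wm square_integrable_measurable[OF p2]
      show "(\<lambda>t. \<bar>?h2 t\<bar> * (1 + norm (w t))\<^sup>2) \<in> borel_measurable unit_measure" by measurable
      show "AE t in unit_measure. norm (\<bar>?h2 t\<bar> * (1 + norm (w t))\<^sup>2) \<le> norm (b0 * (1 + norm (w t))\<^sup>2)"
        using h2b b00 by (intro AE_I2) (simp add: mult_right_mono)
    qed
    have di: "integrable unit_measure d" unfolding d_def[abs_def] using ai bi ci by simp
    have dS: "(LINT t|unit_measure. d t) \<le> (2 * E) * S"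
    proof -
      have one: "square_integrable (\<lambda>t. 1::real)" by (rule continuous_square_integrable) simp
      have 1: "(LINT t|unit_measure. \<bar>?h1 t\<bar>) \<le> S"
        using integral_Cauchy_Schwarz[OF p1a one] by (simp add: S_def)
      have 2: "(LINT t|unit_measure. \<bar>?h1 t\<bar> * (1 + norm (w t))) \<le> S * sqrt W"
        using integral_Cauchy_Schwarz[OF p1a wn] by (simp add: S_def W_def)
      have 3: "(LINT t|unit_measure. \<bar>?h2 t\<bar> * (1 + norm (w t))\<^sup>2) \<le> S * W"
      proof -
        have "(LINT t|unit_measure. \<bar>?h2 t\<bar> * (1 + norm (w t))\<^sup>2) \<le> (LINT t|unit_measure. S * (1 + norm (w t))\<^sup>2)"
          by (rule integral_mono[OF ci]) (use wn2 h2S in \<open>auto intro: mult_right_mono\<close>)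
        then show ?thesis by (simp add: W_def)
      qed
      have "(LINT t|unit_measure. d t) = 2 * \<sigma> * C * V * (LINT t|unit_measure. \<bar>?h1 t\<bar>) +
          B * N * (2 * (LINT t|unit_measure. \<bar>?h2 t\<bar> * (1 + norm (w t))\<^sup>2) + (LINT t|unit_measure. \<bar>?h1 t\<bar> * (1 + norm (w t))))"
        unfolding d_def using ai bi ci by simp
      also have "\<dots> \<le> 2 * \<sigma> * C * V * S + B * N * (2 * (S * W) + S * sqrt W)"
        using \<sigma> nonneg V0 B(1) N(1) by (intro add_mono mult_left_mono 1 2 3) auto
      finally show ?thesis by (simp add: E_def algebra_simps)
    qed
    have dens: "integrable unit_measure (\<lambda>t. density \<sigma> (?p t) (?v t) (?v t) (w t))"
      by (rule integrable_density[OF \<sigma> pm vm vm w V V])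
    have "0 \<le> (LINT t|unit_measure. f t + d t)"
    proof (rule first_order_nonneg[OF s0(1) e0])
      fix s assume s: "0 < s" "s \<le> s0"
      let ?w' = "\<lambda>t. w t + s *\<^sub>R (h t *\<^sub>R z)"
      have w'sq: "square_integrable ?w'" by (rule curve_perturb(1)[OF w h])
      obtain V' where V': "\<And>t. norm (primitive_velocity b ?w' t) \<le> V'" by (rule velocity_bounded[OF w'sq, of b]) blast
      have "integrable unit_measure (\<lambda>t. density \<sigma> (primitive_curve a b ?w' t) (primitive_velocity b ?w' t) (primitive_velocity b ?w' t) (?w' t))"
        by (rule integrable_density[OF \<sigma> _ _ _ w'sq V' V']) (intro curve_measurable w'sq)+
      then have dens': "integrable unit_measure (\<lambda>t. density \<sigma> (?p t + s *\<^sub>R (?h2 t *\<^sub>R z)) (?v t + s *\<^sub>R (?h1 t *\<^sub>R z)) (?v t + s *\<^sub>R (?h1 t *\<^sub>R z)) (?w' t))"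
        unfolding curve_perturb(2,3)[OF w h] .
      have rhs: "integrable unit_measure (\<lambda>t. s * (f t + d t) + s\<^sup>2 * e)" using fi di by simp
      have "curve_energy \<sigma> (a, b) ?w' = (LINT t|unit_measure. density \<sigma> (?p t + s *\<^sub>R (?h2 t *\<^sub>R z)) (?v t + s *\<^sub>R (?h1 t *\<^sub>R z)) (?v t + s *\<^sub>R (?h1 t *\<^sub>R z)) (?w' t))"
        unfolding curve_energy_def frozen_energy_def fst_conv snd_conv curve_perturb(2,3)[OF w h] ..
      also have "\<dots> \<le> (LINT t|unit_measure. density \<sigma> (?p t) (?v t) (?v t) (w t) + (s * (f t + d t) + s\<^sup>2 * e))"
      proof (rule integral_mono[OF dens' Bochner_Integration.integrable_add[OF dens rhs]])
        fix t assume "t \<in> space unit_measure"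
        then show "density \<sigma> (?p t + s *\<^sub>R (?h2 t *\<^sub>R z)) (?v t + s *\<^sub>R (?h1 t *\<^sub>R z)) (?v t + s *\<^sub>R (?h1 t *\<^sub>R z)) (?w' t)
            \<le> density \<sigma> (?p t) (?v t) (?v t) (w t) + (s * (f t + d t) + s\<^sup>2 * e)"
          using pw[OF s, of t] by simp
      qed
      also have "\<dots> = curve_energy \<sigma> (a, b) w + (LINT t|unit_measure. s * (f t + d t) + s\<^sup>2 * e)"
        unfolding curve_energy_def frozen_energy_def fst_conv snd_conv
        by (rule Bochner_Integration.integral_add[OF dens rhs])
      also have "(LINT t|unit_measure. s * (f t + d t) + s\<^sup>2 * e) = s * (LINT t|unit_measure. f t + d t) + s\<^sup>2 * e"
        using fi di by simp
      finally show "0 \<le> s * (LINT t|unit_measure. f t + d t) + s\<^sup>2 * e" using min[OF s(1)] by linarith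
    qed
    then have "0 \<le> (LINT t|unit_measure. f t) + (LINT t|unit_measure. d t)" using fi di by simp
    moreover have "(LINT t|unit_measure. f t) = 2 * (LINT t|unit_measure. h t * g (?p t) (?A t) z)"
      unfolding f_def by simp
    ultimately show "- (LINT t|unit_measure. h t * g (?p t) (?A t) z) \<le> E * sqrt (LINT t|unit_measure. (?h1 t)\<^sup>2)"
      using dS unfolding S_def[symmetric] by linarith
  qed
qed

text \<open>The curves that compete have the positions of the minimizer at the nodes, among them
  both end points, and its velocities at the end points, which all boundary conditions admit. The
  first variation gives the weak estimate for \<open>m\<close>, whence \<open>m\<close> is Hoelder
  continuous. Applying the inverse of the Riesz isomorphism and subtracting the Christoffel term,
  which are Lipschitz continuous along the curve, yields the acceleration.\<close>

theorem minimizer_acceleration_Hoelder: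
  assumes \<sigma>: "0 \<le> \<sigma>" and w: "square_integrable w"
    and N: "finite N" "N \<subseteq> {0..1}" "0 \<in> N" "1 \<in> N"
    and min: "\<And>w'. square_integrable w' \<Longrightarrow>
      (\<And>n. n \<in> N \<Longrightarrow> primitive_curve a b w' n = primitive_curve a b w n) \<Longrightarrow>
      primitive_velocity b w' 1 = primitive_velocity b w 1 \<Longrightarrow>
      curve_energy \<sigma> (a, b) w \<le> curve_energy \<sigma> (a, b) w'"
  obtains w0 H where "\<And>s t. s \<in> {0..1} \<Longrightarrow> t \<in> {0..1} \<Longrightarrow> norm (w0 s - w0 t) \<le> H * sqrt \<bar>s - t\<bar>"
    "AE t in unit_measure. w t = w0 t"
proof -
  interpret \<iota>: bounded_linear \<iota> by (rule \<iota>)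
  obtain NN where NN: "0 < NN" "\<And>v. norm (\<iota> v) \<le> norm v * NN" using \<iota>.pos_bounded by blast
  let ?p = "primitive_curve a b w" and ?v = "primitive_velocity b w"
  let ?A = "\<lambda>t. w t + \<Gamma> (?p t) (?v t)"
  define m where "m t = riesz (?p t) (?A t)" for t
  note pm = curve_measurable(1)[OF w, of a b] and vm = curve_measurable(2)[OF w, of b]
  note wm = square_integrable_measurable[OF w]
  have Am: "?A \<in> borel_measurable unit_measure"
    by (intro borel_measurable_add wm measurable_\<Gamma> pm vm)
  obtain V where V: "\<And>t. norm (?v t) \<le> V" by (rule velocity_bounded[OF w, of b]) blast
  note wn = square_integrable_one_plus_norm[OF w]
  have msq: "square_integrable m"
  proof (rule square_integrable_bound[where S="\<lambda>t. (C * (1 + K * V\<^sup>2))\<^sup>2 * (1 + norm (w t))\<^sup>2"])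
    show "m \<in> borel_measurable unit_measure"
      unfolding m_def[abs_def] by (intro measurable_riesz pm Am)
    show "integrable unit_measure (\<lambda>t. (C * (1 + K * V\<^sup>2))\<^sup>2 * (1 + norm (w t))\<^sup>2)"
      using square_integrable_norm_sq[OF wn] by simp
    show "AE t in unit_measure. (norm (m t))\<^sup>2 \<le> (C * (1 + K * V\<^sup>2))\<^sup>2 * (1 + norm (w t))\<^sup>2"
    proof (rule AE_I2)
      fix t
      have "norm (m t) \<le> C * norm (?A t)" unfolding m_def by (rule norm_riesz_le)
      also have "\<dots> \<le> C * ((1 + K * V\<^sup>2) * (1 + norm (w t)))"
        by (intro mult_left_mono norm_acceleration_le V nonneg)
      finally have "(norm (m t))\<^sup>2 \<le> (C * ((1 + K * V\<^sup>2) * (1 + norm (w t))))\<^sup>2" by (intro power_mono) auto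
      then show "(norm (m t))\<^sup>2 \<le> (C * (1 + K * V\<^sup>2))\<^sup>2 * (1 + norm (w t))\<^sup>2"
        by (simp only: mult.assoc[symmetric] power_mult_distrib)
    qed
  qed
  obtain E where E: "0 \<le> E"
    "\<And>h z. square_integrable h \<Longrightarrow> bounded (h ` {0..1}) \<Longrightarrow> norm z \<le> 1 \<Longrightarrow>
      (\<And>s. 0 < s \<Longrightarrow> curve_energy \<sigma> (a, b) w \<le> curve_energy \<sigma> (a, b) (\<lambda>t. w t + s *\<^sub>R (h t *\<^sub>R z))) \<Longrightarrow>
      - (LINT t|unit_measure. h t * g (?p t) (?A t) z) \<le> E * sqrt (LINT t|unit_measure. (primitive h t)\<^sup>2)"
    by (rule first_variation_bound[OF \<sigma> w, of a b]) blast
  have weak: "norm (LINT t|unit_measure. h t *\<^sub>R m t) \<le> E * sqrt (LINT t|unit_measure. (primitive h t)\<^sup>2)"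
    if h: "square_integrable h" "bounded (h ` {0..1})" "primitive h 1 = 0"
      and hN: "\<And>n. n \<in> N \<Longrightarrow> primitive (primitive h) n = 0" for h
  proof -
    let ?I = "LINT t|unit_measure. h t *\<^sub>R m t"
    note hmi = integrable_square_integrable_scaleR[OF h(1) msq]
    have Iz: "inner ?I z = (LINT t|unit_measure. h t * g (?p t) (?A t) z)" for z
    proof -
      have "inner ?I z = (LINT t|unit_measure. inner (h t *\<^sub>R m t) z)"
        by (rule integral_inner_left[symmetric]) (rule hmi)
      then show ?thesis by (simp add: m_def inner_riesz)
    qed
    have bound: "- inner ?I z \<le> E * sqrt (LINT t|unit_measure. (primitive h t)\<^sup>2)" if "norm z \<le> 1" for z
      unfolding Iz
    proof (rule E(2)[OF h(1,2) that])
      fix s :: real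
      show "curve_energy \<sigma> (a, b) w \<le> curve_energy \<sigma> (a, b) (\<lambda>t. w t + s *\<^sub>R (h t *\<^sub>R z))"
        by (rule min[OF curve_perturb(1)[OF w h(1)]])
          (simp_all add: curve_perturb(2,3)[OF w h(1)] hN h(3) del: scaleR_scaleR)
    qed
    show ?thesis
    proof (cases "?I = 0")
      case True
      have "0 \<le> E * sqrt (LINT t|unit_measure. (primitive h t)\<^sup>2)"
        using E(1) by (intro mult_nonneg_nonneg real_sqrt_ge_zero integral_nonneg_AE) auto
      then show ?thesis unfolding True by simp
    next
      case False
      \<comment> \<open>The estimate is applied to the unit vector opposite to the
        integral.\<close>
      have "norm ?I * norm ?I = inner ?I ?I" by (simp only: power2_norm_eq_inner[symmetric] power2_eq_square)
      then have "norm ?I = - inner ?I (- ((1 / norm ?I) *\<^sub>R ?I))"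
        using False by (simp only: inner_minus_right inner_scaleR_right minus_minus) (simp add: field_simps)
      also have "\<dots> \<le> E * sqrt (LINT t|unit_measure. (primitive h t)\<^sup>2)"
        by (rule bound) (use False in simp)
      finally show ?thesis .
    qed
  qed
  obtain H where H: "0 \<le> H" "\<And>h. square_integrable h \<Longrightarrow> bounded (range h) \<Longrightarrow> primitive h 1 = 0 \<Longrightarrow>
      norm (LINT t|unit_measure. h t *\<^sub>R m t) \<le> H * sqrt (LINT t|unit_measure. (primitive h t)\<^sup>2)"
    by (rule remove_interpolation_constraints[OF msq N E(1) weak]) blast+
  obtain m0 where m0: "\<And>s t. s \<in> {0..1} \<Longrightarrow> t \<in> {0..1} \<Longrightarrow> norm (m0 s - m0 t) \<le> H * sqrt \<bar>s - t\<bar>"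
    and m_eq: "AE t in unit_measure. m t = m0 t"
    by (rule Hoelder_representative[OF msq H(2) H(1)]) blast+
  have "\<exists>a0. riesz (?p t) a0 = m0 t" for t using riesz_inverse by metis
  then obtain A0 where A0: "\<And>t. riesz (?p t) (A0 t) = m0 t" by metis
  define R where "R = pair_norm_sq (a, b) w"
  have R0: "0 \<le> R" unfolding R_def by (rule pair_norm_sq_nonneg)
  have RR: "pair_norm_sq (a, b) w \<le> R" by (simp add: R_def)
  note cb = curve_bounds[OF w RR]
  have \<iota>H: "norm (\<iota> x - \<iota> y) \<le> NN * (2 * R + 2) * r" if "norm (x - y) \<le> (2 * R + 2) * r" for x y r
  proof -
    have "norm (\<iota> x - \<iota> y) \<le> norm (x - y) * NN" using NN(2)[of "x - y"] by (simp add: \<iota>.diff)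
    also have "\<dots> \<le> (2 * R + 2) * r * NN" using that NN(1) by (intro mult_right_mono) auto
    finally show ?thesis by (simp add: ac_simps)
  qed
  define Q where "Q = NN * (2 * R + 2)"
  have Q0: "0 \<le> Q" using NN(1) R0 by (simp add: Q_def)
  have pH: "norm (\<iota> (?p s) - \<iota> (?p t)) \<le> Q * sqrt \<bar>s - t\<bar>"
    and vH: "norm (\<iota> (?v s) - \<iota> (?v t)) \<le> Q * sqrt \<bar>s - t\<bar>" if "s \<in> {0..1}" "t \<in> {0..1}" for s t
    unfolding Q_def by (intro \<iota>H cb(4,5) that)+
  define M where "M = (norm (m0 0) + H) / c"
  have A0b: "norm (A0 t) \<le> M" if "t \<in> {0..1}" for t
  proof -
    have r0: "riesz (?p t) 0 = 0" using riesz_diff[of "?p t" 0 0] by simp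
    have "H * sqrt \<bar>t - 0\<bar> \<le> H * 1" using H(1) that by (intro mult_left_mono) auto
    then have "norm (m0 t) \<le> norm (m0 0) + H"
      using m0[OF that, of 0] norm_triangle_sub[of "m0 t" "m0 0"] by simp
    then show ?thesis
      using riesz_lower[of "A0 t" 0 "?p t" "?p t"] c_pos unfolding M_def A0 r0
      by (simp add: divide_right_mono order_trans[OF _ divide_right_mono])
  qed
  have M0: "0 \<le> M" using H(1) c_pos by (simp add: M_def)
  define w0 where "w0 t = A0 t - \<Gamma> (?p t) (?v t)" for t
  define H0 where "H0 = (H + L * Q * M) / c + K * (Q * (V\<^sup>2 + V\<^sup>2) + Q * (V + V))"
  have V0: "0 \<le> V" using order_trans[OF norm_ge_zero V] .
  show ?thesis
  proof (rule that[of w0 H0])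
    fix s t :: real assume st: "s \<in> {0..1}" "t \<in> {0..1}"
    define r where "r = sqrt \<bar>s - t\<bar>"
    have r0: "0 \<le> r" by (simp add: r_def)
    have "norm (A0 s - A0 t) \<le> (norm (m0 s - m0 t) + L * norm (\<iota> (?p s) - \<iota> (?p t)) * norm (A0 t)) / c"
      using riesz_lower[of "A0 s" "A0 t" "?p s" "?p t"] by (simp add: A0)
    also have "\<dots> \<le> (H * r + L * (Q * r) * M) / c"
      using m0[OF st] pH[OF st] A0b[OF st(2)] nonneg c_pos Q0 r0 unfolding r_def[symmetric]
      by (intro divide_right_mono add_mono mult_mono mult_left_mono) auto
    finally have 1: "norm (A0 s - A0 t) \<le> (H + L * Q * M) / c * r" by (simp add: algebra_simps)
    have "norm (\<Gamma> (?p s) (?v s) - \<Gamma> (?p t) (?v t)) \<le>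
        K * (norm (\<iota> (?p s) - \<iota> (?p t)) * ((norm (?v s))\<^sup>2 + (norm (?v t))\<^sup>2) + norm (\<iota> (?v s) - \<iota> (?v t)) * (norm (?v s) + norm (?v t)))"
      by (rule \<Gamma>_lipschitz)
    also have "\<dots> \<le> K * ((Q * r) * (V\<^sup>2 + V\<^sup>2) + (Q * r) * (V + V))"
      using pH[OF st] vH[OF st] V Q0 r0 V0 nonneg unfolding r_def[symmetric]
      by (intro mult_left_mono add_mono mult_mono power_mono) auto
    finally have 2: "norm (\<Gamma> (?p s) (?v s) - \<Gamma> (?p t) (?v t)) \<le> K * (Q * (V\<^sup>2 + V\<^sup>2) + Q * (V + V)) * r"
      by (simp add: algebra_simps)
    have "w0 s - w0 t = (A0 s - A0 t) - (\<Gamma> (?p s) (?v s) - \<Gamma> (?p t) (?v t))" by (simp add: w0_def)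
    then have "norm (w0 s - w0 t) \<le> norm (A0 s - A0 t) + norm (\<Gamma> (?p s) (?v s) - \<Gamma> (?p t) (?v t))"
      by (metis norm_triangle_ineq4)
    also have "\<dots> \<le> H0 * r" using 1 2 unfolding H0_def distrib_right by linarith
    finally show "norm (w0 s - w0 t) \<le> H0 * sqrt \<bar>s - t\<bar>" by (simp add: r_def)
  next
    show "AE t in unit_measure. w t = w0 t"
      using m_eq
    proof eventually_elim
      case (elim t)
      then have "riesz (?p t) (?A t) = riesz (?p t) (A0 t)" by (simp add: m_def A0)
      then have "norm (?A t - A0 t) \<le> 0" using riesz_lower[of "?A t" "A0 t" "?p t" "?p t"] by simp
      then show ?case by (simp add: w0_def algebra_simps)
    qed
  qed
qed

end

section \<open>Spline interpolations\<close>

text \<open>The boundary conditions in the coordinates of \<open>primitive_curve\<close>; they are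
  affine, whereas \<open>satisfies_bc\<close> refers to the derivative of the curve.\<close>

primrec curve_satisfies_bc ::
  "'v boundary_condition \<Rightarrow> 'v::{banach, second_countable_topology} \<Rightarrow> 'v \<Rightarrow> (real \<Rightarrow> 'v) \<Rightarrow> bool"
  where
    "curve_satisfies_bc Natural a b w \<longleftrightarrow> True"
  | "curve_satisfies_bc (Hermite v0 v1) a b w \<longleftrightarrow>
      primitive_velocity b w 0 = v0 \<and> primitive_velocity b w 1 = v1"
  | "curve_satisfies_bc Periodic a b w \<longleftrightarrow>
      primitive_curve a b w 0 = primitive_curve a b w 1 \<and> primitive_velocity b w 0 = primitive_velocity b w 1"

definition interpolation_data ::
  "nat \<Rightarrow> (nat \<Rightarrow> real) \<Rightarrow> (nat \<Rightarrow> 'v) \<Rightarrow> 'v boundary_condition \<Rightarrow>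
    (('v \<times> 'v::{banach, second_countable_topology}) \<times> (real \<Rightarrow> 'v)) set"
  where "interpolation_data I t ybar bc = {(x, w). square_integrable w \<and>
    (\<forall>i\<in>{1..I}. primitive_curve (fst x) (snd x) w (t i) = ybar i) \<and>
    curve_satisfies_bc bc (fst x) (snd x) w}"

lemma curve_satisfies_bc_iff:
  assumes w: "square_integrable w" and y: "\<And>t. t \<in> {0..1} \<Longrightarrow> y t = primitive_curve a b w t"
  shows "satisfies_bc bc y \<longleftrightarrow> curve_satisfies_bc bc a b w"
proof -
  have "velocity y 0 = primitive_velocity b w 0" "velocity y 1 = primitive_velocity b w 1"
    by (rule velocity_primitive_curve[OF w y], simp_all)+
  then show ?thesis using y[of 0] y[of 1] by (cases bc) auto
qed

lemma interpolation_data_midpoint: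
  assumes d: "(x, w) \<in> interpolation_data I t ybar bc" "(x', w') \<in> interpolation_data I t ybar bc"
  shows "((1/2) *\<^sub>R (x + x'), \<lambda>t. (1/2) *\<^sub>R (w t + w' t)) \<in> interpolation_data I t ybar bc"
proof -
  obtain a b a' b' where x: "x = (a, b)" "x' = (a', b')" by (cases x, cases x')
  have w: "square_integrable w" "square_integrable w'" using d by (auto simp: interpolation_data_def)
  have "square_integrable (\<lambda>t. (1/2) *\<^sub>R (w t + w' t))"
    by (intro square_integrable_scaleR square_integrable_add w)
  moreover have "curve_satisfies_bc bc ((1/2) *\<^sub>R (a + a')) ((1/2) *\<^sub>R (b + b')) (\<lambda>t. (1/2) *\<^sub>R (w t + w' t))"
  proof (cases bc)
    case Natural
    then show ?thesis by simp
  next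
    case (Hermite v0 v1)
    then show ?thesis using d unfolding Hermite curve_satisfies_bc.simps curve_midpoint[OF w]
      by (auto simp: interpolation_data_def x scaleR_half_double)
  next
    case Periodic
    then show ?thesis using d unfolding Periodic curve_satisfies_bc.simps curve_midpoint[OF w]
      by (auto simp: interpolation_data_def x)
  qed
  ultimately show ?thesis
    using d unfolding interpolation_data_def x
    by (simp add: curve_midpoint[OF w] scaleR_half_double del: scaleR_add_right)
qed

lemma interpolation_data_closed:
  assumes d: "\<And>k. (x k, z k) \<in> interpolation_data I t ybar bc" and x: "x \<longlonglongrightarrow> x0" and w: "square_integrable w"
    and S: "integrable unit_measure S"
    and AE: "AE t in unit_measure. (\<forall>k. (norm (z k t))\<^sup>2 \<le> S t) \<and> (\<lambda>k. z k t) \<longlonglongrightarrow> w t"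
  shows "(x0, w) \<in> interpolation_data I t ybar bc"
proof -
  have z: "square_integrable (z k)" for k using d[of k] by (auto simp: interpolation_data_def)
  have fs: "(\<lambda>k. fst (x k)) \<longlonglongrightarrow> fst x0" "(\<lambda>k. snd (x k)) \<longlonglongrightarrow> snd x0"
    using x by (auto intro: tendsto_fst tendsto_snd)
  have vel: "(\<lambda>k. primitive_velocity (snd (x k)) (z k) t) \<longlonglongrightarrow> primitive_velocity (snd x0) w t"
    and pos: "(\<lambda>k. primitive_curve (fst (x k)) (snd (x k)) (z k) t) \<longlonglongrightarrow> primitive_curve (fst x0) (snd x0) w t" for t
    by (rule curve_tendsto(1)[OF z w S AE fs], rule curve_tendsto(2)[OF z w S AE fs])
  have "primitive_curve (fst x0) (snd x0) w (t i) = ybar i" if "i \<in> {1..I}" for i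
  proof (rule LIMSEQ_unique[OF pos])
    have "primitive_curve (fst (x k)) (snd (x k)) (z k) (t i) = ybar i" for k
      using d[of k] that by (auto simp: interpolation_data_def)
    then show "(\<lambda>k. primitive_curve (fst (x k)) (snd (x k)) (z k) (t i)) \<longlonglongrightarrow> ybar i" by simp
  qed
  moreover have "curve_satisfies_bc bc (fst x0) (snd x0) w"
  proof (cases bc)
    case Natural
    then show ?thesis by simp
  next
    case (Hermite v0 v1)
    have "primitive_velocity (snd (x k)) (z k) 0 = v0" "primitive_velocity (snd (x k)) (z k) 1 = v1" for k
      using d[of k] by (auto simp: interpolation_data_def Hermite)
    then show ?thesis using vel[of 0] vel[of 1] by (simp add: Hermite LIMSEQ_const_iff)
  next
    case Periodic
    have eq: "primitive_curve (fst (x k)) (snd (x k)) (z k) 0 = primitive_curve (fst (x k)) (snd (x k)) (z k) 1"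
      "primitive_velocity (snd (x k)) (z k) 0 = primitive_velocity (snd (x k)) (z k) 1" for k
      using d[of k] by (auto simp: interpolation_data_def Periodic)
    show ?thesis using LIMSEQ_unique[OF pos[of 0] pos[of 1, folded eq(1)]] LIMSEQ_unique[OF vel[of 0] vel[of 1, folded eq(2)]]
      by (simp add: Periodic)
  qed
  ultimately show ?thesis using w by (auto simp: interpolation_data_def)
qed

text \<open>In the periodic case a common value at both end points has to be chosen. It is
  prescribed at most at one of them, since not both are interpolation times.\<close>

lemma interpolation_data_nonempty:
  fixes ybar :: "nat \<Rightarrow> 'v::{banach, second_countable_topology}"
  assumes I: "I > 2" and t: "0 \<le> t 1" "strict_mono_on {1..I} t" "t I \<le> 1" and bc: "bc_times_ok bc (t 1) (t I)"
  shows "interpolation_data I t ybar bc \<noteq> {}"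
proof -
  define T where "T = t ` {1..I}"
  have mono: "t i \<le> t j" if "i \<le> j" "i \<in> {1..I}" "j \<in> {1..I}" for i j
    using strict_mono_on_leD[OF t(2)] that by blast
  have T01: "T \<subseteq> {0..1}"
  proof
    fix s assume "s \<in> T"
    then obtain i where "s = t i" "i \<in> {1..I}" by (auto simp: T_def)
    then show "s \<in> {0..1}" using mono[of 1 i] mono[of i I] I t by auto
  qed
  have inj: "inj_on t {1..I}" by (rule strict_mono_on_imp_inj_on[OF t(2)])
  have T0: "0 \<in> T \<longleftrightarrow> t 1 = 0"
  proof
    assume "0 \<in> T"
    then obtain i where "t i = 0" "i \<in> {1..I}" by (auto simp: T_def)
    then show "t 1 = 0" using mono[of 1 i] I t(1) by auto
  qed (use I in \<open>force simp: T_def\<close>)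
  have T1: "1 \<in> T \<longleftrightarrow> t I = 1"
  proof
    assume "1 \<in> T"
    then obtain i where "t i = 1" "i \<in> {1..I}" by (auto simp: T_def)
    then show "t I = 1" using mono[of i I] I t(3) by auto
  qed (use I in \<open>force simp: T_def\<close>)
  define q where "q = (if t 1 = 0 then ybar 1 else if t I = 1 then ybar I else 0)"
  define f where "f s = (if s \<in> T then ybar (the_inv_into {1..I} t s) else q)" for s
  define d where "d s = (case bc of Hermite v0 v1 \<Rightarrow> if s = 0 then v0 else v1 | _ \<Rightarrow> 0)" for s :: real
  have ft: "f (t i) = ybar i" if "i \<in> {1..I}" for i
  proof -
    have "t i \<in> T" using that by (auto simp: T_def)
    then show ?thesis unfolding f_def by (simp only: if_True the_inv_into_f_f[OF inj that])
  qed
  obtain a b w where w: "square_integrable w"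
    "\<And>n. n \<in> insert 0 (insert 1 T) \<Longrightarrow> primitive_curve a b w n = f n"
    "\<And>n. n \<in> insert 0 (insert 1 T) \<Longrightarrow> primitive_velocity b w n = d n"
    by (rule Hermite_interpolation_curve[of "insert 0 (insert 1 T)" f d]) (use T01 in \<open>auto simp: T_def\<close>)
  have "f 0 = f 1" if "bc = Periodic"
  proof -
    have "t 1 \<noteq> 0 \<or> t I \<noteq> 1" using bc that by simp
    moreover have "f 0 = ybar 1" if "t 1 = 0" using ft[of 1] that I by simp
    moreover have "f 1 = ybar I" if "t I = 1" using ft[of I] that I by simp
    moreover have "f 0 = q" if "t 1 \<noteq> 0" using that T0 by (simp add: f_def)
    moreover have "f 1 = q" if "t I \<noteq> 1" using that T1 by (simp add: f_def)
    ultimately show ?thesis unfolding q_def by metis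
  qed
  then have "curve_satisfies_bc bc a b w"
    using w(2)[of 0] w(2)[of 1] w(3)[of 0] w(3)[of 1] by (cases bc) (auto simp: d_def)
  then have "((a, b), w) \<in> interpolation_data I t ybar bc"
    using w(1,2) ft by (auto simp: interpolation_data_def T_def)
  then show ?thesis by blast
qed

text \<open>Both parts of the energy have integrable densities, so the sum of the integrals is the
  integral of the sum.\<close>

lemma reg_spline_energy_eq_curve_energy:
  assumes "spline_metric \<iota> g (\<lambda>p v. christoffel g p v v) c C L K" and \<sigma>: "0 \<le> \<sigma>"
    and w: "square_integrable w" and y: "\<And>t. t \<in> {0..1} \<Longrightarrow> y t = primitive_curve a b w t"
  shows "reg_spline_energy \<sigma> g y = spline_metric.curve_energy g (\<lambda>p v. christoffel g p v v) \<sigma> (a, b) w"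
proof -
  interpret spline_metric \<iota> g "\<lambda>p v. christoffel g p v v" c C L K by fact
  let ?p = "primitive_curve a b w" and ?v = "primitive_velocity b w"
  let ?G = "\<lambda>t. christoffel g (?p t) (?v t) (?v t)"
  note m = curve_measurable[OF w]
  have wd: "AE t in unit_measure. weak_derivative (velocity y) t = w t"
    "weak_derivative (velocity y) \<in> borel_measurable unit_measure"
    by (rule weak_derivative_velocity[OF w], rule y, assumption)+
  have vel: "velocity y t = ?v t" if "t \<in> {0..1}" for t
    by (rule velocity_primitive_curve[OF w y that])
  have Gm: "?G \<in> borel_measurable unit_measure" by (intro measurable_\<Gamma> m)
  obtain V where V: "\<And>t. norm (?v t) \<le> V" by (rule velocity_bounded[OF w, of b]) blast
  have path: "path_energy g y = (LINT t|unit_measure. g (?p t) (?v t) (?v t))"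
    unfolding path_energy_def by (rule Bochner_Integration.integral_cong) (auto simp: y vel)
  have "spline_energy g y = (LINT t|unit_measure. g (?p t) (weak_derivative (velocity y) t + ?G t) (weak_derivative (velocity y) t + ?G t))"
    unfolding spline_energy_def covariant_accel_def
    by (rule Bochner_Integration.integral_cong) (auto simp: y vel)
  also have "\<dots> = (LINT t|unit_measure. g (?p t) (w t + ?G t) (w t + ?G t))"
  proof (rule integral_cong_AE)
    show "AE t in unit_measure. g (?p t) (weak_derivative (velocity y) t + ?G t) (weak_derivative (velocity y) t + ?G t)
        = g (?p t) (w t + ?G t) (w t + ?G t)"
      using wd(1) by eventually_elim simp
  qed (intro measurable_g m borel_measurable_add wd(2) Gm square_integrable_measurable w)+
  finally have spline: "spline_energy g y = (LINT t|unit_measure. g (?p t) (w t + ?G t) (w t + ?G t))" .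
  have i0: "integrable unit_measure (\<lambda>t. g (?p t) (w t + ?G t) (w t + ?G t))"
    using integrable_density[OF order_refl m(1) m(2) m(2) w V V, of a] by (simp add: density_def)
  have i1: "integrable unit_measure (\<lambda>t. g (?p t) (?v t) (?v t))"
  proof -
    have "integrable unit_measure (\<lambda>t. density 1 (?p t) (?v t) (?v t) (w t) - g (?p t) (w t + ?G t) (w t + ?G t))"
      by (rule Bochner_Integration.integrable_diff[OF integrable_density[OF zero_le_one m(1) m(2) m(2) w V V] i0])
    then show ?thesis by (simp add: density_def)
  qed
  show ?thesis
    unfolding reg_spline_energy_def spline path curve_energy_def frozen_energy_def density_def fst_conv snd_conv
    using i0 i1 by simp
qed

lemma Hoelder_acceleration_imp_holder_C2:
  assumes w: "square_integrable w" and w0: "\<And>s t. s \<in> {0..1} \<Longrightarrow> t \<in> {0..1} \<Longrightarrow> norm (w0 s - w0 t) \<le> H * sqrt \<bar>s - t\<bar>"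
    and AE: "AE t in unit_measure. w t = w0 t" and S: "S \<subseteq> {0..1}"
  shows "holder_C2 (1/2) S (primitive_curve a b w)"
  unfolding holder_C2_def
proof (intro exI conjI ballI)
  have c0: "continuous_on {0..1} w0" by (rule Hoelder_imp_continuous_on[OF w0])
  note i0 = continuous_integrable_unit[OF c0]
  have v: "primitive_velocity b w = (\<lambda>t. b + primitive w0 t)"
    unfolding primitive_velocity_def
    by (rule ext) (simp add: primitive_cong_AE[OF AE square_integrable_measurable[OF w] borel_measurable_integrable[OF i0]])
  fix t assume t: "t \<in> S"
  then have t01: "t \<in> {0..1}" using S by auto
  show "(primitive_curve a b w has_vector_derivative primitive_velocity b w t) (at t within S)"
    by (rule has_vector_derivative_within_subset[OF primitive_curve_has_vector_derivative[OF w t01] S])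
  have "((\<lambda>t. b + primitive w0 t) has_vector_derivative 0 + w0 t) (at t within {0..1})"
    by (rule has_vector_derivative_add[OF has_vector_derivative_const primitive_has_vector_derivative[OF i0 c0 t01]])
  then show "(primitive_velocity b w has_vector_derivative w0 t) (at t within S)"
    unfolding v using has_vector_derivative_within_subset S by fastforce
next
  show "continuous_on S w0" by (rule continuous_on_subset[OF Hoelder_imp_continuous_on[OF w0] S])
  show "norm (w0 s - w0 t) \<le> H * \<bar>s - t\<bar> powr (1/2)" if "s \<in> S" "t \<in> S" for s t
  proof -
    have "norm (w0 s - w0 t) \<le> H * sqrt \<bar>s - t\<bar>" by (rule w0) (use that S in auto)
    then show ?thesis by (simp add: powr_half_sqrt)
  qed
qed

text \<open>The set of interpolation data is convex and closed, so it contains a minimizer of the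
  energy, and the nodes for the regularity are the interpolation times together with the end
  points.\<close>

theorem theorem2p19:
  fixes \<iota> :: "'v::{real_inner, banach, second_countable_topology} \<Rightarrow> 'y::banach"
    and g :: "'v \<Rightarrow> 'v \<Rightarrow> 'v \<Rightarrow> real"
    and \<sigma> :: real
    and I :: nat
    and t :: "nat \<Rightarrow> real"
    and ybar :: "nat \<Rightarrow> 'v"
    and bc :: "'v boundary_condition"
  assumes "compact_embedding \<iota>"
    and "admissible_metric \<iota> g"
    and "\<sigma> > 0"
    and "I > 2"
    and "0 \<le> t 1" and "strict_mono_on {1..I} t" and "t I \<le> 1"
    and "bc_times_ok bc (t 1) (t I)"
  shows "\<exists>y. is_spline_interpolation \<sigma> g I t ybar bc y \<and>
           (\<forall>\<delta>\<in>{0<..<1/2}. holder_C2 (1/2) {\<delta>..1 - \<delta>} y)"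
proof -
  let ?\<Gamma> = "\<lambda>p v. christoffel g p v v"
  obtain c C L K where loc: "spline_metric \<iota> g ?\<Gamma> c C L K"
    by (rule admissible_metric_imp_spline_metric[OF assms(1,2)])
  interpret spline_metric \<iota> g ?\<Gamma> c C L K by (rule loc)
  let ?A = "interpolation_data I t ybar bc"
  have ti: "t i \<in> {0..1}" if "i \<in> {1..I}" for i
    using strict_mono_on_leD[OF assms(6), of 1 i] strict_mono_on_leD[OF assms(6), of i I] that assms(4,5,7) by auto
  note energy = reg_spline_energy_eq_curve_energy[OF loc less_imp_le[OF assms(3)]]
  obtain x w where xw: "(x, w) \<in> ?A"
    and min: "\<And>x' w'. (x', w') \<in> ?A \<Longrightarrow> curve_energy \<sigma> x w \<le> curve_energy \<sigma> x' w'"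
  proof (rule curve_energy_minimizer[of \<sigma> ?A "t 1" "norm (ybar 1)"])
    show "compact_operator \<iota>" using assms(1) by (simp add: compact_embedding_def)
    show "?A \<noteq> {}" by (rule interpolation_data_nonempty[OF assms(4-8)])
    show "norm (primitive_curve (fst x) (snd x) w (t 1)) \<le> norm (ybar 1)" if "(x, w) \<in> ?A" for x w
    proof -
      have "primitive_curve (fst x) (snd x) w (t 1) = ybar 1" using that assms(4) by (simp add: interpolation_data_def)
      then show ?thesis by simp
    qed
    show "square_integrable w" if "(x, w) \<in> ?A" for x w using that by (simp add: interpolation_data_def)
    show "((1/2) *\<^sub>R (x + x'), \<lambda>t. (1/2) *\<^sub>R (w t + w' t)) \<in> ?A"
      if "(x, w) \<in> ?A" "(x', w') \<in> ?A" for x w x' w'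
      by (rule interpolation_data_midpoint[OF that])
    show "(x0, w) \<in> ?A" if "\<And>k. (x k, z k) \<in> ?A" "x \<longlonglongrightarrow> x0" "square_integrable w"
      "integrable unit_measure S"
      "AE t in unit_measure. (\<forall>k. (norm (z k t))\<^sup>2 \<le> S t) \<and> (\<lambda>k. z k t) \<longlonglongrightarrow> w t" for x z x0 w S
      by (rule interpolation_data_closed[OF that])
    show "0 < \<sigma>" "0 \<le> t 1" "0 \<le> norm (ybar 1)" using assms by auto
  qed blast
  obtain a b where x: "x = (a, b)" by (cases x)
  define y where "y = primitive_curve a b w"
  have w: "square_integrable w" and yi: "\<And>i. i \<in> {1..I} \<Longrightarrow> y (t i) = ybar i" and ybc: "curve_satisfies_bc bc a b w"
    using xw by (auto simp: interpolation_data_def x y_def)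
  have yy: "y s = primitive_curve a b w s" for s by (simp add: y_def)
  have "is_spline_interpolation \<sigma> g I t ybar bc y"
    unfolding is_spline_interpolation_def
  proof (intro conjI ballI)
    show "y \<in> interpolating_curves I t ybar bc"
      unfolding interpolating_curves_def
      using primitive_curve_in_W22[OF w yy] yi ybc curve_satisfies_bc_iff[OF w yy, of bc] by auto
    fix z assume z: "z \<in> interpolating_curves I t ybar bc"
    then have "z \<in> W22" by (simp add: interpolating_curves_def)
    then obtain a' b' w' where w': "square_integrable w'" and zz: "\<And>s. s \<in> {0..1} \<Longrightarrow> z s = primitive_curve a' b' w' s"
      by (rule W22_imp_primitive_curve) blast
    have "((a', b'), w') \<in> ?A"
      using z w' zz ti curve_satisfies_bc_iff[OF w' zz, of bc]
      unfolding interpolation_data_def interpolating_curves_def by auto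
    from min[OF this] have "curve_energy \<sigma> (a, b) w \<le> curve_energy \<sigma> (a', b') w'" unfolding x .
    moreover have "reg_spline_energy \<sigma> g y = curve_energy \<sigma> (a, b) w" by (rule energy[OF w yy])
    moreover have "reg_spline_energy \<sigma> g z = curve_energy \<sigma> (a', b') w'" by (rule energy[OF w' zz])
    ultimately show "reg_spline_energy \<sigma> g y \<le> reg_spline_energy \<sigma> g z" by simp
  qed
  moreover have "holder_C2 (1/2) {\<delta>..1 - \<delta>} y" if "\<delta> \<in> {0<..<1/2}" for \<delta>
  proof -
    let ?N = "insert 0 (insert 1 (t ` {1..I}))"
    obtain w0 H where w0: "\<And>s t. s \<in> {0..1} \<Longrightarrow> t \<in> {0..1} \<Longrightarrow> norm (w0 s - w0 t) \<le> H * sqrt \<bar>s - t\<bar>"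
      and AE: "AE t in unit_measure. w t = w0 t"
    proof (rule minimizer_acceleration_Hoelder[OF less_imp_le[OF assms(3)] w, of ?N a b])
      show "finite ?N" "0 \<in> ?N" "1 \<in> ?N" by auto
      show "?N \<subseteq> {0..1}" using ti by auto
      fix w' assume w': "square_integrable w'"
        and n: "\<And>n. n \<in> ?N \<Longrightarrow> primitive_curve a b w' n = primitive_curve a b w n"
        and v: "primitive_velocity b w' 1 = primitive_velocity b w 1"
      have v0: "primitive_velocity b w' 0 = primitive_velocity b w 0" by (simp add: primitive_velocity_def)
      have "curve_satisfies_bc bc a b w'"
        using ybc n[of 0] n[of 1] v v0 by (cases bc) auto
      moreover have "primitive_curve a b w' (t i) = ybar i" if "i \<in> {1..I}" for i
        using n[of "t i"] yi[OF that] that by (simp add: y_def)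
      ultimately have "((a, b), w') \<in> ?A" using w' by (simp add: interpolation_data_def)
      then show "curve_energy \<sigma> (a, b) w \<le> curve_energy \<sigma> (a, b) w'" using min unfolding x by blast
    qed blast
    show ?thesis unfolding y_def
      by (rule Hoelder_acceleration_imp_holder_C2[OF w w0 AE]) (use that in auto)
  qed
  ultimately show ?thesis by blast
qed

end
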